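(* (i) Let $\varepsilon>0$ and let $N\subset[\varepsilon,\infty)$ be a bounded countable set. Then $N=N_A$ for some nonempty compact set $A\subset\mathbb{R}^2$ if and only if $\lambda_1(\overline{N})=0$ and $G_{1/2}(\overline{N})<\infty$. (ii) Let $N\subset(0,\infty)$ be a bounded countable set. Then $N=N_A$ for some nonempty compact set $A\subset\mathbb{R}^2$ if and only if $\lambda_1(\overline{N})=0$ and $$\int_0^\infty G_{1/2}(\overline{N}\cap[r,\infty))\,\sqrt{r}\,dr<\infty.$$
   Context: For nonempty compact $A\subset\mathbb{R}^d$ (here $d=2$) and $r>0$, let $A_r:=\{x\in\mathbb{R}^d: d(x,A)<r\}$, where $d(x,A)=\min_{y\in A}|x-y|$, and $V_A(r):=\lambda_d(A_r)$, where $\lambda_d$ is Lebesgue measure on $\mathbb{R}^d$. $N_A\subset(0,\infty)$ denotes the set of all $s>0$ at which $V_A:(0,\infty)\to\mathbb{R}$ is not differentiable. $\overline{N}$ denotes the closure of $N$ in $\mathbb{R}$. For a compact set $K\subset\mathbb{R}$, the degree-$\frac12$ gap sum $G_{1/2}(K)\in[0,\infty]$ is the sum of the square roots of the lengths of all bounded connected components (bounded open intervals) of $\mathbb{R}\setminus K$; it equals $0$ if there are no such intervals (in particular if $K=\emptyset$). Countable includes finite. *)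

theory Defs
  imports "HOL-Analysis.Analysis"
begin

text \<open>
  For nonempty compact \<open>A\<close> the infimum in \<^const>\<open>infdist\<close> is attained, so \<^const>\<open>infdist\<close> is the
  minimal distance \<open>d(x, A)\<close>.
\<close>

definition parallel_set :: "'a::euclidean_space set \<Rightarrow> real \<Rightarrow> 'a set" where
  "parallel_set A r = {x. infdist x A < r}"

definition volume_function :: "'a::euclidean_space set \<Rightarrow> real \<Rightarrow> real" where
  "volume_function A r = measure lborel (parallel_set A r)"

text \<open>
  The volume function is meant as a function on the positive reals only; since that set is open,
  its values at nonpositive radii do not affect differentiability at \<open>s > 0\<close>.
\<close>

definition nondiff_radii :: "'a::euclidean_space set \<Rightarrow> real set" where
  "nondiff_radii A = {s. s > 0 \<and> \<not> volume_function A differentiable (at s)}"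

definition gaps :: "real set \<Rightarrow> real set set" where
  "gaps K = {I \<in> components (- K). bounded I}"

text \<open>The sum is taken in \<^typ>\<open>ennreal\<close>, where it always exists and may be infinite.\<close>

definition gap_sum_half :: "real set \<Rightarrow> ennreal" where
  "gap_sum_half K = (\<Sum>\<^sub>\<infinity>I\<in>gaps K. ennreal (sqrt (measure lborel I)))"

end

theory Submission
  imports Defs
begin

text \<open>
  \<^emph>\<open>Necessity.\<close> Let \<open>Q(\<sigma>)\<close> be the area of \<open>{d\<^sup>2 < \<sigma>}\<close>, so that \<open>V\<^sub>A(r) = Q(r\<^sup>2)\<close>. Shrinking towards nearest
  points shows that \<open>Q\<close> is concave, so \<open>V\<^sub>A\<close> is differentiable at \<open>r\<close> unless the right slope of \<open>Q\<close> at
  \<open>r\<^sup>2\<close> is smaller than the left one. At a point \<open>x\<close> which is not critical, \<open>d\<^sup>2\<close> increases along some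
  direction, and since \<open>|x|\<^sup>2 - d(x)\<^sup>2\<close> is convex, the shells inside and outside the level set have the
  same area near \<open>x\<close> up to second order. Hence every radius in \<open>N\<^sub>A\<close> is a critical value of \<open>d\<close>.
  Critical points satisfy \<open>|d(x)\<^sup>2 - d(y)\<^sup>2| \<le> |x - y|\<^sup>2\<close> and lie on finitely many Lipschitz graphs
  inside any ball whose radius is comparable to \<open>d\<close>; summing \<open>|x - y|\<close> along the graphs bounds the
  square roots of the gaps between critical values in \<open>[r, 2r]\<close> by the area of a shell around \<open>A\<close>.

  \<^emph>\<open>Sufficiency.\<close> The complement of \<open>A\<close> in a large rectangle is a union of disjoint holes, each symmetric about
  a horizontal axis. A hole is the union, over \<open>b\<close> in a piece of the closure of \<open>N\<close>, of the stadiums of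
  radius \<open>b\<close> around the segment \<open>[-\<psi>(b), \<psi>(b)]\<close> of the axis. The distance to \<open>A\<close> is constant \<open>= n\<close> on a
  segment of the axis, so that \<open>V\<^sub>A\<close> has a kink at \<open>n\<close>, exactly if \<open>\<psi>\<close> jumps at \<open>n\<close>; the jumps are put at
  the points of \<open>N\<close>. On a gap \<open>(a, b)\<close> the profile has to drop by at least \<open>\<surd>(b\<^sup>2 - a\<^sup>2)\<close>, and the
  gap sum condition makes it possible to stack countably many holes of bounded width and summable height.
\<close>

subsection \<open>Shrinking towards nearest points\<close>

text \<open>Concavity is sought in the squared radius because contracting towards nearest points by
  \<open>1 / sqrt m\<close> divides squared distances by \<open>m\<close> and plane areas by at most
  \<open>m\<close>; the equal factors are where dimension two enters. A hole has critical points of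
  its own, so a differentiability criterion that excludes all critical points at the level
  \<open>s\<close> would be too weak for the construction. Finitely many are therefore tolerated:
  within \<delta> of one of them the shell \<open>sqshell A (\<sigma> - h) \<sigma>\<close> has area
  of order \<delta> times \<open>h\<close>. The weight \<open>sqrt r\<close> comes from counting.
  Critical points at distances in [r, 2r] fall into O(a / r^2) cells, where a is the area of a
  surrounding shell, and a cell contributes O(sqrt r) to the roots of the gaps. The integral of
  \<open>sqrt r\<close> up to this scale has order r^(3/2) and turns the bound a r^(-3/2) into a,
  which is summable over dyadic shells. Conversely, after an exchange of integrals the same weight
  bounds the integral of \<open>x * dens x\<close>, and this controls the total height of holes of
  bounded width.\<close>

text \<open>The Vitali theorem covers \<open>S\<close>, up to a null set, by disjoint balls inside
  an open set slightly larger than \<open>Z\<close>, and a ball goes into a ball of \<open>L\<close>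
  times the radius. Balls make the constant exactly \<open>L\<close> to the dimension, and concavity
  depends on this exactness. \<open>S\<close> is an arbitrary subset of \<open>Z\<close> because
  nearest points will be chosen without measurability.\<close>

lemma emeasure_Lipschitz_image_le:
  fixes f :: "'a::euclidean_space \<Rightarrow> 'a"
  assumes Z: "Z \<in> sets borel" "S \<subseteq> Z" and L: "L > 0"
    and lip: "\<And>x y. x \<in> S \<Longrightarrow> y \<in> S \<Longrightarrow> dist (f x) (f y) \<le> L * dist x y"
    and Y: "Y \<in> sets borel" "Y \<subseteq> f ` S"
  shows "emeasure lborel Y \<le> ennreal (L ^ DIM('a)) * emeasure lborel Z"
proof (rule ennreal_le_epsilon)
  let ?n = "DIM('a)"
  fix e :: real assume e: "e > 0"
  define e' where "e' = e / L ^ ?n"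
  have e': "e' > 0" using e L by (simp add: e'_def)
  obtain U where U: "open U" "Z \<subseteq> U" "emeasure lborel (U - Z) < e'"
    using outer_regular_lborel[OF Z(1) e'] by blast
  define K where "K = {(x, \<rho>). x \<in> S \<and> \<rho> > 0 \<and> ball x \<rho> \<subseteq> U}"
  obtain C where C: "countable C" "C \<subseteq> K"
    and pw: "pairwise (\<lambda>i j. disjnt (ball (fst i) (snd i)) (ball (fst j) (snd j))) C"
    and neg: "negligible (S - (\<Union>i\<in>C. ball (fst i) (snd i)))"
  proof (rule Vitali_covering_theorem_balls[of S K fst snd])
    fix x and d :: real assume x: "x \<in> S" and d: "0 < d"
    obtain k where k: "k > 0" "ball x k \<subseteq> U"
      using U(1,2) x Z(2) by (meson openE subsetD)
    define \<rho> where "\<rho> = min (d/2) k"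
    have "(x, \<rho>) \<in> K" using x d k by (auto simp: K_def \<rho>_def)
    moreover have "\<rho> > 0" "\<rho> < d" using d k by (auto simp: \<rho>_def)
    ultimately show "\<exists>i. i \<in> K \<and> x \<in> ball (fst i) (snd i) \<and> snd i < d"
      by (intro exI[of _ "(x, \<rho>)"]) auto
  qed
  have CK: "fst i \<in> S" "snd i > 0" "ball (fst i) (snd i) \<subseteq> U" if "i \<in> C" for i
    using subsetD[OF C(2) that] by (auto simp: K_def split: prod.splits)
  define R where "R = S - (\<Union>i\<in>C. ball (fst i) (snd i))"
  have negR: "negligible (f ` R)"
  proof (rule negligible_locally_Lipschitz_image[OF order_refl])
    show "negligible R" using neg by (simp add: R_def)
    show "\<exists>T B. open T \<and> x \<in> T \<and> (\<forall>y\<in>R \<inter> T. norm (f y - f x) \<le> B * norm (y - x))" if "x \<in> R" for x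
      using that lip by (intro exI[of _ UNIV] exI[of _ L]) (auto simp: R_def dist_norm)
  qed
  obtain N where N: "N \<in> null_sets lborel" "f ` R \<subseteq> N"
    using negR unfolding negligible_iff_null_sets by (auto simp: null_sets_completion_iff2)
  have sub: "Y \<subseteq> N \<union> (\<Union>i\<in>C. cball (f (fst i)) (L * snd i))"
  proof
    fix y assume "y \<in> Y"
    then obtain x where x: "x \<in> S" "y = f x" using Y(2) by blast
    show "y \<in> N \<union> (\<Union>i\<in>C. cball (f (fst i)) (L * snd i))"
    proof (cases "x \<in> R")
      case True then show ?thesis using N(2) x by blast
    next
      case False
      then obtain i where i: "i \<in> C" "x \<in> ball (fst i) (snd i)" using x by (auto simp: R_def)
      have "dist (f (fst i)) y \<le> L * dist (fst i) x" using lip CK(1)[OF i(1)] x by auto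
      also have "\<dots> \<le> L * snd i" using i(2) L by simp
      finally show ?thesis using i(1) by auto
    qed
  qed
  define I where "I = to_nat_on C ` C"
  define c r where "c n = fst (from_nat_into C n)" and "r n = snd (from_nat_into C n)" for n
  define b b' where "b n = (if n \<in> I then ball (c n) (r n) else {})"
    and "b' n = (if n \<in> I then cball (f (c n)) (L * r n) else {})" for n
  have bC: "(\<Union>n. b n) = (\<Union>i\<in>C. ball (fst i) (snd i))" "(\<Union>n. b' n) = (\<Union>i\<in>C. cball (f (fst i)) (L * snd i))"
    using C(1) by (auto simp: b_def b'_def I_def c_def r_def split: if_splits)
  have "emeasure lborel (b' n) = ennreal (L ^ ?n) * emeasure lborel (b n)" for n
  proof (cases "n \<in> I")
    case True
    then have "r n > 0" using CK C(1) by (auto simp: r_def I_def)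
    then show ?thesis using L True
      by (simp add: b_def b'_def emeasure_ball emeasure_cball ennreal_mult'[symmetric] power_mult_distrib mult_ac)
  qed (simp add: b_def b'_def)
  then have eqb: "(\<Sum>n. emeasure lborel (b' n)) = ennreal (L ^ ?n) * (\<Sum>n. emeasure lborel (b n))"
    by simp
  have disj: "disjoint_family b"
    unfolding disjoint_family_on_def
  proof (intro ballI impI)
    fix m n :: nat assume "m \<noteq> n"
    show "b m \<inter> b n = {}"
    proof (cases "m \<in> I \<and> n \<in> I")
      case True
      then obtain i j where ij: "i \<in> C" "m = to_nat_on C i" "j \<in> C" "n = to_nat_on C j" by (auto simp: I_def)
      then have "i \<noteq> j" using \<open>m \<noteq> n\<close> by auto
      with ij pw have "ball (fst i) (snd i) \<inter> ball (fst j) (snd j) = {}"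
        by (auto simp: pairwise_def disjnt_def)
      then show ?thesis using ij C(1) by (simp add: b_def c_def r_def)
    qed (auto simp: b_def)
  qed
  have "emeasure lborel Y \<le> emeasure lborel (N \<union> (\<Union>n. b' n))"
    using N(1) sub unfolding bC(2)[symmetric] by (intro emeasure_mono) (auto simp: b'_def)
  also have "\<dots> \<le> emeasure lborel N + emeasure lborel (\<Union>n. b' n)"
    using N(1) by (intro emeasure_subadditive) (auto simp: b'_def)
  also have "\<dots> = emeasure lborel (\<Union>n. b' n)"
    using N(1) by auto
  also have "\<dots> \<le> (\<Sum>n. emeasure lborel (b' n))"
    by (rule emeasure_subadditive_countably) (auto simp: b'_def)
  also have "\<dots> = ennreal (L ^ ?n) * (\<Sum>n. emeasure lborel (b n))" by (rule eqb)
  also have "(\<Sum>n. emeasure lborel (b n)) = emeasure lborel (\<Union>n. b n)"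
    by (rule suminf_emeasure[OF _ disj]) (auto simp: b_def)
  also have "(\<Union>n. b n) = (\<Union>i\<in>C. ball (fst i) (snd i))" by (rule bC)
  also have "emeasure lborel \<dots> \<le> emeasure lborel U"
    using CK(3) U(1) by (intro emeasure_mono) auto
  also have "\<dots> = emeasure lborel (Z \<union> (U - Z))" using U(2) by (simp add: Un_absorb1)
  also have "\<dots> \<le> emeasure lborel Z + emeasure lborel (U - Z)"
    using Z(1) U(1) by (intro emeasure_subadditive) auto
  also have "\<dots> \<le> emeasure lborel Z + ennreal e'"
    using U(3) by (intro add_left_mono) simp
  finally have "emeasure lborel Y \<le> ennreal (L ^ ?n) * (emeasure lborel Z + ennreal e')"
    by (simp add: mult_left_mono)
  also have "\<dots> = ennreal (L ^ ?n) * emeasure lborel Z + ennreal e"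
    using e L by (simp add: distrib_left ennreal_mult'[symmetric] e'_def)
  finally show "emeasure lborel Y \<le> ennreal (L ^ ?n) * emeasure lborel Z + ennreal e" .
qed

definition nearest_points :: "'a::euclidean_space set \<Rightarrow> 'a \<Rightarrow> 'a set" where
  "nearest_points A x = {p \<in> A. dist x p = infdist x A}"

lemma nearest_points_nonempty:
  assumes "closed A" "A \<noteq> {}" obtains p where "p \<in> nearest_points A x"
  using infdist_attains_inf[OF assms, of x] by (metis (mono_tags, lifting) mem_Collect_eq nearest_points_def)

text \<open>Nearest points are subgradients of the convex function (|x|^2 - d(x)^2) / 2, a supremum
  of affine functions, and subgradients are monotone.\<close>

lemma nearest_points_monotone:
  assumes "p \<in> nearest_points A x" "p' \<in> nearest_points A x'"
  shows "(x - x') \<bullet> (p - p') \<ge> 0"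
proof -
  have "dist x p \<le> dist x p'" "dist x' p' \<le> dist x' p"
    using assms infdist_le[of p' A x] infdist_le[of p A x'] by (auto simp: nearest_points_def)
  then have "(dist x p)\<^sup>2 \<le> (dist x p')\<^sup>2" "(dist x' p')\<^sup>2 \<le> (dist x' p)\<^sup>2" by (auto intro: power_mono)
  then show ?thesis
    by (simp add: dist_norm power2_norm_eq_inner inner_diff inner_commute)
qed

text \<open>With \<open>z\<close> the contraction, \<open>L *\<^sub>R (z y - z y') = (y - y') + (L -
  1) *\<^sub>R (p y - p y')\<close>. By monotonicity the two summands have a nonnegative inner
  product, so the left side is at least as long as \<open>y - y'\<close>; the inverse of
  \<open>z\<close> is \<open>L\<close>-Lipschitz.\<close>

lemma emeasure_le_shrunk:
  fixes A :: "'a::euclidean_space set"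
  assumes Y: "Y \<in> sets borel" and Z: "Z \<in> sets borel" and l: "L \<ge> 1"
    and p: "\<And>y. y \<in> Y \<Longrightarrow> p y \<in> nearest_points A y \<and> p y + (y - p y) /\<^sub>R L \<in> Z"
  shows "emeasure lborel Y \<le> ennreal (L ^ DIM('a)) * emeasure lborel Z"
proof -
  define z where "z y = p y + (y - p y) /\<^sub>R L" for y
  have key: "dist y y' \<le> L * dist (z y) (z y')" if "y \<in> Y" "y' \<in> Y" for y y'
  proof -
    have e: "L *\<^sub>R (z y - z y') = (y - y') + (L - 1) *\<^sub>R (p y - p y')"
      using l by (simp add: z_def algebra_simps)
    have "(norm (y - y'))\<^sup>2 \<le> (norm (y - y'))\<^sup>2 + 2 * ((L - 1) * ((y - y') \<bullet> (p y - p y'))) + (norm ((L - 1) *\<^sub>R (p y - p y')))\<^sup>2"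
      using nearest_points_monotone[of "p y" A y "p y'" y'] p that l by simp
    also have "\<dots> = (norm (L *\<^sub>R (z y - z y')))\<^sup>2"
      unfolding e by (simp add: power2_norm_eq_inner inner_add inner_commute algebra_simps)
    finally have "norm (y - y') \<le> norm (L *\<^sub>R (z y - z y'))" by (rule power2_le_imp_le) simp
    then show ?thesis using l by (simp add: dist_norm)
  qed
  have inj: "inj_on z Y"
    using key by (intro inj_onI) (metis dist_le_zero_iff dist_self mult_zero_right)
  show ?thesis
  proof (rule emeasure_Lipschitz_image_le[of Z "z ` Y" L "inv_into Y z"])
    show "z ` Y \<subseteq> Z" using p by (auto simp: z_def)
    show "dist (inv_into Y z a) (inv_into Y z b) \<le> L * dist a b" if "a \<in> z ` Y" "b \<in> z ` Y" for a b
      using that key inj by auto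
    show "Y \<subseteq> inv_into Y z ` z ` Y" using inj by (simp add: image_image)
  qed (use l Y Z in auto)
qed

lemma infdist_shrunk:
  fixes A :: "'a::euclidean_space set"
  assumes p: "p \<in> nearest_points A y" and t: "0 \<le> t" "t \<le> 1"
  shows "p \<in> nearest_points A (p + t *\<^sub>R (y - p))" "infdist (p + t *\<^sub>R (y - p)) A = t * infdist y A"
proof -
  let ?z = "p + t *\<^sub>R (y - p)"
  have pA: "p \<in> A" "dist y p = infdist y A" using p by (auto simp: nearest_points_def)
  have zp: "dist ?z p = t * infdist y A"
    using t pA(2) by (simp add: dist_norm)
  have "y - ?z = (1 - t) *\<^sub>R (y - p)" by (simp add: algebra_simps)
  then have "dist y ?z = (1 - t) * infdist y A" using t pA(2) by (simp add: dist_norm)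
  then have "infdist ?z A \<ge> t * infdist y A"
    using infdist_triangle[of y A ?z] by (simp add: algebra_simps)
  moreover have "infdist ?z A \<le> t * infdist y A" using infdist_le[OF pA(1), of ?z] zp by simp
  ultimately show "infdist ?z A = t * infdist y A" by simp
  then show "p \<in> nearest_points A ?z" using zp pA by (simp add: nearest_points_def)
qed

subsection \<open>Concavity of the volume function\<close>

text \<open>Suppose \<open>Q\<close> dips below a chord and subtract the chord. Linear functions
  satisfy the scaling relation with equality, so the difference \<open>g\<close> inherits it. At the
  smallest minimiser \<open>z1\<close> of \<open>g\<close>, the step down to \<open>z1 / m\<close>
  raises \<open>g\<close> strictly while the step up to \<open>m * z1\<close> does not lower it,
  which contradicts scaling by \<open>m\<close>.\<close>

lemma concave_on_of_scaling:
  fixes Q :: "real \<Rightarrow> real"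
  assumes cont: "continuous_on {0<..} Q"
    and scal: "\<And>a b m. 0 < a \<Longrightarrow> a \<le> b \<Longrightarrow> 1 \<le> m \<Longrightarrow> Q (m * b) - Q (m * a) \<le> m * (Q b - Q a)"
  shows "concave_on {0<..} Q"
  unfolding concave_on_def
proof (rule convex_onI)
  fix t x y :: real assume t: "0 < t" "t < 1" and xy: "x \<in> {0<..}" "y \<in> {0<..}"
  have main: "Q ((1-s) * x + s * y) \<ge> (1-s) * Q x + s * Q y" if s: "0 < s" "s < 1" and xy: "0 < x" "x < y" for s x y
  proof (rule ccontr)
    assume neg: "\<not> ?thesis"
    define k where "k = (Q y - Q x) / (y - x)"
    define g where "g z = Q z - Q x - k * (z - x)" for z
    have g0: "g x = 0" "g y = 0" using xy by (auto simp: g_def k_def)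
    define z0 where "z0 = (1-s) * x + s * y"
    have z0x: "z0 - x = s * (y - x)" by (simp add: z0_def algebra_simps)
    have kz: "k * (z0 - x) = s * (Q y - Q x)" using xy by (simp add: z0x k_def)
    have gz0: "g z0 < 0" using neg unfolding g_def kz by (simp add: z0_def algebra_simps)
    have "0 < s * (y - x)" "s * (y - x) < 1 * (y - x)" using s xy by (auto intro: mult_strict_right_mono)
    then have z0: "z0 \<in> {x..y}" using z0x by auto
    have cg: "continuous_on {x..y} g" unfolding g_def
      by (intro continuous_intros continuous_on_subset[OF cont]) (use xy in auto)
    obtain zm where zm: "zm \<in> {x..y}" "\<And>z. z \<in> {x..y} \<Longrightarrow> g zm \<le> g z"
      using continuous_attains_inf[OF _ _ cg] z0 by auto
    define M where "M = {z \<in> {x..y}. g z = g zm}"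
    have "closed M" unfolding M_def by (rule continuous_closed_preimage_constant[OF cg]) auto
    moreover have "M \<subseteq> {x..y}" by (auto simp: M_def)
    ultimately have "compact M" by (metis bounded_closed_interval bounded_subset compact_eq_bounded_closed)
    moreover have "M \<noteq> {}" using zm by (auto simp: M_def)
    ultimately obtain z1 where z1: "z1 \<in> M" "\<And>z. z \<in> M \<Longrightarrow> z1 \<le> z" by (meson compact_attains_inf)
    have g1: "g z1 < 0" using z1(1) zm(2)[OF z0] gz0 by (auto simp: M_def)
    have z1i: "x < z1" "z1 < y" using z1(1) g1 g0 by (auto simp: M_def less_le)
    \<comment> \<open>The largest factor that keeps both \<open>z1 / m\<close> and
      \<open>m * z1\<close> in the interval.\<close>
    define m where "m = min (z1 / x) (y / z1)"
    have m1: "m > 1" using z1i xy by (simp add: m_def)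
    have "m \<le> z1 / x" "m \<le> y / z1" by (auto simp: m_def)
    then have mx: "x \<le> z1 / m" "z1 / m < z1" and my: "m * z1 \<le> y"
      using m1 z1i xy by (auto simp: field_simps)
    have my': "z1 \<le> m * z1" using m1 z1i xy by simp
    have "z1 / m \<notin> M" using mx z1(2) by force
    moreover have "z1 / m \<in> {x..y}" using mx z1i by auto
    ultimately have a: "g z1 < g (z1 / m)" using zm(2)[of "z1/m"] z1(1) by (force simp: M_def)
    have b: "g z1 \<le> g (m * z1)" using zm(2)[of "m * z1"] z1(1) my my' z1i by (auto simp: M_def)
    have "Q (m * z1) - Q (m * (z1 / m)) \<le> m * (Q z1 - Q (z1 / m))"
      by (rule scal) (use mx xy m1 in auto)
    then have c: "Q (m * z1) - Q z1 \<le> m * (Q z1 - Q (z1 / m))" using m1 by simp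
    have "Q z1 - Q (z1/m) < k * (z1 - z1 / m)"
      using a by (simp add: g_def algebra_simps)
    then have "m * (Q z1 - Q (z1/m)) < m * (k * (z1 - z1 / m))"
      using m1 by simp
    also have "\<dots> = k * (m * z1 - z1)" using m1 by (simp add: field_simps)
    also have "\<dots> \<le> Q (m * z1) - Q z1" using b by (simp add: g_def algebra_simps)
    finally show False using c by simp
  qed
  show "- Q ((1 - t) *\<^sub>R x + t *\<^sub>R y) \<le> (1 - t) * - Q x + t * - Q y"
  proof (cases x y rule: linorder_cases)
    case less then show ?thesis using main[of t x y] t xy by simp
  next
    case equal then show ?thesis by (simp add: algebra_simps)
  next
    case greater then show ?thesis using main[of "1-t" y x] t xy by (simp add: add.commute)
  qed
qed (simp add: convex_real_interval)

lemma concave_slopes: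
  fixes f :: "real \<Rightarrow> real"
  assumes c: "concave_on S f" and S: "x \<in> S" "z \<in> S" and xyz: "x < y" "y < z"
  shows "(f z - f y) / (z - y) \<le> (f z - f x) / (z - x)" "(f z - f x) / (z - x) \<le> (f y - f x) / (y - x)"
proof -
  have "convex_on S (\<lambda>x. - f x)" using c by (simp add: concave_on_def)
  from convex_on_slope_le[OF this S xyz] show "(f z - f y) / (z - y) \<le> (f z - f x) / (z - x)" "(f z - f x) / (z - x) \<le> (f y - f x) / (y - x)"
    using xyz by (auto simp: field_simps)
qed

text \<open>Difference quotients of a concave function are monotone in the step. Once the left and
  right quotients at a single step \<open>h\<close> are \<open>e\<close>-close, all quotients with
  smaller steps are trapped between them.\<close>

lemma concave_differentiable:
  fixes f :: "real \<Rightarrow> real"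
  assumes c: "concave_on {0<..} f" and s: "s > 0"
    and small: "\<And>e. e > 0 \<Longrightarrow> \<exists>h>0. h < s \<and> (f s - f (s - h)) - (f (s + h) - f s) \<le> e * h"
  shows "f differentiable (at s)"
proof -
  define R where "R h = (f (s + h) - f s) / h" for h
  define L where "L h = (f s - f (s - h)) / h" for h
  have RL: "R h \<le> L k" if "0 < h" "0 < k" "k < s" for h k
    using concave_slopes[OF c, of "s - k" "s + h" s] that s by (simp add: R_def L_def)
  have R: "R h \<le> R k" if "0 < k" "k \<le> h" for h k
    using concave_slopes(2)[OF c, of s "s + h" "s + k"] that s by (cases "k = h") (auto simp: R_def)
  have L: "L k \<le> L h" if "0 < k" "k \<le> h" "h < s" for h k
    using concave_slopes(1)[OF c, of "s - h" s "s - k"] that s by (cases "k = h") (auto simp: L_def)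
  define D where "D = Inf (L ` {0<..<s})"
  have bdd: "bdd_below (L ` {0<..<s})" by (rule bdd_belowI2[of _ "R 1"]) (use RL in auto)
  have DL: "D \<le> L h" if "0 < h" "h < s" for h
    unfolding D_def by (rule cInf_lower[OF _ bdd]) (use that in auto)
  have RD: "R h \<le> D" if "0 < h" for h
    unfolding D_def by (rule cInf_greatest) (use that s RL in auto)
  have "(\<lambda>h. (f (s + h) - f s) / h) \<midarrow>0\<rightarrow> D"
  proof (rule LIM_I)
    fix e :: real assume "e > 0"
    then obtain h where h: "h > 0" "h < s" "(f s - f (s - h)) - (f (s + h) - f s) \<le> e/2 * h"
      using small[of "e/2"] by auto
    have "L h - R h = ((f s - f (s - h)) - (f (s + h) - f s)) / h" by (simp add: L_def R_def diff_divide_distrib add_divide_distrib)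
    also have "\<dots> \<le> e / 2" using h by (simp add: pos_divide_le_eq)
    finally have "L h - R h \<le> e / 2" .
    moreover have "\<bar>(f (s + k) - f s) / k - D\<bar> \<le> L h - R h" if k: "k \<noteq> 0" "\<bar>k\<bar> < h" for k
    proof (cases "k > 0")
      case True
      then have "R h \<le> R k" "R k \<le> D" "D \<le> L h" using R RD DL k h by auto
      then show ?thesis by (simp add: R_def)
    next
      case False
      then have "L (-k) \<le> L h" "D \<le> L (-k)" "R h \<le> D" using L DL RD k h by auto
      moreover have "L (-k) = (f (s + k) - f s) / k" by (simp add: L_def minus_divide_right[symmetric] minus_divide_left)
      ultimately show ?thesis by simp
    qed
    ultimately show "\<exists>d>0. \<forall>x. x \<noteq> 0 \<and> norm (x - 0) < d \<longrightarrow> norm ((f (s + x) - f s) / x - D) < e"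
      using h \<open>e > 0\<close> by (intro exI[of _ h]) force
  qed
  then have "(f has_field_derivative D) (at s)" by (simp add: DERIV_def)
  then show ?thesis by (auto simp: real_differentiable_def)
qed

section \<open>Areas of shells of the squared distance\<close>

definition sqvol :: "'a::euclidean_space set \<Rightarrow> real \<Rightarrow> real" where
  "sqvol A s = measure lborel {x. (infdist x A)\<^sup>2 < s}"

text \<open>Half open, so that consecutive shells are disjoint and differences of
  \<open>sqvol\<close> are exactly their areas.\<close>

definition sqshell :: "'a::euclidean_space set \<Rightarrow> real \<Rightarrow> real \<Rightarrow> 'a set" where
  "sqshell A a b = {x. a \<le> (infdist x A)\<^sup>2 \<and> (infdist x A)\<^sup>2 < b}"

lemma borel_measurable_infdist [measurable]: "(\<lambda>x. infdist x A) \<in> borel_measurable borel"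
  by (intro borel_measurable_continuous_onI continuous_intros)

lemma sqshell_borel [measurable]: "sqshell A a b \<in> sets borel"
  unfolding sqshell_def by measurable

lemma bounded_sq_less:
  fixes A :: "'a::euclidean_space set"
  assumes "compact A" "A \<noteq> {}"
  shows "bounded {x. (infdist x A)\<^sup>2 < s}"
proof -
  obtain B where B: "\<And>a. a \<in> A \<Longrightarrow> norm a \<le> B"
    using compact_imp_bounded[OF assms(1)] by (auto simp: bounded_iff)
  have "norm x \<le> B + sqrt s" if "(infdist x A)\<^sup>2 < s" for x
  proof -
    obtain p where p: "p \<in> nearest_points A x"
      using nearest_points_nonempty compact_imp_closed[OF assms(1)] assms(2) by metis
    then have "dist x p \<le> sqrt s" using that by (simp add: nearest_points_def real_le_rsqrt)
    moreover have "norm p \<le> B" using p B by (auto simp: nearest_points_def)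
    ultimately show ?thesis using norm_triangle_sub[of x p] by (simp add: dist_norm)
  qed
  then show ?thesis by (auto simp: bounded_iff)
qed

context
  fixes A :: "'a::euclidean_space set"
  assumes A: "compact A" "A \<noteq> {}"
begin

lemma sqshell_fmeasurable: "sqshell A a b \<in> fmeasurable lborel"
proof (rule fmeasurableI)
  have "bounded (sqshell A a b)"
    by (rule bounded_subset[OF bounded_sq_less[OF A, of b]]) (auto simp: sqshell_def)
  from emeasure_bounded_finite[OF this] show "emeasure lborel (sqshell A a b) < \<infinity>" .
qed auto

lemma sqvol_diff: "a \<le> b \<Longrightarrow> sqvol A b - sqvol A a = measure lborel (sqshell A a b)"
proof -
  assume ab: "a \<le> b"
  have fm: "{x. (infdist x A)\<^sup>2 < s} \<in> fmeasurable lborel" for s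
    by (rule fmeasurableI, measurable, rule emeasure_bounded_finite, rule bounded_sq_less[OF A])
  have "sqshell A a b = {x. (infdist x A)\<^sup>2 < b} - {x. (infdist x A)\<^sup>2 < a}" by (auto simp: sqshell_def)
  also have "measure lborel \<dots> = sqvol A b - sqvol A a"
    unfolding sqvol_def using ab by (intro measurable_measure_Diff fm) auto
  finally show ?thesis by simp
qed

lemma sqvol_mono: "a \<le> b \<Longrightarrow> sqvol A a \<le> sqvol A b"
  using sqvol_diff[of a b] by (metis diff_ge_0_iff_ge measure_nonneg)

end


lemma emeasure_le_shrunk_plane:
  fixes A :: "(real^2) set"
  assumes A: "compact A" "A \<noteq> {}" and Y: "Y \<in> sets borel" and Z: "Z \<in> sets borel" and m: "m \<ge> 1"
    and sub: "\<And>y p. y \<in> Y \<Longrightarrow> p \<in> nearest_points A y \<Longrightarrow> p + (1 / sqrt m) *\<^sub>R (y - p) \<in> Z"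
  shows "emeasure lborel Y \<le> ennreal m * emeasure lborel Z"
proof -
  define p where "p y = (SOME p. p \<in> nearest_points A y)" for y
  have p: "p y \<in> nearest_points A y" for y
    using nearest_points_nonempty[OF compact_imp_closed[OF A(1)] A(2), of y] unfolding p_def by (metis someI_ex)
  have "emeasure lborel Y \<le> ennreal (sqrt m ^ DIM(real^2)) * emeasure lborel Z"
    using sub p m by (intro emeasure_le_shrunk[OF Y Z, of _ p A]) (auto simp: inverse_eq_divide)
  then show ?thesis using m by simp
qed

lemma sqvol_scaling:
  fixes A :: "(real^2) set"
  assumes A: "compact A" "A \<noteq> {}" and ab: "a \<le> b" and m: "1 \<le> m"
  shows "sqvol A (m * b) - sqvol A (m * a) \<le> m * (sqvol A b - sqvol A a)"
proof -
  have "emeasure lborel (sqshell A (m * a) (m * b)) \<le> ennreal m * emeasure lborel (sqshell A a b)"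
  proof (rule emeasure_le_shrunk_plane[OF A _ _ m])
    fix y p assume y: "y \<in> sqshell A (m * a) (m * b)" and p: "p \<in> nearest_points A y"
    have "(infdist (p + (1 / sqrt m) *\<^sub>R (y - p)) A)\<^sup>2 = (infdist y A)\<^sup>2 / m"
      using infdist_shrunk(2)[OF p, of "1 / sqrt m"] m by (simp add: power_divide)
    then show "p + (1 / sqrt m) *\<^sub>R (y - p) \<in> sqshell A a b"
      using y m unfolding sqshell_def mem_Collect_eq by (simp add: pos_le_divide_eq pos_divide_less_eq mult.commute)
  qed auto
  then have "measure lborel (sqshell A (m * a) (m * b)) \<le> m * measure lborel (sqshell A a b)"
    using sqshell_fmeasurable[OF A] m
    by (simp add: emeasure_eq_measure2 ennreal_mult'[symmetric])
  moreover have "m * a \<le> m * b" using ab m by simp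
  ultimately show ?thesis using sqvol_diff[OF A] ab by metis
qed

text \<open>
  The shell is shrunk by \<open>n\<close> different factors, which gives \<open>n\<close> disjoint shells of comparable area.
\<close>

lemma emeasure_sqshell_Int_le:
  fixes A :: "(real^2) set"
  assumes A: "compact A" "A \<noteq> {}" and X: "X \<in> sets borel" and W: "W \<in> sets borel"
    and th: "0 < \<theta>" "\<theta> \<le> 1/2" and h: "0 < h" "h \<le> \<theta> * s"
    and sub: "\<And>y p t. y \<in> X \<Longrightarrow> (infdist y A)\<^sup>2 < s \<Longrightarrow> p \<in> nearest_points A y \<Longrightarrow> 1 - \<theta> \<le> t \<Longrightarrow> t \<le> 1
            \<Longrightarrow> p + t *\<^sub>R (y - p) \<in> W"
  shows "emeasure lborel (sqshell A (s - h) s \<inter> X) \<le> ennreal (4 * h / (\<theta> * s)) * emeasure lborel W"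
proof -
  have s: "s > 0" using h th zero_less_mult_pos[of \<theta> s] by auto
  define \<rho> where "\<rho> = 1 - h / s"
  have hs: "h / s \<le> \<theta>" using h s by (simp add: field_simps)
  have r: "0 < \<rho>" "\<rho> < 1" using hs th h(1) s by (simp_all add: \<rho>_def del: divide_less_eq_1_pos)
  have rs: "s - h = \<rho> * s" using s by (simp add: \<rho>_def field_simps)
  \<comment> \<open>About \<open>\<theta> * s / h\<close> consecutive shells of ratio
    \<open>\<rho>\<close> fit before the factor falls below \<open>1 - \<theta>\<close> (Bernoulli),
    which is at least 1/2. Rounding down costs a factor 2 and stretching a shell back another 2;
    together they are the 4 of the statement.\<close>
  define n where "n = nat \<lfloor>\<theta> * s / h\<rfloor>"
  have q1: "\<theta> * s / h \<ge> 1" using h by simp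
  have n: "real n \<le> \<theta> * s / h" "real n \<ge> \<theta> * s / (2 * h)" 
  proof -
    have "real n = \<lfloor>\<theta> * s / h\<rfloor>" using q1 by (simp add: n_def)
    then show "real n \<le> \<theta> * s / h" by simp
    have "real n \<ge> 1" using q1 by (simp add: n_def)
    moreover have "real n > \<theta> * s / h - 1" using \<open>real n = _\<close> by linarith
    moreover have "\<theta> * s / (2 * h) = (\<theta> * s / h) / 2" by simp
    ultimately show "real n \<ge> \<theta> * s / (2 * h)" using q1 by linarith
  qed
  have ri: "1 - \<theta> \<le> \<rho> ^ i" if "i < n" for i
  proof -
    have "1 + real i * (- (h / s)) \<le> (1 + (- (h/s))) ^ i"
      by (rule Bernoulli_inequality) (use hs th in auto)
    moreover have "real i * (h / s) \<le> \<theta>"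
    proof -
      have "real i * (h / s) \<le> (\<theta> * s / h) * (h / s)" using that n(1) h s by (intro mult_right_mono) auto
      then show ?thesis using h s by simp
    qed
    ultimately show ?thesis by (simp add: \<rho>_def)
  qed
  define Z where "Z i = sqshell A (\<rho> ^ Suc i * s) (\<rho> ^ i * s) \<inter> W" for i
  let ?Y = "sqshell A (s - h) s \<inter> X"
  have Z: "emeasure lborel ?Y \<le> ennreal 2 * emeasure lborel (Z i)" if i: "i < n" for i
  proof -
    have half: "1/2 \<le> \<rho> ^ i" using ri[OF i] th by simp
    have le1: "\<rho> ^ i \<le> 1" using r by (simp add: power_le_one)
    have m: "1 / \<rho> ^ i \<ge> 1" "1 / \<rho> ^ i \<le> 2" using half le1 r by (auto simp: field_simps)
    have "emeasure lborel ?Y \<le> ennreal (1 / \<rho> ^ i) * emeasure lborel (Z i)"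
    proof (rule emeasure_le_shrunk_plane[OF A _ _ m(1)])
      show "?Y \<in> sets borel" "Z i \<in> sets borel" using X W by (auto simp: Z_def)
      fix y p assume y: "y \<in> ?Y" and p: "p \<in> nearest_points A y"
      define t where "t = 1 / sqrt (1 / \<rho> ^ i)"
      have t: "t = sqrt (\<rho> ^ i)" by (simp add: t_def real_sqrt_divide)
      have tr: "\<rho> ^ i \<le> t" unfolding t using le1 r
        by (intro real_le_rsqrt) (simp add: power2_eq_square mult_left_le)
      have t1: "t \<le> 1" "1 - \<theta> \<le> t" "0 \<le> t" using tr ri[OF i] le1 th t by auto
      have "(infdist (p + t *\<^sub>R (y - p)) A)\<^sup>2 = \<rho> ^ i * (infdist y A)\<^sup>2"
        using infdist_shrunk(2)[OF p t1(3,1)] r t by (simp add: power_mult_distrib)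
      then show "p + (1 / sqrt (1 / \<rho> ^ i)) *\<^sub>R (y - p) \<in> Z i"
        unfolding t_def[symmetric] using y p sub t1 r rs
        by (auto simp: Z_def sqshell_def mult_ac)
    qed
    also have "\<dots> \<le> ennreal 2 * emeasure lborel (Z i)" using m by (intro mult_right_mono ennreal_leI) auto
    finally show ?thesis .
  qed
  have disj: "disjoint_family_on Z {..<n}"
    unfolding disjoint_family_on_def
  proof (intro ballI impI)
    have *: "Z i \<inter> Z j = {}" if "i < j" for i j
    proof -
      have "\<rho> ^ j \<le> \<rho> ^ Suc i" using that r by (intro power_decreasing) auto
      then have "\<rho> ^ j * s \<le> \<rho> ^ Suc i * s" using s by (intro mult_right_mono) auto
      then show ?thesis by (auto simp: Z_def sqshell_def)
    qed
    show "Z i \<inter> Z j = {}" if "i \<noteq> j" for i j using *[of i j] *[of j i] that by (cases "i < j") auto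
  qed
  have "ennreal (real n) * emeasure lborel ?Y = (\<Sum>i<n. emeasure lborel ?Y)"
    by (simp add: ennreal_of_nat_eq_real_of_nat)
  also have "\<dots> \<le> (\<Sum>i<n. ennreal 2 * emeasure lborel (Z i))" by (intro sum_mono Z) auto
  also have "\<dots> = ennreal 2 * emeasure lborel (\<Union>i<n. Z i)"
    using disj W by (subst sum_emeasure[symmetric]) (auto simp: sum_distrib_left Z_def)
  also have "\<dots> \<le> ennreal 2 * emeasure lborel W"
    using W by (intro mult_left_mono emeasure_mono) (auto simp: Z_def)
  finally have 1: "ennreal (real n) * emeasure lborel ?Y \<le> ennreal 2 * emeasure lborel W" .
  have c: "4 * h / (\<theta> * s) = (2 * h / (\<theta> * s)) * 2" "0 \<le> 2 * h / (\<theta> * s)" using h th s by auto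
  have "(2 * h / (\<theta> * s)) * (\<theta> * s / (2 * h)) \<le> (2 * h / (\<theta> * s)) * real n"
    using n(2) c(2) by (intro mult_left_mono)
  then have "1 \<le> (2 * h / (\<theta> * s)) * real n" using h th s by simp
  then have "1 * emeasure lborel ?Y \<le> ennreal ((2 * h / (\<theta> * s)) * real n) * emeasure lborel ?Y"
    by (intro mult_right_mono) (auto simp flip: ennreal_1 intro: ennreal_leI)
  also have "\<dots> = ennreal (2 * h / (\<theta> * s)) * (ennreal (real n) * emeasure lborel ?Y)"
    by (subst ennreal_mult[OF c(2)]) (simp_all only: mult.assoc of_nat_0_le_iff)
  also have "\<dots> \<le> ennreal (2 * h / (\<theta> * s)) * (ennreal 2 * emeasure lborel W)"
    by (intro mult_left_mono 1) auto
  also have "\<dots> = ennreal (4 * h / (\<theta> * s)) * emeasure lborel W"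
    unfolding c(1) by (subst ennreal_mult[OF c(2)]) (simp_all only: mult.assoc zero_le_numeral)
  finally show ?thesis by simp
qed

text \<open>The shrinking estimate with \<open>\<theta> = 1/2\<close> and with the whole parallel
  set as target; 8 is 4 divided by 1/2. It gives the local Lipschitz bound, hence the continuity
  that the concavity argument presupposes.\<close>

lemma sqvol_left_le:
  fixes A :: "(real^2) set"
  assumes A: "compact A" "A \<noteq> {}" and h: "0 < h" "h \<le> s / 2"
  shows "sqvol A s - sqvol A (s - h) \<le> 8 * h / s * sqvol A s"
proof -
  have fm: "{x. (infdist x A)\<^sup>2 < s} \<in> fmeasurable lborel"
    by (rule fmeasurableI, measurable, rule emeasure_bounded_finite, rule bounded_sq_less[OF A])
  have "emeasure lborel (sqshell A (s - h) s \<inter> UNIV)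
      \<le> ennreal (4 * h / (1/2 * s)) * emeasure lborel {x. (infdist x A)\<^sup>2 < s}"
  proof (rule emeasure_sqshell_Int_le[OF A])
    fix y p t assume "(infdist y A)\<^sup>2 < s" and p: "p \<in> nearest_points A y" and t: "1 - 1/2 \<le> t" "t \<le> (1::real)"
    moreover have "infdist (p + t *\<^sub>R (y - p)) A \<le> infdist y A"
      using infdist_shrunk(2)[OF p] t by (simp add: mult_left_le_one_le infdist_nonneg)
    ultimately show "p + t *\<^sub>R (y - p) \<in> {x. (infdist x A)\<^sup>2 < s}"
      by (auto intro: le_less_trans[OF power_mono] simp: infdist_nonneg)
  qed (use h fm in \<open>auto dest: fmeasurableD\<close>)
  then have "measure lborel (sqshell A (s - h) s) \<le> 8 * h / s * sqvol A s"
    unfolding sqvol_def using sqshell_fmeasurable[OF A] fm h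
    by (simp add: emeasure_eq_measure2 ennreal_mult'[symmetric])
  then show ?thesis using sqvol_diff[OF A, of "s - h" s] h by simp
qed

lemma sqvol_continuous:
  fixes A :: "(real^2) set"
  assumes A: "compact A" "A \<noteq> {}"
  shows "continuous_on {0<..} (sqvol A)"
proof -
  have "isCont (sqvol A) s" if s: "s > 0" for s
  proof -
    define C where "C = 16 / s * sqvol A (2 * s)"
    have sv: "sqvol A u \<ge> 0" for u by (simp add: sqvol_def)
    have key: "sqvol A v - sqvol A u \<le> C * (v - u)" if "3/4 * s \<le> u" "u < v" "v \<le> 5/4 * s" for u v
    proof -
      have "sqvol A v - sqvol A u \<le> 8 * (v - u) / v * sqvol A v"
        using sqvol_left_le[OF A, of "v - u" v] that s by auto
      also have "\<dots> \<le> 8 * (v - u) / (s / 2) * sqvol A (2 * s)"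
        using that s by (intro mult_mono divide_left_mono sqvol_mono[OF A] sv) auto
      finally show ?thesis by (simp add: C_def field_simps)
    qed
    have C: "C \<ge> 0" using sv s by (simp add: C_def)
    have bound: "\<bar>sqvol A u - sqvol A s\<bar> \<le> C * \<bar>u - s\<bar>" if "\<bar>u - s\<bar> < s/4" for u
    proof (cases u s rule: linorder_cases)
      case less
      then show ?thesis using key[of u s] sqvol_mono[OF A, of u s] that s by (auto simp: abs_if)
    next
      case greater
      then show ?thesis using key[of s u] sqvol_mono[OF A, of s u] that s by (auto simp: abs_if)
    qed auto
    have "((\<lambda>u. sqvol A u - sqvol A s) \<longlongrightarrow> 0) (at s)"
    proof (rule Lim_null_comparison)
      show "\<forall>\<^sub>F u in at s. norm (sqvol A u - sqvol A s) \<le> C * \<bar>u - s\<bar>"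
        unfolding eventually_at using bound s by (intro exI[of _ "s/4"]) (auto simp: dist_real_def)
      have "((\<lambda>u. C * \<bar>u - s\<bar>) \<longlongrightarrow> C * \<bar>s - s\<bar>) (at s)" by (intro tendsto_intros)
      then show "((\<lambda>u. C * \<bar>u - s\<bar>) \<longlongrightarrow> 0) (at s)" by simp
    qed
    then show ?thesis by (simp add: isCont_def LIM_zero_iff)
  qed
  then show ?thesis by (auto intro!: continuous_at_imp_continuous_on)
qed

lemma sqvol_concave:
  fixes A :: "(real^2) set"
  assumes "compact A" "A \<noteq> {}"
  shows "concave_on {0<..} (sqvol A)"
  by (rule concave_on_of_scaling[OF sqvol_continuous[OF assms]]) (use sqvol_scaling[OF assms] in auto)

lemma volume_function_eq_sqvol:
  assumes "r > 0" shows "volume_function A r = sqvol A (r\<^sup>2)"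
proof -
  have "infdist x A < r \<longleftrightarrow> (infdist x A)\<^sup>2 < r\<^sup>2" for x
    using assms infdist_nonneg[of x A] by (meson power_strict_mono power_less_imp_less_base less_imp_le pos2)
  then show ?thesis by (simp add: volume_function_def parallel_set_def sqvol_def)
qed

lemma volume_function_differentiable_iff:
  assumes "s > 0"
  shows "volume_function A differentiable (at s) \<longleftrightarrow> sqvol A differentiable (at (s\<^sup>2))"
proof
  assume "sqvol A differentiable (at (s\<^sup>2))"
  then obtain D where D: "(sqvol A has_field_derivative D) (at (s\<^sup>2))" by (auto simp: real_differentiable_def)
  have "((\<lambda>r. r\<^sup>2) has_field_derivative 2 * s) (at s)" by (auto intro!: derivative_eq_intros)
  from DERIV_chain2[OF D this] have "(volume_function A has_field_derivative D * (2 * s)) (at s)"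
    by (rule has_field_derivative_transform_within_open[of _ _ _ "{0<..}"]) (use assms in \<open>auto simp: volume_function_eq_sqvol\<close>)
  then show "volume_function A differentiable (at s)" by (auto simp: real_differentiable_def)
next
  assume "volume_function A differentiable (at s)"
  then obtain D where "(volume_function A has_field_derivative D) (at s)" by (auto simp: real_differentiable_def)
  then have D: "(volume_function A has_field_derivative D) (at (sqrt (s\<^sup>2)))" using assms by simp
  have "(sqrt has_field_derivative inverse (sqrt (s\<^sup>2)) / 2) (at (s\<^sup>2))"
    using assms by (intro DERIV_real_sqrt) auto
  from DERIV_chain2[OF D this] have "(sqvol A has_field_derivative D * (inverse (sqrt (s\<^sup>2)) / 2)) (at (s\<^sup>2))"
    by (rule has_field_derivative_transform_within_open[of _ _ _ "{0<..}"]) (use assms in \<open>auto simp: volume_function_eq_sqvol\<close>)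
  then show "sqvol A differentiable (at (s\<^sup>2))" by (auto simp: real_differentiable_def)
qed

subsection \<open>Critical points and differentiability\<close>

text \<open>Equivalently, \<open>x\<close> lies outside \<open>A\<close> and in the convex hull of
  its nearest points: by separation and compactness, this fails exactly if some \<open>v\<close> has
  positive inner product with every \<open>x - p\<close>. The dual form lets each proof choose a
  test direction \<open>v\<close>.\<close>

definition critical_point :: "'a::euclidean_space set \<Rightarrow> 'a \<Rightarrow> bool" where
  "critical_point A x \<longleftrightarrow> infdist x A > 0 \<and> (\<forall>v. \<exists>p\<in>nearest_points A x. (x - p) \<bullet> v \<le> 0)"

lemma nearest_points_limit:
  fixes A :: "'a::euclidean_space set"
  assumes "compact A" and X: "X \<longlonglongrightarrow> x" and P: "\<And>n. P n \<in> nearest_points A (X n)"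
  obtains p r where "p \<in> nearest_points A x" "strict_mono r" "(P \<circ> r) \<longlonglongrightarrow> p"
proof -
  have "\<forall>n. P n \<in> A" using P by (auto simp: nearest_points_def)
  then obtain p r where p: "p \<in> A" "strict_mono r" "(P \<circ> r) \<longlonglongrightarrow> p"
    using \<open>compact A\<close> unfolding compact_def by blast
  have Xr: "(X \<circ> r) \<longlonglongrightarrow> x" using X p(2) by (rule LIMSEQ_subseq_LIMSEQ)
  have "(\<lambda>n. dist ((X \<circ> r) n) ((P \<circ> r) n)) \<longlonglongrightarrow> dist x p" by (intro tendsto_dist Xr p)
  moreover have "(\<lambda>n. infdist ((X \<circ> r) n) A) \<longlonglongrightarrow> infdist x A" by (intro tendsto_infdist Xr)
  moreover have "dist ((X \<circ> r) n) ((P \<circ> r) n) = infdist ((X \<circ> r) n) A" for n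
    using P by (auto simp: nearest_points_def)
  ultimately have "dist x p = infdist x A" using LIMSEQ_unique by simp
  then show ?thesis using that p by (auto simp: nearest_points_def)
qed

text \<open>The nearest point of \<open>x\<close> stays a competitor for \<open>x + w\<close>. This
  one-sided quadratic bound is the source of all later estimates of the squared distance.\<close>

lemma infdist_sq_le:
  assumes "p \<in> nearest_points A x"
  shows "(infdist (x + w) A)\<^sup>2 \<le> (infdist x A)\<^sup>2 + 2 * ((x - p) \<bullet> w) + (norm w)\<^sup>2"
proof -
  have p: "p \<in> A" "norm (x - p) = infdist x A" using assms by (auto simp: nearest_points_def dist_norm)
  have "infdist (x + w) A \<le> norm ((x - p) + w)"
    using infdist_le[OF p(1), of "x + w"] by (simp add: dist_norm algebra_simps)
  then have "(infdist (x + w) A)\<^sup>2 \<le> (norm ((x - p) + w))\<^sup>2" by (intro power_mono infdist_nonneg)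
  also have "\<dots> = (norm (x - p))\<^sup>2 + 2 * ((x - p) \<bullet> w) + (norm w)\<^sup>2"
    by (simp add: power2_norm_eq_inner inner_add inner_commute)
  finally show ?thesis using p by simp
qed

text \<open>If no uniform \<open>c\<close> existed, points tending to \<open>x0\<close> would have
  nearest points with smaller and smaller inner products; these accumulate at a nearest point of
  \<open>x0\<close> where the inner product is not positive.\<close>

lemma regular_neighbourhood:
  fixes A :: "'a::euclidean_space set"
  assumes A: "compact A" "A \<noteq> {}" and x0: "infdist x0 A > 0" "\<not> critical_point A x0"
  obtains v c d where "norm v = 1" "c > 0" "d > 0"
    "\<And>x p. x \<in> ball x0 d \<Longrightarrow> p \<in> nearest_points A x \<Longrightarrow> (x - p) \<bullet> v \<ge> c"
proof -
  obtain v0 where v0: "\<And>p. p \<in> nearest_points A x0 \<Longrightarrow> (x0 - p) \<bullet> v0 > 0"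
    using x0 by (force simp: critical_point_def not_le)
  obtain p0 where "p0 \<in> nearest_points A x0"
    using nearest_points_nonempty compact_imp_closed[OF A(1)] A(2) by metis
  then have "v0 \<noteq> 0" using v0 by fastforce
  define v where "v = v0 /\<^sub>R norm v0"
  have nv: "norm v = 1" using \<open>v0 \<noteq> 0\<close> by (simp add: v_def)
  have v: "(x0 - p) \<bullet> v > 0" if "p \<in> nearest_points A x0" for p
    using v0[OF that] \<open>v0 \<noteq> 0\<close> by (simp add: v_def)
  have "\<exists>e>0. \<forall>x p. x \<in> ball x0 e \<longrightarrow> p \<in> nearest_points A x \<longrightarrow> (x - p) \<bullet> v \<ge> e"
  proof (rule ccontr)
    assume "\<not> ?thesis"
    then have "\<And>e. e > 0 \<Longrightarrow> \<exists>x p. x \<in> ball x0 e \<and> p \<in> nearest_points A x \<and> (x - p) \<bullet> v < e"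
      by (auto simp: not_le)
    then have "\<exists>x p. x \<in> ball x0 (inverse (real (Suc n))) \<and> p \<in> nearest_points A x \<and> (x - p) \<bullet> v < inverse (real (Suc n))" for n
      by simp
    then obtain X P where XP: "\<And>n. X n \<in> ball x0 (inverse (real (Suc n)))" "\<And>n. P n \<in> nearest_points A (X n)"
        "\<And>n. (X n - P n) \<bullet> v < inverse (real (Suc n))"
      by metis
    have X0: "X \<longlonglongrightarrow> x0"
    proof (rule metric_LIMSEQ_I)
      fix e :: real assume "e > 0"
      then obtain N where N: "inverse (real (Suc N)) < e" using reals_Archimedean by blast
      have "dist (X n) x0 < e" if "n \<ge> N" for n
      proof -
        have "dist (X n) x0 < inverse (real (Suc n))" using XP(1)[of n] by (simp add: dist_commute del: of_nat_Suc)
        also have "\<dots> \<le> inverse (real (Suc N))" using that by (intro le_imp_inverse_le) auto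
        finally show ?thesis using N by simp
      qed
      then show "\<exists>N. \<forall>n\<ge>N. dist (X n) x0 < e" by blast
    qed
    obtain p r where p: "p \<in> nearest_points A x0" "strict_mono r" "(P \<circ> r) \<longlonglongrightarrow> p"
      by (rule nearest_points_limit[OF A(1) X0 XP(2)])
    have "(\<lambda>n. ((X \<circ> r) n - (P \<circ> r) n) \<bullet> v) \<longlonglongrightarrow> (x0 - p) \<bullet> v"
      by (intro tendsto_intros p LIMSEQ_subseq_LIMSEQ[OF X0])
    moreover have "((\<lambda>n. inverse (real (Suc n))) \<circ> r) \<longlonglongrightarrow> 0"
      by (rule LIMSEQ_subseq_LIMSEQ[OF LIMSEQ_inverse_real_of_nat p(2)])
    ultimately have "(x0 - p) \<bullet> v \<le> 0"
      by (rule LIMSEQ_le) (use XP(3) in \<open>auto intro!: less_imp_le simp del: of_nat_Suc\<close>)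
    then show False using v[OF p(1)] by simp
  qed
  then show ?thesis using that[OF nv] by blast
qed

section \<open>Balanced shells near regular points\<close>

text \<open>Every line in the direction \<open>v\<close> meets the slab in unit length, so
  integrating over base points in the slab and then along the line counts each point once. This
  replaces a rotation of the coordinates.\<close>

lemma nn_integral_lines:
  fixes F :: "'a::euclidean_space \<Rightarrow> ennreal" and v :: 'a
  assumes F[measurable]: "F \<in> borel_measurable borel" and v: "norm v = 1"
  shows "(\<integral>\<^sup>+x. F x \<partial>lborel) =
    (\<integral>\<^sup>+x. indicator {x. 0 \<le> x \<bullet> v \<and> x \<bullet> v < 1} x * (\<integral>\<^sup>+t. F (x + t *\<^sub>R v) \<partial>lborel) \<partial>lborel)"
proof -
  define S where "S = {x::'a. 0 \<le> x \<bullet> v \<and> x \<bullet> v < 1}"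
  have [measurable]: "S \<in> sets borel" unfolding S_def by measurable
  have "(\<integral>\<^sup>+x. indicator S x * (\<integral>\<^sup>+t. F (x + t *\<^sub>R v) \<partial>lborel) \<partial>lborel)
      = (\<integral>\<^sup>+x. \<integral>\<^sup>+t. indicator S x * F (x + t *\<^sub>R v) \<partial>lborel \<partial>lborel)"
    by (simp add: nn_integral_cmult)
  also have "\<dots> = (\<integral>\<^sup>+t. \<integral>\<^sup>+x. indicator S x * F (x + t *\<^sub>R v) \<partial>lborel \<partial>lborel)"
    by (rule lborel_pair.Fubini'[symmetric]) measurable
  also have "\<dots> = (\<integral>\<^sup>+t. \<integral>\<^sup>+y. indicator S (y - t *\<^sub>R v) * F y \<partial>lborel \<partial>lborel)"
  proof (rule nn_integral_cong)
    fix t :: real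
    have "(\<integral>\<^sup>+y. indicator S (y - t *\<^sub>R v) * F y \<partial>lborel)
        = (\<integral>\<^sup>+y. indicator S (y - t *\<^sub>R v) * F y \<partial>distr lborel borel ((+) (t *\<^sub>R v)))"
      by (simp add: lborel_distr_plus)
    also have "\<dots> = (\<integral>\<^sup>+x. indicator S x * F (x + t *\<^sub>R v) \<partial>lborel)"
      by (subst nn_integral_distr) (auto simp: add.commute)
    finally show "(\<integral>\<^sup>+x. indicator S x * F (x + t *\<^sub>R v) \<partial>lborel) = (\<integral>\<^sup>+y. indicator S (y - t *\<^sub>R v) * F y \<partial>lborel)" ..
  qed
  also have "\<dots> = (\<integral>\<^sup>+y. \<integral>\<^sup>+t. indicator S (y - t *\<^sub>R v) * F y \<partial>lborel \<partial>lborel)"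
    by (rule lborel_pair.Fubini') measurable
  also have "\<dots> = (\<integral>\<^sup>+y. F y \<partial>lborel)"
  proof (rule nn_integral_cong)
    fix y :: 'a
    have vv: "v \<bullet> v = 1" using v by (simp add: norm_eq_1)
    have "indicator S (y - t *\<^sub>R v) = (indicator {y \<bullet> v - 1<..y \<bullet> v} t :: ennreal)" for t
      using vv by (auto simp: S_def indicator_def inner_diff_left)
    then have "(\<integral>\<^sup>+t. indicator S (y - t *\<^sub>R v) * F y \<partial>lborel) = (\<integral>\<^sup>+t. indicator {y \<bullet> v - 1<..y \<bullet> v} t \<partial>lborel) * F y"
      by (simp add: nn_integral_multc)
    then show "(\<integral>\<^sup>+t. indicator S (y - t *\<^sub>R v) * F y \<partial>lborel) = F y" by simp
  qed
  finally show ?thesis by (simp add: S_def)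
qed

text \<open>The idea is to reflect the line in the point where \<open>\<psi>\<close> attains the value \<open>s\<close>.\<close>

lemma nn_integral_reflect_le:
  fixes \<phi> \<psi> :: "real \<Rightarrow> real"
  assumes cont: "continuous_on UNIV \<psi>" and m\<phi>[measurable]: "\<phi> \<in> borel_measurable borel"
    and h: "h > 0" and c: "c > 0" and \<phi>0: "\<And>t. 0 \<le> \<phi> t"
    and J: "\<And>t u. \<phi> t \<noteq> 0 \<Longrightarrow> \<bar>u - t\<bar> \<le> 2 * h / c \<Longrightarrow> u \<in> J"
    and mono: "\<And>t u. t \<in> J \<Longrightarrow> u \<in> J \<Longrightarrow> t \<le> u \<Longrightarrow> \<psi> t + c * (u - t) \<le> \<psi> u"
    and conc: "\<And>t u. t \<in> J \<Longrightarrow> \<psi> (t + u) + \<psi> (t - u) \<le> 2 * \<psi> t + 2 * u\<^sup>2"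
    and w: "\<And>t u. \<bar>u - t\<bar> \<le> 2 * h / c \<Longrightarrow> \<bar>\<phi> u - \<phi> t\<bar> \<le> w" "0 \<le> w"
    and B: "2 / c\<^sup>2 < B"
  shows "(\<integral>\<^sup>+t. ennreal (\<phi> t) * indicator {t. s - h \<le> \<psi> t \<and> \<psi> t < s} t \<partial>lborel)
       \<le> (\<integral>\<^sup>+t. ennreal (\<phi> t) * indicator {t. s \<le> \<psi> t \<and> \<psi> t < s + h + B * h\<^sup>2} t \<partial>lborel) + ennreal (w * h / c)"
proof (cases "\<exists>t. \<phi> t \<noteq> 0 \<and> s - h \<le> \<psi> t \<and> \<psi> t < s")
  case False
  then have "(\<integral>\<^sup>+t. ennreal (\<phi> t) * indicator {t. s - h \<le> \<psi> t \<and> \<psi> t < s} t \<partial>lborel) = (\<integral>\<^sup>+t. 0 \<partial>(lborel :: real measure))"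
    by (intro nn_integral_cong) (auto simp: indicator_def)
  then show ?thesis by simp
next
  case True
  have [measurable]: "\<psi> \<in> borel_measurable borel" using cont by (rule borel_measurable_continuous_onI)
  obtain t0 where t0: "\<phi> t0 \<noteq> 0" "s - h \<le> \<psi> t0" "\<psi> t0 < s" using True by blast
  have hc: "h / c > 0" using h c by simp
  have t0J: "t0 \<in> J" "t0 + h / c \<in> J" using J[OF t0(1)] h c by (auto simp: field_simps)
  then have "\<psi> (t0 + h / c) \<ge> s" using mono[OF t0J] t0 c hc by simp
  then have "\<exists>x\<ge>t0. x \<le> t0 + h / c \<and> \<psi> x = s"
    using t0 hc by (intro IVT' continuous_on_subset[OF cont]) auto
  then obtain r where r: "t0 \<le> r" "r \<le> t0 + h / c" "\<psi> r = s" by blast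
  have rJ: "r \<in> J" using J[OF t0(1), of r] r h c by (auto simp: field_simps)
  define G where "G t = ennreal (\<phi> t) * indicator {t. s \<le> \<psi> t \<and> \<psi> t < s + h + B * h\<^sup>2} t" for t
  have [measurable]: "G \<in> borel_measurable borel" unfolding G_def by measurable
  \<comment> \<open>The reflection \<open>t \<mapsto> 2 * r - t\<close> carries the inner shell into
    the outer one: \<open>mono\<close> puts the image above level \<open>s\<close>,
    \<open>conc\<close> bounds its excess. Replacing \<open>\<phi> t\<close> by
    \<open>\<phi> (2 * r - t)\<close> costs at most \<open>w\<close>, and only on an interval of
    length \<open>h / c\<close>.\<close>
  have pw: "ennreal (\<phi> t) * indicator {t. s - h \<le> \<psi> t \<and> \<psi> t < s} t \<le> G (2 * r - t) + ennreal w * indicator {r - h / c..r} t" for t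
  proof (cases "\<phi> t \<noteq> 0 \<and> s - h \<le> \<psi> t \<and> \<psi> t < s")
    case True
    then have tJ: "t \<in> J" using J[of t t] h c by auto
    have tr: "t < r" using mono[OF rJ tJ] True r(3) mult_nonneg_nonneg[of c "t - r"] c by fastforce
    have "c * (r - t) \<le> h" using mono[OF tJ rJ] tr True r(3) by auto
    then have rt: "r - t \<le> h / c" using c by (simp add: field_simps)
    have t'J: "2 * r - t \<in> J" using J[of t "2 * r - t"] True rt tr by auto
    have "c * (2 * r - t - r) \<ge> 0" using c tr by simp
    then have p1: "\<psi> (2 * r - t) \<ge> s" using mono[OF rJ t'J] tr r by auto
    have "\<psi> (2 * r - t) + \<psi> t \<le> 2 * s + 2 * (r - t)\<^sup>2" using conc[OF rJ, of "r - t"] r by simp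
    also have "(r - t)\<^sup>2 \<le> (h / c)\<^sup>2" using rt tr by (intro power_mono) auto
    also have "2 * (h / c)\<^sup>2 = (2 / c\<^sup>2) * h\<^sup>2" by (simp add: power_divide)
    finally have "\<psi> (2 * r - t) \<le> s + h + (2 / c\<^sup>2) * h\<^sup>2" using True by linarith
    moreover have "(2 / c\<^sup>2) * h\<^sup>2 < B * h\<^sup>2" using B h by (intro mult_strict_right_mono) auto
    ultimately have p2: "\<psi> (2 * r - t) < s + h + B * h\<^sup>2" by linarith
    have "\<bar>\<phi> (2 * r - t) - \<phi> t\<bar> \<le> w" using w(1)[of "2 * r - t" t] rt tr by auto
    then have "\<phi> t \<le> \<phi> (2 * r - t) + w" by linarith
    then have "ennreal (\<phi> t) \<le> ennreal (\<phi> (2 * r - t)) + ennreal w"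
      using \<phi>0 w(2) by (simp add: ennreal_plus[symmetric] ennreal_leI del: ennreal_plus)
    then show ?thesis using p1 p2 True rt tr by (simp add: G_def)
  qed (auto simp: indicator_def)
  have "(\<integral>\<^sup>+t. ennreal (\<phi> t) * indicator {t. s - h \<le> \<psi> t \<and> \<psi> t < s} t \<partial>lborel)
      \<le> (\<integral>\<^sup>+t. G (2 * r - t) + ennreal w * indicator {r - h / c..r} t \<partial>lborel)"
    by (rule nn_integral_mono) (rule pw)
  also have "\<dots> = (\<integral>\<^sup>+t. G (2 * r + (-1) * t) \<partial>lborel) + ennreal w * (\<integral>\<^sup>+t. indicator {r - h / c..r} t \<partial>lborel)"
    by (subst nn_integral_add) (auto simp: nn_integral_cmult)
  also have "(\<integral>\<^sup>+t. G (2 * r + (-1) * t) \<partial>lborel) = (\<integral>\<^sup>+t. G t \<partial>lborel)"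
    using nn_integral_real_affine[of G "-1" "2 * r"] by simp
  also have "(\<integral>\<^sup>+t. indicator {r - h / c..r} t \<partial>lborel) = ennreal (h / c)" using hc by simp
  also have "ennreal w * ennreal (h / c) = ennreal (w * h / c)"
    using w(2) hc by (simp add: ennreal_mult'[symmetric])
  finally show ?thesis by (simp add: G_def)
qed


text \<open>
  Near a regular point the inner shells are not larger than the outer ones, up to \<open>O(h\<^sup>2)\<close>.
\<close>

definition balanced_shells :: "'a::euclidean_space set \<Rightarrow> 'a \<Rightarrow> real \<Rightarrow> real \<Rightarrow> real \<Rightarrow> bool" where
  "balanced_shells A x0 d B h0 \<longleftrightarrow> d > 0 \<and> B \<ge> 0 \<and> h0 > 0 \<and>
    (\<forall>\<phi> L h s. (\<forall>x. 0 \<le> \<phi> x) \<and> (\<forall>x. \<phi> x \<noteq> 0 \<longrightarrow> x \<in> ball x0 d)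
      \<and> (\<forall>x y. \<bar>\<phi> x - \<phi> y\<bar> \<le> L * dist x y) \<and> 0 \<le> L \<and> 0 < h \<and> h \<le> h0 \<longrightarrow>
      (\<integral>\<^sup>+x. ennreal (\<phi> x) * indicator (sqshell A (s - h) s) x \<partial>lborel)
      \<le> (\<integral>\<^sup>+x. ennreal (\<phi> x) * indicator (sqshell A s (s + h + B * h\<^sup>2)) x \<partial>lborel) + ennreal (L * B * h\<^sup>2))"

text \<open>Along lines in the direction \<open>v\<close> the squared distance grows at a rate at
  least \<open>c\<close> and has second differences at most \<open>2 * u^2\<close>. The reflection
  estimate therefore applies on each line, and integration over the lines gives the claim. The
  weight \<open>\<phi>\<close> is there for a partition of unity.\<close>

lemma regular_point_balanced_shells:
  fixes A :: "'a::euclidean_space set"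
  assumes A: "compact A" "A \<noteq> {}" and x0: "infdist x0 A > 0" "\<not> critical_point A x0"
  shows "\<exists>d B h0. balanced_shells A x0 d B h0"
proof -
  obtain v c d0 where v: "norm v = 1" and c: "c > 0" and d0: "d0 > 0"
    and reg: "\<And>x p. x \<in> ball x0 d0 \<Longrightarrow> p \<in> nearest_points A x \<Longrightarrow> (x - p) \<bullet> v \<ge> c"
    by (rule regular_neighbourhood[OF A x0]) blast
  \<comment> \<open>Parameters on one line within the ball differ by at most
    \<open>2 * D \<le> c\<close>, so the quadratic error of \<open>infdist_sq_le\<close> uses up
    only half of the linear gain \<open>2 * c\<close>.\<close>
  define D where "D = min d0 (c / 2)"
  have D: "D > 0" "D \<le> d0" "2 * D \<le> c" using d0 c by (auto simp: D_def)
  \<comment> \<open>A ball of this radius contains every base point in the slab whose line meets the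
    support of \<open>\<phi>\<close>; only these lines contribute an error term.\<close>
  define R where "R = 2 * (norm x0 + D) + 1"
  define m where "m = measure lborel (cball (0::'a) R)"
  have m0: "m \<ge> 0" by (simp add: m_def)
  define B where "B = 2 / c\<^sup>2 * (1 + m) + 1"
  have Bm: "2 / c\<^sup>2 * m \<le> B" "2 / c\<^sup>2 < B" "B \<ge> 0"
  proof -
    have "2 / c\<^sup>2 * m \<ge> 0" "2 / c\<^sup>2 > 0" using m0 c by auto
    moreover have "B = 2 / c\<^sup>2 + 2 / c\<^sup>2 * m + 1" unfolding B_def by (simp add: distrib_left)
    ultimately show "2 / c\<^sup>2 * m \<le> B" "2 / c\<^sup>2 < B" "B \<ge> 0" by linarith+
  qed
  have mono: "(infdist (x + t *\<^sub>R v) A)\<^sup>2 + c * (u - t) \<le> (infdist (x + u *\<^sub>R v) A)\<^sup>2"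
    if "x + t *\<^sub>R v \<in> ball x0 D" "x + u *\<^sub>R v \<in> ball x0 D" "t \<le> u" for x t u
  proof -
    let ?z = "x + u *\<^sub>R v"
    obtain p where p: "p \<in> nearest_points A ?z"
      using nearest_points_nonempty compact_imp_closed[OF A(1)] A(2) by metis
    have e: "?z + (- (u - t)) *\<^sub>R v = x + t *\<^sub>R v" by (simp add: algebra_simps)
    have "dist (x + t *\<^sub>R v) ?z < D + D"
      using that dist_triangle2[of "x + t *\<^sub>R v" ?z x0] by (auto simp: dist_commute)
    moreover have "dist (x + t *\<^sub>R v) ?z = u - t" using v that(3) 
      by (simp add: dist_norm algebra_simps flip: scaleR_diff_left)
    ultimately have ut: "u - t \<le> c" using D by linarith
    have "(infdist (x + t *\<^sub>R v) A)\<^sup>2 \<le> (infdist ?z A)\<^sup>2 + 2 * ((?z - p) \<bullet> ((- (u - t)) *\<^sub>R v)) + (norm ((- (u - t)) *\<^sub>R v))\<^sup>2"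
      using infdist_sq_le[OF p, of "(- (u - t)) *\<^sub>R v"] unfolding e .
    also have "\<dots> = (infdist ?z A)\<^sup>2 - 2 * (u - t) * ((?z - p) \<bullet> v) + (u - t) * (u - t)"
      using v that(3) by (simp only: inner_scaleR_right norm_scaleR) (simp add: power2_eq_square algebra_simps)
    also have "\<dots> \<le> (infdist ?z A)\<^sup>2 - 2 * (u - t) * c + (u - t) * c"
      using reg[OF _ p] that D ut by (intro add_mono diff_mono mult_left_mono order_refl) auto
    finally show ?thesis by (simp add: algebra_simps)
  qed
  have conc: "(infdist (x + (t + u) *\<^sub>R v) A)\<^sup>2 + (infdist (x + (t - u) *\<^sub>R v) A)\<^sup>2 \<le> 2 * (infdist (x + t *\<^sub>R v) A)\<^sup>2 + 2 * u\<^sup>2" for x t u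
  proof -
    let ?z = "x + t *\<^sub>R v"
    obtain p where p: "p \<in> nearest_points A ?z"
      using nearest_points_nonempty compact_imp_closed[OF A(1)] A(2) by metis
    show ?thesis
      using infdist_sq_le[OF p, of "u *\<^sub>R v"] infdist_sq_le[OF p, of "(-u) *\<^sub>R v"] v
      by (simp add: algebra_simps)
  qed
  have "balanced_shells A x0 (D / 2) B (c * D / 4)"
    unfolding balanced_shells_def
  proof (intro conjI allI impI, goal_cases)
    case (4 \<phi> L h s)
    then have \<phi>0: "\<And>x. 0 \<le> \<phi> x" and supp: "\<And>x. \<phi> x \<noteq> 0 \<Longrightarrow> x \<in> ball x0 (D / 2)"
      and lip: "\<And>x y. \<bar>\<phi> x - \<phi> y\<bar> \<le> L * dist x y" and L: "0 \<le> L" and h: "0 < h" "h \<le> c * D / 4"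
      by blast+
    have hc: "2 * h / c \<le> D / 2" using h c by (simp add: field_simps)
    have "L-lipschitz_on UNIV \<phi>" using lip L by (intro lipschitz_onI) (auto simp: dist_real_def)
    then have [measurable]: "\<phi> \<in> borel_measurable borel"
      by (intro borel_measurable_continuous_onI lipschitz_on_continuous_on)
    define F where "F x = ennreal (\<phi> x) * indicator (sqshell A (s - h) s) x" for x
    define G where "G x = ennreal (\<phi> x) * indicator (sqshell A s (s + h + B * h\<^sup>2)) x" for x
    have [measurable]: "F \<in> borel_measurable borel" "G \<in> borel_measurable borel"
      unfolding F_def G_def by measurable
    define S where "S = {x. 0 \<le> x \<bullet> v \<and> x \<bullet> v < 1}"
    have [measurable]: "S \<in> sets borel" unfolding S_def by measurable
    have [measurable]: "cball (0::'a) R \<in> sets borel" by simp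
    define w where "w = L * (2 * h / c)"
    have w0: "w \<ge> 0" using L h c by (simp add: w_def)
    have line: "(\<integral>\<^sup>+t. F (x + t *\<^sub>R v) \<partial>lborel) \<le> (\<integral>\<^sup>+t. G (x + t *\<^sub>R v) \<partial>lborel) + ennreal (w * h / c)" for x
    proof -
      have "(\<integral>\<^sup>+t. ennreal (\<phi> (x + t *\<^sub>R v)) * indicator {t. s - h \<le> (infdist (x + t *\<^sub>R v) A)\<^sup>2 \<and> (infdist (x + t *\<^sub>R v) A)\<^sup>2 < s} t \<partial>lborel)
        \<le> (\<integral>\<^sup>+t. ennreal (\<phi> (x + t *\<^sub>R v)) * indicator {t. s \<le> (infdist (x + t *\<^sub>R v) A)\<^sup>2 \<and> (infdist (x + t *\<^sub>R v) A)\<^sup>2 < s + h + B * h\<^sup>2} t \<partial>lborel) + ennreal (w * h / c)"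
      proof (rule nn_integral_reflect_le[where J = "{t. x + t *\<^sub>R v \<in> ball x0 D}"])
        show "continuous_on UNIV (\<lambda>t. (infdist (x + t *\<^sub>R v) A)\<^sup>2)" by (intro continuous_intros)
        show "u \<in> {t. x + t *\<^sub>R v \<in> ball x0 D}" if "\<phi> (x + t *\<^sub>R v) \<noteq> 0" "\<bar>u - t\<bar> \<le> 2 * h / c" for t u
        proof -
          have "dist (x + t *\<^sub>R v) (x + u *\<^sub>R v) = \<bar>u - t\<bar>" using v
            by (simp add: dist_norm abs_minus_commute algebra_simps flip: scaleR_diff_left)
          then show ?thesis using supp[OF that(1)] that(2) hc dist_triangle[of x0 "x + u *\<^sub>R v" "x + t *\<^sub>R v"] by auto
        qed
        show "\<bar>\<phi> (x + u *\<^sub>R v) - \<phi> (x + t *\<^sub>R v)\<bar> \<le> w" if "\<bar>u - t\<bar> \<le> 2 * h / c" for t u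
        proof -
          have "dist (x + u *\<^sub>R v) (x + t *\<^sub>R v) = \<bar>u - t\<bar>" using v
            by (simp add: dist_norm algebra_simps flip: scaleR_diff_left)
          then have "\<bar>\<phi> (x + u *\<^sub>R v) - \<phi> (x + t *\<^sub>R v)\<bar> \<le> L * \<bar>u - t\<bar>" using lip by metis
          also have "\<dots> \<le> w" unfolding w_def using that L by (intro mult_left_mono)
          finally show ?thesis .
        qed
      qed (use c h \<phi>0 mono conc w0 Bm in auto)
      then show ?thesis by (simp add: F_def G_def sqshell_def indicator_def)
    qed
    have "(\<integral>\<^sup>+x. F x \<partial>lborel) = (\<integral>\<^sup>+x. indicator S x * (\<integral>\<^sup>+t. F (x + t *\<^sub>R v) \<partial>lborel) \<partial>lborel)"
      unfolding S_def by (rule nn_integral_lines[OF _ v]) measurable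
    also have "\<dots> \<le> (\<integral>\<^sup>+x. indicator S x * (\<integral>\<^sup>+t. G (x + t *\<^sub>R v) \<partial>lborel) + ennreal (w * h / c) * indicator (cball 0 R) x \<partial>lborel)"
    proof (rule nn_integral_mono)
      fix x :: 'a
      show "indicator S x * (\<integral>\<^sup>+t. F (x + t *\<^sub>R v) \<partial>lborel)
          \<le> indicator S x * (\<integral>\<^sup>+t. G (x + t *\<^sub>R v) \<partial>lborel) + ennreal (w * h / c) * indicator (cball 0 R) x"
      proof (cases "x \<in> S \<and> (\<exists>t. F (x + t *\<^sub>R v) \<noteq> 0)")
        case True
        then obtain t where "F (x + t *\<^sub>R v) \<noteq> 0" and xS: "x \<in> S" by blast
        then have "\<phi> (x + t *\<^sub>R v) \<noteq> 0" by (auto simp: F_def)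
        then have "x + t *\<^sub>R v \<in> ball x0 (D / 2)" by (rule supp)
        then have n: "norm (x + t *\<^sub>R v) \<le> norm x0 + D"
          using norm_triangle_sub[of "x + t *\<^sub>R v" x0] D by (simp add: dist_norm norm_minus_commute)
        have "t = (x + t *\<^sub>R v) \<bullet> v - x \<bullet> v" using v by (simp add: inner_add_left norm_eq_1)
        moreover have "\<bar>(x + t *\<^sub>R v) \<bullet> v\<bar> \<le> norm (x + t *\<^sub>R v)"
          using Cauchy_Schwarz_ineq2[of "x + t *\<^sub>R v" v] v by simp
        ultimately have t: "\<bar>t\<bar> \<le> norm x0 + D + 1" using n xS by (auto simp: S_def)
        have "norm x \<le> norm (x + t *\<^sub>R v) + norm (t *\<^sub>R v)" using norm_triangle_ineq4[of "x + t *\<^sub>R v" "t *\<^sub>R v"] by simp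
        also have "\<dots> \<le> R" using n t v by (simp add: R_def)
        finally show ?thesis using line[of x] xS by simp
      qed auto
    qed
    also have "\<dots> = (\<integral>\<^sup>+x. indicator S x * (\<integral>\<^sup>+t. G (x + t *\<^sub>R v) \<partial>lborel) \<partial>lborel) + ennreal (w * h / c) * emeasure lborel (cball (0::'a) R)"
      by (subst nn_integral_add) (auto simp: nn_integral_cmult)
    also have "(\<integral>\<^sup>+x. indicator S x * (\<integral>\<^sup>+t. G (x + t *\<^sub>R v) \<partial>lborel) \<partial>lborel) = (\<integral>\<^sup>+x. G x \<partial>lborel)"
      unfolding S_def by (rule nn_integral_lines[OF _ v, symmetric]) measurable
    also have "emeasure lborel (cball (0::'a) R) = ennreal m"
      unfolding m_def using emeasure_bounded_finite[of "cball (0::'a) R"] by (intro emeasure_eq_ennreal_measure) auto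
    also have "ennreal (w * h / c) * ennreal m = ennreal (w * h / c * m)" by (rule ennreal_mult''[OF m0, symmetric])
    also have "w * h / c * m = L * (2 / c\<^sup>2 * m) * h\<^sup>2" by (simp add: w_def power2_eq_square)
    also have "ennreal (L * (2 / c\<^sup>2 * m) * h\<^sup>2) \<le> ennreal (L * B * h\<^sup>2)"
      using Bm L by (intro ennreal_leI mult_right_mono mult_left_mono) auto
    finally show "(\<integral>\<^sup>+x. ennreal (\<phi> x) * indicator (sqshell A (s - h) s) x \<partial>lborel)
      \<le> (\<integral>\<^sup>+x. ennreal (\<phi> x) * indicator (sqshell A s (s + h + B * h\<^sup>2)) x \<partial>lborel) + ennreal (L * B * h\<^sup>2)"
      by (simp add: F_def G_def)
  qed (use D Bm c in auto)
  then show ?thesis by blast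
qed

text \<open>Small balls around the critical points carry a negligible share of the inner shell. The
  rest of the level set is compact and regular, so a partition of unity adds up finitely many
  balanced shells. Inner minus outer area is then at most \<open>e * h\<close> for a suitable
  \<open>h\<close>, which suffices for a concave function.\<close>

theorem volume_function_differentiable:
  fixes A :: "(real^2) set"
  assumes A: "compact A" "A \<noteq> {}" and s: "s > 0"
    and fin: "finite {x. critical_point A x \<and> infdist x A = s}"
  shows "volume_function A differentiable (at s)"
  unfolding volume_function_differentiable_iff[OF s]
proof (rule concave_differentiable[OF sqvol_concave[OF A]])
  show s2: "0 < s\<^sup>2" using s by simp
  fix e :: real assume e: "e > 0"
  define \<sigma> where "\<sigma> = s\<^sup>2"
  have \<sigma>: "\<sigma> > 0" using s by (simp add: \<sigma>_def)
  define q where "q x = (infdist x A)\<^sup>2" for x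
  have cq: "continuous_on UNIV q" unfolding q_def by (intro continuous_intros)
  have q_eq: "q x = \<sigma> \<longleftrightarrow> infdist x A = s" for x
    using s infdist_nonneg[of x A] by (simp add: q_def \<sigma>_def)
  define C where "C = {x. critical_point A x \<and> infdist x A = s}"
  have finC: "finite C" using fin by (simp add: C_def)
  define u where "u = unit_ball_vol 2"
  have u: "u \<ge> 0" by (simp add: u_def)
  \<comment> \<open>Shrinking by factors down to \<open>1 - \<delta> / s\<close> moves points by at
    most \<delta>, so one ball of radius \<delta> holds at most
    \<open>16 * u * \<delta> / s * h\<close> of the shell. The constant makes all
    \<open>card C\<close> balls together cost at most \<open>e / 4 * h\<close>.\<close>
  define \<delta> where "\<delta> = min (s / 2) (e * s / (64 * (u + 1) * (real (card C) + 1)))"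
  have \<delta>: "\<delta> > 0" "\<delta> \<le> s / 2"
    using s e u by (simp add: \<delta>_def add_nonneg_pos) (simp only: \<delta>_def min.cobounded1)
  have \<delta>e: "real (card C) * (16 * u * \<delta> / s) \<le> e / 4"
  proof -
    have "\<delta> \<le> e * s / (64 * (u + 1) * (real (card C) + 1))" by (simp add: \<delta>_def)
    then have 1: "\<delta> * (64 * (u + 1) * (real (card C) + 1)) \<le> e * s"
      using u by (simp add: pos_le_divide_eq add_nonneg_pos)
    have "real (card C) * (u * \<delta>) \<le> (real (card C) + 1) * ((u + 1) * \<delta>)"
      using u \<delta> by (intro mult_mono) auto
    then have "64 * (real (card C) * (u * \<delta>)) \<le> 64 * ((real (card C) + 1) * ((u + 1) * \<delta>))" by linarith
    also have "\<dots> = \<delta> * (64 * (u + 1) * (real (card C) + 1))" by (simp only: mult_ac)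
    also have "\<dots> \<le> e * s" by (rule 1)
    finally have "64 * (real (card C) * (u * \<delta>)) \<le> e * s" .
    then show ?thesis using s by (simp add: field_simps)
  qed
  have near: "emeasure lborel (sqshell A (\<sigma> - h) \<sigma> \<inter> ball c \<delta>) \<le> ennreal (16 * u * \<delta> / s * h)"
    if h: "0 < h" "h \<le> \<delta> * s" for h c
  proof -
    have "emeasure lborel (sqshell A (\<sigma> - h) \<sigma> \<inter> ball c \<delta>)
       \<le> ennreal (4 * h / (\<delta> / s * \<sigma>)) * emeasure lborel (ball c (2 * \<delta>))"
    proof (rule emeasure_sqshell_Int_le[OF A])
      fix y p t assume y: "y \<in> ball c \<delta>" "(infdist y A)\<^sup>2 < \<sigma>" and p: "p \<in> nearest_points A y"
        and t: "1 - \<delta> / s \<le> t" "t \<le> 1"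
      have d: "infdist y A \<le> s" using y(2) s by (simp add: \<sigma>_def power2_less_imp_less less_imp_le)
      have "y - (p + t *\<^sub>R (y - p)) = (1 - t) *\<^sub>R (y - p)" by (simp add: algebra_simps)
      then have "dist y (p + t *\<^sub>R (y - p)) = (1 - t) * infdist y A"
        using p t by (simp add: dist_norm nearest_points_def)
      also have "\<dots> \<le> (\<delta> / s) * s" using t d s \<delta> by (intro mult_mono infdist_nonneg) auto
      finally have "dist y (p + t *\<^sub>R (y - p)) \<le> \<delta>" using s by simp
      then show "p + t *\<^sub>R (y - p) \<in> ball c (2 * \<delta>)"
        using y(1) dist_triangle[of c "p + t *\<^sub>R (y - p)" y] by auto
    qed (use h s \<delta> in \<open>auto simp: \<sigma>_def power2_eq_square field_simps\<close>)
    also have "emeasure lborel (ball c (2 * \<delta>)) = ennreal (u * (2 * \<delta>)\<^sup>2)"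
      using \<delta> by (subst emeasure_ball) (auto simp: u_def)
    also have "ennreal (4 * h / (\<delta> / s * \<sigma>)) * ennreal (u * (2 * \<delta>)\<^sup>2) = ennreal (4 * h / (\<delta> / s * \<sigma>) * (u * (2 * \<delta>)\<^sup>2))"
      using u by (intro ennreal_mult''[symmetric]) auto
    also have "4 * h / (\<delta> / s * \<sigma>) * (u * (2 * \<delta>)\<^sup>2) = 16 * u * \<delta> / s * h"
      using s \<delta> by (simp add: \<sigma>_def power2_eq_square)
    finally show ?thesis .
  qed
  define \<Gamma> where "\<Gamma> = {x. q x = \<sigma>} - (\<Union>c\<in>C. ball c \<delta>)"
  have bq: "bounded {x. q x \<le> \<sigma>}"
    by (rule bounded_subset[OF bounded_sq_less[OF A, of "\<sigma> + 1"]]) (auto simp: q_def)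
  have "compact \<Gamma>"
  proof -
    have "closed {x. q x = \<sigma>}" using cq by (intro closed_Collect_eq) auto
    then have "closed \<Gamma>" unfolding \<Gamma>_def by (intro closed_Diff open_UN) auto
    moreover have "bounded \<Gamma>" by (rule bounded_subset[OF bq]) (auto simp: \<Gamma>_def)
    ultimately show ?thesis by (simp add: compact_eq_bounded_closed)
  qed
  have "\<exists>d B h0. balanced_shells A x d B h0" if "x \<in> \<Gamma>" for x
  proof -
    have x: "infdist x A = s" "x \<notin> C" using that \<delta> q_eq by (auto simp: \<Gamma>_def)
    then have "infdist x A > 0" "\<not> critical_point A x" using s by (auto simp: C_def)
    then show ?thesis by (rule regular_point_balanced_shells[OF A])
  qed
  then obtain d B h0 where good: "\<And>x. x \<in> \<Gamma> \<Longrightarrow> balanced_shells A x (d x) (B x) (h0 x)" by metis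
  have pos: "d x > 0" "B x \<ge> 0" "h0 x > 0" if "x \<in> \<Gamma>" for x using good[OF that] by (auto simp: balanced_shells_def)
  obtain F where F: "F \<subseteq> \<Gamma>" "finite F" "\<Gamma> \<subseteq> (\<Union>x\<in>F. ball x (d x))"
  proof (rule compactE_image[OF \<open>compact \<Gamma>\<close>, of \<Gamma> "\<lambda>x. ball x (d x)"])
    show "\<Gamma> \<subseteq> (\<Union>x\<in>\<Gamma>. ball x (d x))" using pos by force
  qed auto
  define f where "f i x = max 0 (d i - dist i x)" for i x
  define S where "S x = (\<Sum>i\<in>F. f i x)" for x
  have f0: "f i x \<ge> 0" for i x by (simp add: f_def)
  have flip: "\<bar>f i x - f i y\<bar> \<le> dist x y" for i x y
    using dist_triangle[of i x y] dist_triangle[of i y x] by (auto simp: f_def dist_commute)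
  have S0: "S x \<ge> 0" for x unfolding S_def by (intro sum_nonneg f0)
  have Slip: "\<bar>S x - S y\<bar> \<le> real (card F) * dist x y" for x y
  proof -
    have "\<bar>S x - S y\<bar> = \<bar>\<Sum>i\<in>F. f i x - f i y\<bar>" by (simp add: S_def sum_subtractf)
    also have "\<dots> \<le> (\<Sum>i\<in>F. \<bar>f i x - f i y\<bar>)" by (rule sum_abs)
    also have "\<dots> \<le> (\<Sum>i\<in>F. dist x y)" by (intro sum_mono flip)
    finally show ?thesis by simp
  qed
  have cS: "continuous_on UNIV S" unfolding S_def f_def by (intro continuous_intros)
  have Spos: "S x > 0" if x: "x \<in> \<Gamma>" for x
  proof -
    obtain i where i: "i \<in> F" "x \<in> ball i (d i)" using F(3) x by blast
    have "f i x \<le> S x" unfolding S_def by (rule member_le_sum) (use i F f0 in auto)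
    moreover have "f i x > 0" using i by (simp add: f_def)
    ultimately show ?thesis by linarith
  qed
  obtain m where m: "m > 0" "\<And>x. x \<in> \<Gamma> \<Longrightarrow> m \<le> S x"
  proof (cases "\<Gamma> = {}")
    case True then show ?thesis using that[of 1] by auto
  next
    case False
    then obtain x where "x \<in> \<Gamma>" "\<forall>y\<in>\<Gamma>. S x \<le> S y"
      using continuous_attains_inf[OF \<open>compact \<Gamma>\<close> False continuous_on_subset[OF cS]] by auto
    then show ?thesis using that[of "S x"] Spos by auto
  qed
  \<comment> \<open>Truncating at \<open>m / 2\<close> keeps the quotients
    \<open>f i x / g x\<close> Lipschitz where \<open>S\<close> vanishes. They sum to at most 1
    everywhere and to exactly 1 where \<open>S x \<ge> m / 2\<close>.\<close>
  define g where "g x = max (S x) (m / 2)" for x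
  have g: "g x \<ge> m / 2" "S x \<le> g x" for x by (auto simp: g_def)
  have gpos: "g x > 0" for x using g(1)[of x] m by linarith
  have glip: "\<bar>g x - g y\<bar> \<le> real (card F) * dist x y" for x y
    using Slip[of x y] by (auto simp: g_def max_def)
  define \<phi> where "\<phi> i x = f i x / g x" for i x
  define L where "L = (2 / m) * (1 + real (card F))"
  have L0: "L \<ge> 0" using m by (simp add: L_def)
  have \<phi>0: "\<phi> i x \<ge> 0" for i x using f0 gpos by (simp add: \<phi>_def less_imp_le)
  have \<phi>lip: "\<bar>\<phi> i x - \<phi> i y\<bar> \<le> L * dist x y" if "i \<in> F" for i x y
  proof -
    have fg: "f i y / g y \<le> 1"
    proof -
      have "f i y \<le> S y" unfolding S_def by (rule member_le_sum) (use that F f0 in auto)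
      then show ?thesis using g(2)[of y] gpos[of y] by (simp add: divide_le_eq_1)
    qed
    have "\<phi> i x - \<phi> i y = (f i x - f i y + (f i y / g y) * (g y - g x)) / g x"
      using gpos[of x] gpos[of y] by (simp add: \<phi>_def field_simps)
    then have "\<bar>\<phi> i x - \<phi> i y\<bar> = \<bar>f i x - f i y + (f i y / g y) * (g y - g x)\<bar> / g x"
      using gpos[of x] by simp
    also have "\<dots> \<le> (dist x y + real (card F) * dist x y) / (m / 2)"
    proof (rule frac_le)
      have "\<bar>(f i y / g y) * (g y - g x)\<bar> \<le> 1 * (real (card F) * dist x y)"
        unfolding abs_mult using fg f0 gpos[of y] glip[of y x] by (intro mult_mono) (auto simp: dist_commute)
      then show "\<bar>f i x - f i y + (f i y / g y) * (g y - g x)\<bar> \<le> dist x y + real (card F) * dist x y"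
        using flip[of i x y] by linarith
    qed (use g m in auto)
    also have "\<dots> = L * dist x y" using m by (simp add: L_def field_simps)
    finally show ?thesis .
  qed
  have sum\<phi>: "(\<Sum>i\<in>F. \<phi> i x) = S x / g x" for x by (simp add: \<phi>_def S_def sum_divide_distrib)
  \<comment> \<open>The points below the level and off the balls with \<open>S x \<le> m / 2\<close>
    form a compact set that misses the level itself, so \<open>q\<close> stays away from \<sigma> on
    it.\<close>
  obtain h1 where h1: "h1 > 0" "\<And>x. \<sigma> - h1 \<le> q x \<Longrightarrow> q x \<le> \<sigma> \<Longrightarrow> x \<notin> (\<Union>c\<in>C. ball c \<delta>) \<Longrightarrow> m / 2 \<le> S x"
  proof -
    define \<Gamma>' where "\<Gamma>' = {x. q x \<le> \<sigma>} \<inter> {x. S x \<le> m / 2} - (\<Union>c\<in>C. ball c \<delta>)"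
    have "closed {x. q x \<le> \<sigma>}" "closed {x. S x \<le> m / 2}" by (rule closed_Collect_le; intro cq cS continuous_intros)+
    then have "closed \<Gamma>'" unfolding \<Gamma>'_def by (intro closed_Diff closed_Int open_UN) auto
    moreover have "bounded \<Gamma>'" by (rule bounded_subset[OF bq]) (auto simp: \<Gamma>'_def)
    ultimately have comp: "compact \<Gamma>'" by (simp add: compact_eq_bounded_closed)
    show ?thesis
    proof (cases "\<Gamma>' = {}")
      case True
      then have "m / 2 \<le> S x" if "q x \<le> \<sigma>" "x \<notin> (\<Union>c\<in>C. ball c \<delta>)" for x
        using that by (force simp: \<Gamma>'_def)
      then show ?thesis using that[of 1] by auto
    next
      case False
      then obtain z where z: "z \<in> \<Gamma>'" "\<forall>y\<in>\<Gamma>'. q y \<le> q z"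
        using continuous_attains_sup[OF comp False continuous_on_subset[OF cq]] by auto
      have "q z \<noteq> \<sigma>"
      proof
        assume "q z = \<sigma>"
        then have "z \<in> \<Gamma>" using z(1) by (auto simp: \<Gamma>'_def \<Gamma>_def)
        then show False using m z(1) by (fastforce simp: \<Gamma>'_def)
      qed
      then have qz: "q z < \<sigma>" using z(1) by (auto simp: \<Gamma>'_def)
      show ?thesis
      proof (rule that[of "(\<sigma> - q z) / 2"])
        fix x assume x: "\<sigma> - (\<sigma> - q z) / 2 \<le> q x" "q x \<le> \<sigma>" "x \<notin> (\<Union>c\<in>C. ball c \<delta>)"
        show "m / 2 \<le> S x"
        proof (rule ccontr)
          assume "\<not> m / 2 \<le> S x"
          then have "x \<in> \<Gamma>'" using x by (auto simp: \<Gamma>'_def)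
          then have "q x \<le> q z" using z(2) by blast
          then show False using x qz by (simp add: field_simps)
        qed
      qed (use qz in auto)
    qed
  qed
  define Bt where "Bt = (\<Sum>i\<in>F. B i)"
  have Bt: "B i \<le> Bt" if "i \<in> F" for i
    unfolding Bt_def by (rule member_le_sum) (use that F pos in auto)
  have Bt0: "Bt \<ge> 0" unfolding Bt_def by (rule sum_nonneg) (use F pos in auto)
  define h2 where "h2 = Min (insert 1 (h0 ` F))"
  have h2: "h2 > 0" "\<And>i. i \<in> F \<Longrightarrow> h2 \<le> h0 i" using F pos by (auto simp: h2_def)
  obtain \<eta> where \<eta>: "\<eta> > 0" "\<And>h. 0 < h \<Longrightarrow> h < \<eta> \<Longrightarrow> Bt * (sqvol A (\<sigma> + h) - sqvol A \<sigma>) \<le> e / 4"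
  proof -
    have "isCont (sqvol A) \<sigma>"
      using sqvol_continuous[OF A] \<sigma> by (simp add: continuous_on_eq_continuous_at)
    moreover have "e / (4 * (Bt + 1)) > 0" using e Bt0 by simp
    ultimately have "\<forall>\<^sub>F x in at \<sigma>. dist (sqvol A x) (sqvol A \<sigma>) < e / (4 * (Bt + 1))"
      unfolding isCont_def by (rule tendstoD)
    then obtain \<eta> where \<eta>: "\<eta> > 0" "\<And>x. x \<noteq> \<sigma> \<Longrightarrow> dist x \<sigma> < \<eta> \<Longrightarrow> dist (sqvol A x) (sqvol A \<sigma>) < e / (4 * (Bt + 1))"
      unfolding eventually_at by auto
    have "Bt * (sqvol A (\<sigma> + h) - sqvol A \<sigma>) \<le> e / 4" if "0 < h" "h < \<eta>" for h
    proof -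
      have "sqvol A (\<sigma> + h) - sqvol A \<sigma> \<le> e / (4 * (Bt + 1))"
        using \<eta>(2)[of "\<sigma> + h"] that by (auto simp: dist_real_def)
      then have "Bt * (sqvol A (\<sigma> + h) - sqvol A \<sigma>) \<le> (Bt + 1) * (e / (4 * (Bt + 1)))"
        using Bt0 that sqvol_mono[OF A, of \<sigma> "\<sigma> + h"] by (intro mult_mono) auto
      also have "\<dots> = e / 4" using Bt0 by (simp add: field_simps)
      finally show ?thesis .
    qed
    then show ?thesis using that \<eta>(1) by blast
  qed
  define K where "K = real (card F) * (L * Bt)"
  have K0: "K \<ge> 0" using L0 Bt0 by (simp add: K_def)
  define h where "h = Min {\<sigma> / 2, \<delta> * s, h1, h2, \<eta> / 2, e / (4 * (K + 1))}"
  have h_pos: "h > 0" using \<sigma> \<delta> s h1(1) h2(1) \<eta>(1) e K0 by (simp add: h_def)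
  have h_le: "h \<le> \<sigma> / 2" "h \<le> \<delta> * s" "h \<le> h1" "h \<le> h2" "h \<le> \<eta> / 2" "h \<le> e / (4 * (K + 1))"
    unfolding h_def by (rule Min_le; simp)+
  let ?m = "sqshell A (\<sigma> - h) \<sigma>" and ?p = "sqshell A \<sigma> (\<sigma> + h + Bt * h\<^sup>2)"
  have m\<phi>[measurable]: "\<phi> i \<in> borel_measurable borel" if "i \<in> F" for i
  proof -
    have "L-lipschitz_on UNIV (\<phi> i)" using \<phi>lip that L0 by (intro lipschitz_onI) (auto simp: dist_real_def)
    then show ?thesis by (intro borel_measurable_continuous_onI lipschitz_on_continuous_on)
  qed
  have pw: "(indicator ?m x :: ennreal) \<le> (\<Sum>i\<in>F. ennreal (\<phi> i x) * indicator ?m x) + (\<Sum>c\<in>C. indicator (?m \<inter> ball c \<delta>) x)" for x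
  proof (cases "x \<in> ?m")
    case xm: True
    show ?thesis
    proof (cases "x \<in> (\<Union>c\<in>C. ball c \<delta>)")
      case True
      then obtain c where c: "c \<in> C" "x \<in> ball c \<delta>" by blast
      have "(indicator (?m \<inter> ball c \<delta>) x :: ennreal) \<le> (\<Sum>c\<in>C. indicator (?m \<inter> ball c \<delta>) x)"
        by (rule member_le_sum) (use c finC in auto)
      then have "1 \<le> (\<Sum>c\<in>C. indicator (?m \<inter> ball c \<delta>) x :: ennreal)" using c xm by simp
      then show ?thesis using xm by (simp add: add_increasing)
    next
      case False
      have "m / 2 \<le> S x" by (rule h1(2)[OF _ _ False]) (use xm h_le in \<open>auto simp: sqshell_def q_def\<close>)
      then have "S x / g x = 1" using m by (simp add: g_def)
      then have "(\<Sum>i\<in>F. ennreal (\<phi> i x)) = 1" using sum\<phi>[of x] \<phi>0 by (subst sum_ennreal) auto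
      then show ?thesis using xm by simp
    qed
  qed simp
  have "emeasure lborel ?m = (\<integral>\<^sup>+x. indicator ?m x \<partial>lborel)" by simp
  also have "\<dots> \<le> (\<integral>\<^sup>+x. (\<Sum>i\<in>F. ennreal (\<phi> i x) * indicator ?m x) + (\<Sum>c\<in>C. indicator (?m \<inter> ball c \<delta>) x) \<partial>lborel)"
    by (rule nn_integral_mono) (rule pw)
  also have "\<dots> = (\<Sum>i\<in>F. \<integral>\<^sup>+x. ennreal (\<phi> i x) * indicator ?m x \<partial>lborel) + (\<Sum>c\<in>C. emeasure lborel (?m \<inter> ball c \<delta>))"
  proof -
    have mi: "(\<lambda>x. ennreal (\<phi> i x) * indicator ?m x) \<in> borel_measurable lborel" if "i \<in> F" for i
      using m\<phi>[OF that] by simp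
    have mc: "(\<lambda>x. indicator (?m \<inter> ball c \<delta>) x :: ennreal) \<in> borel_measurable lborel" for c
      by (intro borel_measurable_indicator) simp
    have "(\<integral>\<^sup>+x. (\<Sum>i\<in>F. ennreal (\<phi> i x) * indicator ?m x) + (\<Sum>c\<in>C. indicator (?m \<inter> ball c \<delta>) x) \<partial>lborel)
      = (\<integral>\<^sup>+x. (\<Sum>i\<in>F. ennreal (\<phi> i x) * indicator ?m x) \<partial>lborel) + (\<integral>\<^sup>+x. (\<Sum>c\<in>C. indicator (?m \<inter> ball c \<delta>) x) \<partial>lborel)"
      by (rule nn_integral_add; rule borel_measurable_sum; intro mi mc)
    also have "\<dots> = (\<Sum>i\<in>F. \<integral>\<^sup>+x. ennreal (\<phi> i x) * indicator ?m x \<partial>lborel) + (\<Sum>c\<in>C. emeasure lborel (?m \<inter> ball c \<delta>))"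
      using mi mc by (simp add: nn_integral_sum)
    finally show ?thesis .
  qed
  also have "\<dots> \<le> (\<Sum>i\<in>F. (\<integral>\<^sup>+x. ennreal (\<phi> i x) * indicator ?p x \<partial>lborel) + ennreal (L * Bt * h\<^sup>2)) + (\<Sum>c\<in>C. ennreal (16 * u * \<delta> / s * h))"
  proof (intro add_mono sum_mono)
    fix i assume i: "i \<in> F"
    then have i\<Gamma>: "i \<in> \<Gamma>" using F by blast
    have "(\<integral>\<^sup>+x. ennreal (\<phi> i x) * indicator ?m x \<partial>lborel)
      \<le> (\<integral>\<^sup>+x. ennreal (\<phi> i x) * indicator (sqshell A \<sigma> (\<sigma> + h + B i * h\<^sup>2)) x \<partial>lborel) + ennreal (L * B i * h\<^sup>2)"
    proof -
      have "\<forall>y. \<phi> i y \<noteq> 0 \<longrightarrow> y \<in> ball i (d i)" by (auto simp: \<phi>_def f_def max_def split: if_splits)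
      moreover have "h \<le> h0 i" using h_le(4) h2(2)[OF i] by simp
      ultimately show ?thesis using good[OF i\<Gamma>] \<phi>0 \<phi>lip[OF i] L0 h_pos unfolding balanced_shells_def by blast
    qed
    also have "\<dots> \<le> (\<integral>\<^sup>+x. ennreal (\<phi> i x) * indicator ?p x \<partial>lborel) + ennreal (L * Bt * h\<^sup>2)"
    proof (intro add_mono nn_integral_mono mult_left_mono ennreal_leI mult_right_mono)
      fix x
      have "B i * h\<^sup>2 \<le> Bt * h\<^sup>2" using Bt[OF i] by (intro mult_right_mono) auto
      then show "indicator (sqshell A \<sigma> (\<sigma> + h + B i * h\<^sup>2)) x \<le> (indicator ?p x :: ennreal)"
        by (auto simp: indicator_def sqshell_def)
    qed (use Bt[OF i] L0 in auto)
    finally show "(\<integral>\<^sup>+x. ennreal (\<phi> i x) * indicator ?m x \<partial>lborel)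
      \<le> (\<integral>\<^sup>+x. ennreal (\<phi> i x) * indicator ?p x \<partial>lborel) + ennreal (L * Bt * h\<^sup>2)" .
  qed (use near h_pos h_le in auto)
  also have "\<dots> = (\<Sum>i\<in>F. \<integral>\<^sup>+x. ennreal (\<phi> i x) * indicator ?p x \<partial>lborel)
      + (ennreal (K * h\<^sup>2) + ennreal (real (card C) * (16 * u * \<delta> / s) * h))"
  proof -
    have "(\<Sum>c\<in>C. ennreal (16 * u * \<delta> / s * h)) = ennreal (real (card C) * (16 * u * \<delta> / s) * h)"
      using u \<delta> s h_pos by (subst sum_ennreal) auto
    moreover have "(\<Sum>i\<in>F. ennreal (L * Bt * h\<^sup>2)) = ennreal (K * h\<^sup>2)"
      using L0 Bt0 by (subst sum_ennreal) (auto simp: K_def)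
    ultimately show ?thesis by (simp only: sum.distrib add.assoc)
  qed
  also have "(\<Sum>i\<in>F. \<integral>\<^sup>+x. ennreal (\<phi> i x) * indicator ?p x \<partial>lborel) = (\<integral>\<^sup>+x. (\<Sum>i\<in>F. ennreal (\<phi> i x) * indicator ?p x) \<partial>lborel)"
    by (subst nn_integral_sum) auto
  also have "\<dots> \<le> (\<integral>\<^sup>+x. indicator ?p x \<partial>lborel)"
  proof (rule nn_integral_mono)
    fix x
    have "(\<Sum>i\<in>F. ennreal (\<phi> i x)) = ennreal (S x / g x)" using \<phi>0 by (subst sum_ennreal) (auto simp: sum\<phi>)
    also have "\<dots> \<le> 1" using g(2)[of x] gpos[of x] by (simp add: divide_le_eq_1)
    finally show "(\<Sum>i\<in>F. ennreal (\<phi> i x) * indicator ?p x) \<le> indicator ?p x" by (auto simp: indicator_def)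
  qed
  also have "\<dots> = emeasure lborel ?p" by simp
  finally have main: "emeasure lborel ?m \<le> emeasure lborel ?p + (ennreal (K * h\<^sup>2) + ennreal (real (card C) * (16 * u * \<delta> / s) * h))"
    by (simp add: add_right_mono)
  define P where "P = sqvol A (\<sigma> + h) - sqvol A \<sigma>"
  have "measure lborel ?m \<le> measure lborel ?p + (K * h\<^sup>2 + real (card C) * (16 * u * \<delta> / s) * h)"
    using main sqshell_fmeasurable[OF A] K0 u \<delta> s h_pos
    by (simp add: emeasure_eq_measure2 flip: ennreal_plus)
  moreover have "measure lborel ?m = sqvol A \<sigma> - sqvol A (\<sigma> - h)" using sqvol_diff[OF A, of "\<sigma> - h" \<sigma>] h_pos by simp
  moreover have "measure lborel ?p = sqvol A (\<sigma> + h + Bt * h\<^sup>2) - sqvol A \<sigma>"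
    using sqvol_diff[OF A, of \<sigma> "\<sigma> + h + Bt * h\<^sup>2"] h_pos Bt0 by simp
  \<comment> \<open>Concavity pays for the extra thickness \<open>Bt * h^2\<close>: the quotient
    over the thicker shell is at most \<open>P / h\<close>. The surplus \<open>Bt * h * P\<close> is
    small compared with \<open>h\<close> because \<open>P\<close> tends to 0 by continuity.\<close>
  moreover have "sqvol A (\<sigma> + h + Bt * h\<^sup>2) - sqvol A \<sigma> \<le> P + Bt * h * P"
  proof (cases "Bt = 0")
    case False
    then have b: "Bt * h\<^sup>2 > 0" using Bt0 h_pos by simp
    have "(sqvol A (\<sigma> + h + Bt * h\<^sup>2) - sqvol A \<sigma>) / (h + Bt * h\<^sup>2) \<le> P / h"
      using concave_slopes(2)[OF sqvol_concave[OF A], of \<sigma> "\<sigma> + h + Bt * h\<^sup>2" "\<sigma> + h"] \<sigma> h_pos b by (simp add: P_def add.assoc)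
    then have "sqvol A (\<sigma> + h + Bt * h\<^sup>2) - sqvol A \<sigma> \<le> P / h * (h + Bt * h\<^sup>2)"
      using h_pos b by (simp only: pos_divide_le_eq add_pos_pos)
    also have "\<dots> = P + Bt * h * P" using h_pos by (simp add: field_simps power2_eq_square)
    finally show ?thesis .
  qed (simp add: P_def)
  moreover have "Bt * h * P \<le> e / 4 * h"
    using mult_right_mono[OF \<eta>(2)[of h], of h] h_pos h_le(5) by (simp add: P_def mult_ac)
  moreover have "K * h\<^sup>2 \<le> e / 4 * h"
  proof -
    have "K * h \<le> (K + 1) * (e / (4 * (K + 1)))" using h_le(6) K0 h_pos by (intro mult_mono) auto
    also have "\<dots> = e / 4" using K0 by (simp add: field_simps)
    finally show ?thesis using h_pos by (simp add: power2_eq_square mult_right_mono)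
  qed
  moreover have "real (card C) * (16 * u * \<delta> / s) * h \<le> e / 4 * h"
    using \<delta>e h_pos by (intro mult_right_mono) auto
  moreover have "e / 4 * h + e / 4 * h + e / 4 * h \<le> e * h" using e h_pos by simp
  ultimately have "(sqvol A \<sigma> - sqvol A (\<sigma> - h)) - P \<le> e * h" by linarith
  then show "\<exists>h>0. h < s\<^sup>2 \<and> sqvol A (s\<^sup>2) - sqvol A (s\<^sup>2 - h) - (sqvol A (s\<^sup>2 + h) - sqvol A (s\<^sup>2)) \<le> e * h"
    using h_pos h_le(1) \<sigma> by (intro exI[of _ h]) (simp add: \<sigma>_def P_def)
qed

subsection \<open>A flat piece of the distance function\<close>

lemma norm_plane: "(norm x)\<^sup>2 = (x $ 1)\<^sup>2 + (x $ 2)\<^sup>2" for x :: "real^2"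
  unfolding power2_norm_eq_inner by (simp add: inner_vec_def sum_2 power2_eq_square)

lemma dist_plane: "(dist x y)\<^sup>2 = (x $ 1 - y $ 1)\<^sup>2 + (x $ 2 - y $ 2)\<^sup>2" for x y :: "real^2"
  by (simp add: dist_norm norm_plane)

lemma measure_box_plane:
  assumes "a < b" "c < d"
  shows "measure lborel (box (vector [a, c]) (vector [b, d] :: real^2)) = (b - a) * (d - c)"
proof -
  let ?l = "vector [a, c] :: real^2" and ?u = "vector [b, d] :: real^2"
  have "measure lborel (box ?l ?u) = measure lborel (cbox ?l ?u)"
    by (simp add: measure_lborel_box_eq measure_lborel_cbox_eq)
  also have "cbox ?l ?u \<noteq> {}"
    using assms by (auto simp: interval_ne_empty_cart forall_2)
  then have "measure lborel (cbox ?l ?u) = (b - a) * (d - c)"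
    by (subst content_cbox_cart) (auto simp: UNIV_2)
  finally show ?thesis .
qed

text \<open>Over the rectangle the distance is a roof with ridge \<open>x $ 2 = y0\<close>.
  Contracting the shell outside level \<open>s\<close> into the shell inside it misses the
  rectangle, so the inner shell is larger by a fixed multiple of \<open>h\<close> and the one-sided
  derivatives of \<open>sqvol A\<close> differ.\<close>

theorem volume_function_not_differentiable:
  fixes A :: "(real^2) set"
  assumes A: "compact A" "A \<noteq> {}" and s: "s > 0" and ab: "\<alpha> < \<beta>"
    and rect: "\<And>x. \<alpha> < x $ 1 \<Longrightarrow> x $ 1 < \<beta> \<Longrightarrow> \<bar>x $ 2 - y0\<bar> < s \<Longrightarrow> infdist x A = s - \<bar>x $ 2 - y0\<bar>"
  shows "\<not> volume_function A differentiable (at s)"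
proof
  assume "volume_function A differentiable (at s)"
  define \<sigma> where "\<sigma> = s\<^sup>2"
  have \<sigma>: "\<sigma> > 0" using s by (simp add: \<sigma>_def)
  have "sqvol A differentiable (at \<sigma>)"
    using volume_function_differentiable_iff[OF s, of A] \<open>volume_function A differentiable (at s)\<close> by (simp add: \<sigma>_def)
  then obtain D where D: "(sqvol A has_field_derivative D) (at \<sigma>)" by (auto simp: real_differentiable_def)
  define U :: "(real^2) set" where "U = {x. \<alpha> < x $ 1 \<and> x $ 1 < \<beta> \<and> \<bar>x $ 2 - y0\<bar> < s}"
  have [measurable]: "(\<lambda>x::real^2. x $ i) \<in> borel_measurable borel" for i
    by (intro borel_measurable_continuous_onI continuous_intros)
  have U[measurable]: "U \<in> sets borel" unfolding U_def by measurable
  have dU: "infdist x A = s - \<bar>x $ 2 - y0\<bar>" if "x \<in> U" for x using rect that by (auto simp: U_def)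
  \<comment> \<open>Ridge points have distance exactly \<open>s\<close> and do contract into the
    rectangle; removing them costs only a null set.\<close>
  define ax :: "(real^2) set" where "ax = {x. x $ 2 = y0}"
  have ax: "ax \<in> null_sets lborel"
  proof -
    have "negligible {x::real^2. x \<bullet> axis 2 1 = y0}" by (rule negligible_standard_hyperplane) (auto simp: Basis_vec_def)
    then have "negligible ax" by (simp add: ax_def inner_axis)
    moreover have "ax \<in> sets borel" unfolding ax_def by measurable
    ultimately show ?thesis by (simp add: negligible_iff_null_sets null_sets_completion_iff)
  qed
  \<comment> \<open>Beyond \<open>z\<close> on the ray from \<open>p\<close> to \<open>y\<close> the
    distance grows at unit speed. Inside the roof this happens only when moving vertically towards
    the ridge, and past the ridge it would decrease. Such a ray would have to end on the ridge, but
    \<open>y\<close> is not there.\<close>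
  have avoid: "p + t *\<^sub>R (y - p) \<notin> U"
    if y: "infdist y A \<ge> s" "y \<notin> ax" and p: "p \<in> nearest_points A y" and t: "0 < t" "t < 1" for y p t
  proof
    define z where "z = p + t *\<^sub>R (y - p)"
    assume "p + t *\<^sub>R (y - p) \<in> U"
    then have zU: "z \<in> U" by (simp add: z_def)
    define d where "d = infdist y A"
    have d: "d > 0" "norm (y - p) = d" using y(1) s p by (auto simp: d_def nearest_points_def dist_norm)
    define e where "e = (y - p) /\<^sub>R d"
    have ne: "norm e = 1" using d by (simp add: e_def)
    have ray: "infdist (z + \<epsilon> *\<^sub>R e) A = infdist z A + \<epsilon>" if "0 \<le> \<epsilon>" "\<epsilon> \<le> d - t * d" for \<epsilon>
    proof -
      have "z + \<epsilon> *\<^sub>R e = p + (t + \<epsilon> / d) *\<^sub>R (y - p)" by (simp add: z_def e_def algebra_simps divide_inverse)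
      moreover have "t + \<epsilon> / d \<le> 1" "0 \<le> t + \<epsilon> / d" using that d t by (auto simp: field_simps)
      ultimately have "infdist (z + \<epsilon> *\<^sub>R e) A = (t + \<epsilon> / d) * d"
        using infdist_shrunk(2)[OF p, of "t + \<epsilon> / d"] by (simp add: d_def)
      also have "\<dots> = t * d + \<epsilon>" using d by (simp add: distrib_right)
      also have "t * d = infdist z A" using infdist_shrunk(2)[OF p, of t] t by (simp add: z_def d_def)
      finally show ?thesis .
    qed
    have dz: "infdist z A = t * d" using infdist_shrunk(2)[OF p, of t] t by (simp add: z_def d_def)
    have "(d - t * d) * inverse d = 1 - t" using d by (simp add: field_simps)
    then have "(d - t * d) *\<^sub>R e = (1 - t) *\<^sub>R (y - p)" by (simp add: e_def)
    then have ye: "y = z + (d - t * d) *\<^sub>R e" by (simp add: z_def algebra_simps)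
    define k where "k = z $ 2 - y0"
    have k: "\<bar>k\<bar> \<le> d - t * d" using dU[OF zU] dz y(1) by (simp add: k_def d_def)
    have td: "d - t * d > 0" using d t by simp
    have mem: "z + \<epsilon> *\<^sub>R e \<in> U" if "\<bar>k + \<epsilon> * e $ 2\<bar> < s" "\<bar>\<epsilon> * e $ 1\<bar> < min (z $ 1 - \<alpha>) (\<beta> - z $ 1)" for \<epsilon>
      using that by (auto simp: U_def k_def algebra_simps abs_less_iff)
    have "min (s - \<bar>k\<bar>) (min (d - t * d) (min (z $ 1 - \<alpha>) (\<beta> - z $ 1))) > 0"
      using zU td by (auto simp: U_def k_def)
    then obtain m where "0 < m" "m < min (s - \<bar>k\<bar>) (min (d - t * d) (min (z $ 1 - \<alpha>) (\<beta> - z $ 1)))"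
      using dense by blast
    then have m: "m > 0" "m < s - \<bar>k\<bar>" "m \<le> d - t * d" "m < min (z $ 1 - \<alpha>) (\<beta> - z $ 1)" by auto
    have e1: "\<bar>e $ 1\<bar> \<le> 1" "\<bar>e $ 2\<bar> \<le> 1" using component_le_norm_cart[of e] ne by auto
    have me: "\<bar>m * e $ i\<bar> \<le> m" if "\<bar>e $ i\<bar> \<le> 1" for i using that m(1) by (simp add: abs_mult mult_left_le)
    have "z + m *\<^sub>R e \<in> U"
      by (rule mem) (use me[OF e1(1)] me[OF e1(2)] m in auto)
    then have "\<bar>k + m * e $ 2\<bar> = \<bar>k\<bar> - m"
      using dU[of "z + m *\<^sub>R e"] dU[OF zU] ray[of m] m by (simp add: k_def algebra_simps)
    then have "\<bar>m * e $ 2\<bar> \<ge> m" and km: "\<bar>k\<bar> \<ge> m" by linarith+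
    then have "\<bar>e $ 2\<bar> \<ge> 1" using m(1) by (simp add: abs_mult)
    then have e2: "\<bar>e $ 2\<bar> = 1" using e1 by simp
    then have "(e $ 2)\<^sup>2 = 1" by (metis one_power2 power2_abs)
    then have e10: "e $ 1 = 0" using norm_plane[of e] ne by simp
    have sg: "k * e $ 2 = - \<bar>k\<bar>"
    proof -
      have "e $ 2 = 1 \<or> e $ 2 = -1" using e2 by linarith
      then show ?thesis using \<open>\<bar>k + m * e $ 2\<bar> = \<bar>k\<bar> - m\<close> m(1) km by auto
    qed
    have ke: "k + \<epsilon> * e $ 2 = (\<epsilon> - \<bar>k\<bar>) * e $ 2" for \<epsilon>
    proof -
      have "e $ 2 = 1 \<or> e $ 2 = -1" using e2 by linarith
      then show ?thesis using sg by auto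
    qed
    have "\<bar>k\<bar> \<noteq> d - t * d"
    proof
      assume "\<bar>k\<bar> = d - t * d"
      then have "y $ 2 = y0" using ke[of "\<bar>k\<bar>"] ye by (simp add: k_def)
      then show False using y(2) by (simp add: ax_def)
    qed
    then have k': "\<bar>k\<bar> < d - t * d" using k by simp
    define r where "r = min (d - t * d - \<bar>k\<bar>) (s / 2)"
    have r: "r > 0" "r < s" "\<bar>k\<bar> + r \<le> d - t * d" using k' s by (auto simp: r_def)
    have "z + (\<bar>k\<bar> + r) *\<^sub>R e \<in> U"
      by (rule mem) (use r e2 e10 m zU in \<open>auto simp: ke abs_mult U_def\<close>)
    then have "infdist (z + (\<bar>k\<bar> + r) *\<^sub>R e) A = s - \<bar>k + (\<bar>k\<bar> + r) * e $ 2\<bar>"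
      using dU[of "z + (\<bar>k\<bar> + r) *\<^sub>R e"] unfolding k_def by (simp add: diff_add_eq)
    also have "\<bar>k + (\<bar>k\<bar> + r) * e $ 2\<bar> = r" using ke[of "\<bar>k\<bar> + r"] e2 r by (simp add: abs_mult)
    finally have "infdist z A + (\<bar>k\<bar> + r) = s - r" using ray[of "\<bar>k\<bar> + r"] r by simp
    moreover have "infdist z A = s - \<bar>k\<bar>" using dU[OF zU] by (simp add: k_def)
    ultimately show False using r by simp
  qed
  \<comment> \<open>The inner shell contains a rectangle of width \<open>\<beta> - \<alpha>\<close>
    and height \<open>h / (2 * s)\<close> directly above the ridge; its area is
    \<open>c * h\<close>.\<close>
  define c where "c = (\<beta> - \<alpha>) / (2 * s)"
  have c: "c > 0" using ab s by (simp add: c_def)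
  define P where "P h = sqvol A (\<sigma> + h) - sqvol A \<sigma>" for h
  define M where "M h = sqvol A \<sigma> - sqvol A (\<sigma> - h)" for h
  have main: "P h \<le> (1 + h / \<sigma>) * (M h - c * h)" if h: "0 < h" "h < \<sigma>" for h
  proof -
    define m where "m = 1 + h / \<sigma>"
    have m: "m > 1" using h \<sigma> by (simp add: m_def)
    have m\<sigma>: "m * \<sigma> = \<sigma> + h" using \<sigma> by (simp add: m_def field_simps)
    let ?Y = "sqshell A \<sigma> (\<sigma> + h) - ax" and ?Z = "sqshell A (\<sigma> - h) \<sigma> - U"
    have "emeasure lborel ?Y \<le> ennreal m * emeasure lborel ?Z"
    proof (rule emeasure_le_shrunk_plane[OF A])
      show "?Y \<in> sets borel" using ax by (auto intro!: sets.Diff)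
      fix y p assume y: "y \<in> ?Y" and p: "p \<in> nearest_points A y"
      have t: "0 < 1 / sqrt m" "1 / sqrt m < 1" using m by auto
      have "infdist y A \<ge> s"
        by (rule power2_le_imp_le[OF _ infdist_nonneg]) (use y in \<open>simp add: sqshell_def \<sigma>_def\<close>)
      then have "p + (1 / sqrt m) *\<^sub>R (y - p) \<notin> U" using y by (intro avoid[OF _ _ p t]) auto
      moreover have "(infdist (p + (1 / sqrt m) *\<^sub>R (y - p)) A)\<^sup>2 = (infdist y A)\<^sup>2 / m"
        using infdist_shrunk(2)[OF p, of "1 / sqrt m"] t m by (simp add: power_divide)
      moreover have "\<sigma> - h \<le> (infdist y A)\<^sup>2 / m"
      proof -
        have "(\<sigma> - h) * m \<le> \<sigma>" 
        proof -
          have "(\<sigma> - h) * m * \<sigma> = (\<sigma> - h) * (\<sigma> + h)" using m\<sigma> by (simp add: mult.assoc)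
          also have "\<dots> \<le> \<sigma> * \<sigma>" by (simp add: algebra_simps)
          finally show ?thesis using \<sigma> by (rule mult_right_le_imp_le)
        qed
        then have "\<sigma> - h \<le> \<sigma> / m" using m by (simp add: pos_le_divide_eq)
        also have "\<dots> \<le> (infdist y A)\<^sup>2 / m" using y m by (intro divide_right_mono) (auto simp: sqshell_def)
        finally show ?thesis .
      qed
      moreover have "(infdist y A)\<^sup>2 / m < \<sigma>"
        using y m m\<sigma> by (simp add: sqshell_def pos_divide_less_eq mult.commute)
      ultimately show "p + (1 / sqrt m) *\<^sub>R (y - p) \<in> ?Z" by (simp add: sqshell_def)
    qed (use U m in auto)
    moreover have "emeasure lborel ?Y = emeasure lborel (sqshell A \<sigma> (\<sigma> + h))"
      using ax by (intro emeasure_Diff_null_set) auto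
    moreover have fZ: "?Z \<in> fmeasurable lborel"
      using sqshell_fmeasurable[OF A] U by (intro fmeasurable_Diff) auto
    ultimately have "measure lborel (sqshell A \<sigma> (\<sigma> + h)) \<le> m * measure lborel ?Z"
      using sqshell_fmeasurable[OF A] m
      by (simp add: emeasure_eq_measure2 ennreal_mult'[symmetric])
    moreover have "measure lborel (sqshell A \<sigma> (\<sigma> + h)) = P h" using sqvol_diff[OF A, of \<sigma> "\<sigma> + h"] h by (simp add: P_def)
    moreover have "measure lborel ?Z \<le> M h - c * h"
    proof -
      define k where "k = h / (2 * s)"
      have k: "0 < k" "k < s" using h s by (auto simp: k_def \<sigma>_def power2_eq_square field_simps)
      define R :: "(real^2) set" where "R = box (vector [\<alpha>, y0]) (vector [\<beta>, y0 + k])"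
      have RU: "R \<subseteq> sqshell A (\<sigma> - h) \<sigma> \<inter> U"
      proof
        fix x assume "x \<in> R"
        then have x: "\<alpha> < x $ 1" "x $ 1 < \<beta>" "y0 < x $ 2" "x $ 2 < y0 + k"
          by (auto simp: R_def mem_box_cart forall_2)
        then have xU: "x \<in> U" using k by (simp add: U_def)
        define j where "j = x $ 2 - y0"
        have j: "0 < j" "j < k" using x by (auto simp: j_def)
        have dj: "infdist x A = s - j" using dU[OF xU] j by (simp add: j_def)
        have "(s - j)\<^sup>2 < s\<^sup>2" using j k by (intro power_strict_mono) auto
        moreover have "\<sigma> - h \<le> (s - j)\<^sup>2"
        proof -
          have "2 * s * j \<le> h" using j s by (simp add: k_def field_simps)
          moreover have "(s - j)\<^sup>2 = \<sigma> - 2 * s * j + j\<^sup>2" by (simp add: \<sigma>_def power2_diff)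
          ultimately show ?thesis using zero_le_power2[of j] by linarith
        qed
        ultimately show "x \<in> sqshell A (\<sigma> - h) \<sigma> \<inter> U" using xU dj by (simp add: sqshell_def \<sigma>_def)
      qed
      have "(\<beta> - \<alpha>) * k = measure lborel R" unfolding R_def using ab k by (subst measure_box_plane) auto
      also have "\<dots> \<le> measure lborel (sqshell A (\<sigma> - h) \<sigma> \<inter> U)"
        using RU sqshell_fmeasurable[OF A] U by (intro measure_mono_fmeasurable fmeasurable_Int_fmeasurable) (auto simp: R_def)
      finally have "c * h \<le> measure lborel (sqshell A (\<sigma> - h) \<sigma> \<inter> U)" by (simp add: c_def k_def)
      moreover have "measure lborel (sqshell A (\<sigma> - h) \<sigma>) = measure lborel (sqshell A (\<sigma> - h) \<sigma> \<inter> U) + measure lborel ?Z"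
      proof -
        have "measure lborel ((sqshell A (\<sigma> - h) \<sigma> \<inter> U) \<union> sqshell A (\<sigma> - h) \<sigma>)
          = measure lborel (sqshell A (\<sigma> - h) \<sigma> \<inter> U) + measure lborel (sqshell A (\<sigma> - h) \<sigma> - sqshell A (\<sigma> - h) \<sigma> \<inter> U)"
          using sqshell_fmeasurable[OF A] U by (intro measure_Un2 fmeasurable_Int_fmeasurable) auto
        moreover have "sqshell A (\<sigma> - h) \<sigma> - sqshell A (\<sigma> - h) \<sigma> \<inter> U = ?Z" by blast
        ultimately show ?thesis by (simp add: Un_absorb1)
      qed
      moreover have "measure lborel (sqshell A (\<sigma> - h) \<sigma>) = M h" using sqvol_diff[OF A, of "\<sigma> - h" \<sigma>] h by (simp add: M_def)
      ultimately show ?thesis by linarith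
    qed
    ultimately have "P h \<le> m * measure lborel ?Z" "measure lborel ?Z \<le> M h - c * h" by simp_all
    moreover from this(2) have "m * measure lborel ?Z \<le> m * (M h - c * h)" using m by (intro mult_left_mono) auto
    ultimately show ?thesis unfolding m_def by linarith
  qed
  have limP: "((\<lambda>h. P h / h) \<longlongrightarrow> D) (at_right 0)"
    using D unfolding DERIV_def P_def by (rule filterlim_mono) (auto simp: at_within_le_at)
  have limM: "((\<lambda>h. M h / h) \<longlongrightarrow> D) (at_right 0)"
  proof -
    have "((\<lambda>h. (sqvol A (\<sigma> + h) - sqvol A \<sigma>) / h) \<longlongrightarrow> D) (at_left 0)"
      using D unfolding DERIV_def by (rule filterlim_mono) (auto simp: at_within_le_at)
    then have "((\<lambda>h. (sqvol A (\<sigma> + - h) - sqvol A \<sigma>) / - h) \<longlongrightarrow> D) (at_right 0)"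
      by (subst (asm) filterlim_at_left_to_right) simp
    then show ?thesis by (simp add: M_def minus_divide_left[symmetric] diff_divide_distrib)
  qed
  have "((\<lambda>h. (1 + h / \<sigma>) * (M h / h - c)) \<longlongrightarrow> (1 + 0 / \<sigma>) * (D - c)) (at_right 0)"
    by (intro tendsto_intros limM) (use \<sigma> in auto)
  then have "D \<le> (1 + 0 / \<sigma>) * (D - c)"
  proof (rule tendsto_le[OF _ _ limP, rotated])
    show "\<forall>\<^sub>F h in at_right 0. P h / h \<le> (1 + h / \<sigma>) * (M h / h - c)"
      unfolding eventually_at_right_field
    proof (intro exI[of _ \<sigma>] conjI allI impI)
      fix h assume h: "0 < h" "h < \<sigma>"
      have "P h / h \<le> ((1 + h / \<sigma>) * (M h - c * h)) / h" using main[OF h] h by (intro divide_right_mono) auto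
      also have "\<dots> = (1 + h / \<sigma>) * ((M h - c * h) / h)" by simp
      also have "(M h - c * h) / h = M h / h - c" using h by (simp add: diff_divide_distrib)
      finally show "P h / h \<le> (1 + h / \<sigma>) * (M h / h - c)" .
    qed (use \<sigma> in auto)
  qed auto
  then show False using c by simp
qed

subsection \<open>Gap sums as suprema over finite sets\<close>

definition has_next :: "real set \<Rightarrow> real \<Rightarrow> bool" where "has_next X a \<longleftrightarrow> (\<exists>b\<in>X. a < b)"

definition next_in :: "real set \<Rightarrow> real \<Rightarrow> real" where "next_in X a = Min {b \<in> X. a < b}"

definition sqrt_jump :: "real set \<Rightarrow> real \<Rightarrow> real" where
  "sqrt_jump X a = (if has_next X a then sqrt (next_in X a - a) else 0)"

text \<open>For a finite set this real number is its degree-1/2 gap sum.\<close>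

definition sqrt_jumps :: "real set \<Rightarrow> real" where "sqrt_jumps X = (\<Sum>a\<in>X. sqrt_jump X a)"

lemma next_in:
  assumes "finite X" "has_next X a"
  shows "next_in X a \<in> X" "a < next_in X a" "\<And>b. b \<in> X \<Longrightarrow> a < b \<Longrightarrow> next_in X a \<le> b"
proof -
  have f: "finite {b \<in> X. a < b}" "{b \<in> X. a < b} \<noteq> {}" using assms by (auto simp: has_next_def)
  from Min_in[OF f] show "next_in X a \<in> X" "a < next_in X a" by (auto simp: next_in_def)
  show "next_in X a \<le> b" if "b \<in> X" "a < b" for b
    unfolding next_in_def by (rule Min_le) (use f that in auto)
qed

lemma next_in_eqI:
  assumes "finite X" "b \<in> X" "a < b" "\<And>c. c \<in> X \<Longrightarrow> a < c \<Longrightarrow> b \<le> c"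
  shows "has_next X a" "next_in X a = b"
proof -
  show h: "has_next X a" using assms by (auto simp: has_next_def)
  show "next_in X a = b" using next_in[OF assms(1) h] assms by (intro antisym) auto
qed

lemma sqrt_jump_nonneg: "finite X \<Longrightarrow> 0 \<le> sqrt_jump X a"
  using next_in(2)[of X a] by (cases "has_next X a") (auto simp: sqrt_jump_def)

lemma sqrt_jump_eqI:
  assumes "finite X" "b \<in> X" "a < b" "\<And>c. c \<in> X \<Longrightarrow> a < c \<Longrightarrow> b \<le> c"
  shows "sqrt_jump X a = sqrt (b - a)"
  using next_in_eqI[OF assms] by (simp add: sqrt_jump_def)

text \<open>A new point splits a gap in two. The piece on the side of \<open>y\<close> is no longer
  than \<open>\<bar>x - y\<bar>\<close> and the other is no longer than the old gap; the root of the
  first is all that is added. Beyond the ends only one piece appears.\<close>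

lemma sqrt_jumps_insert_le:
  assumes X: "finite X" and y: "y \<in> X"
  shows "sqrt_jumps (insert x X) \<le> sqrt_jumps X + sqrt \<bar>x - y\<bar>"
proof (cases "x \<in> X")
  case True then show ?thesis by (simp add: insert_absorb)
next
  case x: False
  let ?X = "insert x X"
  have xy: "x \<noteq> y" using x y by blast
  have same: "sqrt_jump ?X a = sqrt_jump X a" if "\<not> (a < x \<and> (\<forall>b\<in>X. a < b \<longrightarrow> x < b))" for a
  proof (cases "has_next X a")
    case True
    note n = next_in[OF X True]
    have "x \<le> a \<or> next_in X a \<le> x"
      using that n by (metis less_le_not_le linorder_not_less order_trans)
    then have "sqrt_jump ?X a = sqrt (next_in X a - a)"
      using n X by (intro sqrt_jump_eqI) auto
    then show ?thesis using True by (simp add: sqrt_jump_def)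
  next
    case False
    then have "\<not> has_next ?X a" using that by (auto simp: has_next_def)
    then show ?thesis using False by (simp add: sqrt_jump_def)
  qed
  have S: "sqrt_jumps ?X = sqrt_jump ?X x + (\<Sum>a\<in>X. sqrt_jump ?X a)" using X x by (simp add: sqrt_jumps_def)
  show ?thesis
  proof (cases "\<exists>a\<in>X. a < x")
    case False
    then have "(\<Sum>a\<in>X. sqrt_jump ?X a) = sqrt_jumps X"
      unfolding sqrt_jumps_def by (intro sum.cong same) auto
    moreover have "sqrt_jump ?X x \<le> sqrt \<bar>x - y\<bar>"
    proof (cases "has_next ?X x")
      case True
      have "x < y" using False y xy by (meson linorder_neqE_linordered_idom)
      then have "next_in ?X x \<le> y" using y by (intro next_in(3)[OF _ True]) (use X in auto)
      then show ?thesis using True by (simp add: sqrt_jump_def)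
    qed (simp add: sqrt_jump_def)
    ultimately show ?thesis using S by simp
  next
    case True
    define u where "u = Max {a \<in> X. a < x}"
    have f: "finite {a \<in> X. a < x}" "{a \<in> X. a < x} \<noteq> {}" using X True by auto
    have u: "u \<in> X" "u < x" using Max_in[OF f] by (auto simp: u_def)
    have umax: "a \<le> u" if "a \<in> X" "a < x" for a unfolding u_def by (rule Max_ge) (use f that in auto)
    have next_u: "x \<le> b" if "b \<in> ?X" "u < b" for b using umax[of b] that by force
    have gu: "sqrt_jump ?X u = sqrt (x - u)" by (rule sqrt_jump_eqI) (use X u next_u in auto)
    have "(\<Sum>a\<in>X - {u}. sqrt_jump ?X a) = (\<Sum>a\<in>X - {u}. sqrt_jump X a)"
    proof (intro sum.cong same refl)
      fix a assume "a \<in> X - {u}"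
      then show "\<not> (a < x \<and> (\<forall>b\<in>X. a < b \<longrightarrow> x < b))" using umax[of a] u by force
    qed
    then have sums: "(\<Sum>a\<in>X. sqrt_jump ?X a) = sqrt_jumps X - sqrt_jump X u + sqrt (x - u)"
      using X u gu by (simp add: sqrt_jumps_def sum.remove[of X u])
    show ?thesis
    proof (cases "has_next X x")
      case False
      then have "\<not> has_next ?X x" by (auto simp: has_next_def)
      moreover have "y < x" using False y xy by (meson has_next_def linorder_neqE_linordered_idom)
      then have "sqrt (x - u) \<le> sqrt \<bar>x - y\<bar>" using umax[OF y] by auto
      moreover from calculation(1) have "sqrt_jump ?X x = 0" by (simp add: sqrt_jump_def)
      ultimately show ?thesis using S sums sqrt_jump_nonneg[OF X, of u] by linarith
    next
      case True
      define v where "v = next_in X x"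
      have v: "v \<in> X" "x < v" "\<And>b. b \<in> X \<Longrightarrow> x < b \<Longrightarrow> v \<le> b"
        using next_in[OF X True] by (auto simp: v_def)
      have gx: "sqrt_jump ?X x = sqrt (v - x)" by (rule sqrt_jump_eqI) (use X v in auto)
      have gXu: "sqrt_jump X u = sqrt (v - u)"
      proof (rule sqrt_jump_eqI[OF X v(1)])
        fix c assume c: "c \<in> X" "u < c"
        then have "x \<le> c" "x \<noteq> c" using next_u[of c] x by auto
        then have "x < c" by simp
        then show "v \<le> c" using v(3) c by blast
      qed (use u v in auto)
      have "sqrt (x - u) + sqrt (v - x) \<le> sqrt (v - u) + sqrt \<bar>x - y\<bar>"
      proof (cases "y < x")
        case True
        then have "sqrt (x - u) \<le> sqrt \<bar>x - y\<bar>" "sqrt (v - x) \<le> sqrt (v - u)" using umax[OF y] u by auto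
        then show ?thesis by linarith
      next
        case False
        then have "x < y" using xy by simp
        then have "sqrt (v - x) \<le> sqrt \<bar>x - y\<bar>" "sqrt (x - u) \<le> sqrt (v - u)" using v(3)[OF y] v u by auto
        then show ?thesis by linarith
      qed
      then show ?thesis using S sums gx gXu by simp
    qed
  qed
qed

text \<open>Insert the points in the order of \<open>\<tau>\<close>. The first is tied to
  \<open>y0\<close> at cost \<open>J\<close>, each later one to its predecessor at cost
  \<open>L\<close> times the increment of \<open>\<tau>\<close>, and the increments add up to at
  most \<open>l\<close>.\<close>

lemma sqrt_jumps_chain_le:
  fixes val \<tau> :: "'a \<Rightarrow> real"
  assumes E: "finite E" and X: "finite X" "y0 \<in> X" and L: "0 \<le> L" and J: "0 \<le> J"
    and lip: "\<And>x y. x \<in> E \<Longrightarrow> y \<in> E \<Longrightarrow> sqrt \<bar>val x - val y\<bar> \<le> L * \<bar>\<tau> x - \<tau> y\<bar>"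
    and J0: "\<And>x. x \<in> E \<Longrightarrow> sqrt \<bar>val x - y0\<bar> \<le> J"
    and rng: "\<And>x. x \<in> E \<Longrightarrow> \<alpha> \<le> \<tau> x \<and> \<tau> x \<le> \<alpha> + l" and l: "0 \<le> l"
  shows "sqrt_jumps (X \<union> val ` E) \<le> sqrt_jumps X + J + L * l"
proof -
  have "F \<subseteq> E \<longrightarrow> (\<forall>T\<ge>\<alpha>. (\<forall>y\<in>F. \<tau> y \<le> T) \<longrightarrow> sqrt_jumps (X \<union> val ` F) \<le> sqrt_jumps X + J + L * (T - \<alpha>))"
    if "finite F" for F
    using that
  proof (induction F rule: finite_ranking_induct[where f = \<tau>])
    case empty
    then show ?case using L J by simp
  next
    case (insert x F)
    note 2 = insert
    show ?case
    proof (intro impI allI)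
      fix T assume sub: "insert x F \<subseteq> E" and T: "\<alpha> \<le> T" "\<forall>y\<in>insert x F. \<tau> y \<le> T"
      have ins: "sqrt_jumps (X \<union> val ` insert x F) \<le> sqrt_jumps (X \<union> val ` F) + sqrt \<bar>val x - z\<bar>" if "z \<in> X \<union> val ` F" for z
        using sqrt_jumps_insert_le[of "X \<union> val ` F" z "val x"] that X 2 by simp
      show "sqrt_jumps (X \<union> val ` insert x F) \<le> sqrt_jumps X + J + L * (T - \<alpha>)"
      proof (cases "F = {}")
        case True
        have "sqrt_jumps (X \<union> val ` insert x F) \<le> sqrt_jumps X + J"
          using ins[of y0] X J0[of x] sub True by simp
        moreover have "0 \<le> L * (T - \<alpha>)" using L T by simp
        ultimately show ?thesis by linarith
      next
        case False
        have "\<exists>y\<in>F. \<forall>z\<in>F. \<tau> z \<le> \<tau> y"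
        proof -
          have "Max (\<tau> ` F) \<in> \<tau> ` F" using 2 False by (intro Max_in) auto
          then obtain y where "y \<in> F" "\<tau> y = Max (\<tau> ` F)" by auto
          then show ?thesis using 2 by (intro bexI[of _ y]) auto
        qed
        then obtain y where y: "y \<in> F" "\<And>z. z \<in> F \<Longrightarrow> \<tau> z \<le> \<tau> y" by blast
        have "sqrt_jumps (X \<union> val ` F) \<le> sqrt_jumps X + J + L * (\<tau> y - \<alpha>)"
          using 2(3) sub y rng by auto
        moreover have "sqrt \<bar>val x - val y\<bar> \<le> L * (\<tau> x - \<tau> y)"
          using lip[of x y] sub y 2(2)[of y] by auto
        ultimately have "sqrt_jumps (X \<union> val ` insert x F) \<le> sqrt_jumps X + J + L * (\<tau> x - \<alpha>)"
          using ins[of "val y"] y(1) by (simp add: algebra_simps)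
        moreover have "L * (\<tau> x - \<alpha>) \<le> L * (T - \<alpha>)" using T L by (intro mult_left_mono) auto
        ultimately show ?thesis by linarith
      qed
    qed
  qed
  from this[OF E] have "\<forall>T\<ge>\<alpha>. (\<forall>y\<in>E. \<tau> y \<le> T) \<longrightarrow> sqrt_jumps (X \<union> val ` E) \<le> sqrt_jumps X + J + L * (T - \<alpha>)"
    by simp
  from this[rule_format, of "\<alpha> + l"] have "sqrt_jumps (X \<union> val ` E) \<le> sqrt_jumps X + J + L * ((\<alpha> + l) - \<alpha>)"
    using rng l by simp
  then show ?thesis by simp
qed

section \<open>Gap sums of closed sets from their finite subsets\<close>

lemma gaps_eq:
  fixes K :: "real set"
  assumes "closed K"
  shows "gaps K = {I. \<exists>a b. a < b \<and> a \<in> K \<and> b \<in> K \<and> {a<..<b} \<inter> K = {} \<and> I = {a<..<b}}"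
proof (intro set_eqI iffI)
  fix I assume "I \<in> {I. \<exists>a b. a < b \<and> a \<in> K \<and> b \<in> K \<and> {a<..<b} \<inter> K = {} \<and> I = {a<..<b}}"
  then obtain a b where ab: "a < b" "a \<in> K" "b \<in> K" "{a<..<b} \<inter> K = {}" "I = {a<..<b}" by blast
  have "I \<in> components (- K)"
    unfolding in_components_maximal
  proof (intro conjI allI impI)
    show "I \<noteq> {}" "I \<subseteq> - K" "connected I" using ab by auto
    fix d assume d: "d \<noteq> {} \<and> I \<subseteq> d \<and> d \<subseteq> - K \<and> connected d"
    show "d = I"
    proof
      show "d \<subseteq> I"
      proof
        fix x assume x: "x \<in> d"
        define m where "m = (a + b) / 2"
        have m: "m \<in> d" "a < m" "m < b" using ab d by (auto simp: m_def)
        have "a \<notin> d" "b \<notin> d" using ab d by auto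
        have "\<not> x \<le> a" 
        proof
          assume "x \<le> a"
          then have "a \<in> d" using d x m by (intro connectedD_interval[of d x m a]) auto
          then show False using \<open>a \<notin> d\<close> by simp
        qed
        moreover have "\<not> b \<le> x"
        proof
          assume "b \<le> x"
          then have "b \<in> d" using d x m by (intro connectedD_interval[of d m x b]) auto
          then show False using \<open>b \<notin> d\<close> by simp
        qed
        ultimately show "x \<in> I" using ab by auto
      qed
    qed (use d in auto)
  qed
  then show "I \<in> gaps K" using ab by (auto simp: gaps_def)
next
  fix I assume "I \<in> gaps K"
  then have I: "I \<in> components (- K)" "bounded I" by (auto simp: gaps_def)
  have op: "open I" using I(1) assms by (meson open_Compl open_components)
  have ne: "I \<noteq> {}" and con: "connected I" and sub: "I \<subseteq> - K"
    using I(1) in_components_nonempty in_components_connected in_components_subset by blast+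
  have bd: "bdd_below I" "bdd_above I" using I(2) by (auto simp: bounded_imp_bdd_below bounded_imp_bdd_above)
  define a b where "a = Inf I" and "b = Sup I"
  have aI: "a \<notin> I" and bI: "b \<notin> I"
  proof -
    show "a \<notin> I"
    proof
      assume "a \<in> I"
      then obtain e where "e > 0" "ball a e \<subseteq> I" using op open_contains_ball by blast
      then have "a - e/2 \<in> I" by (auto simp: dist_real_def)
      then show False using cInf_lower[OF _ bd(1)] \<open>e > 0\<close> by (force simp: a_def)
    qed
    show "b \<notin> I"
    proof
      assume "b \<in> I"
      then obtain e where "e > 0" "ball b e \<subseteq> I" using op open_contains_ball by blast
      then have "b + e/2 \<in> I" by (auto simp: dist_real_def)
      then show False using cSup_upper[OF _ bd(2)] \<open>e > 0\<close> by (force simp: b_def)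
    qed
  qed
  have Iab: "I = {a<..<b}"
  proof
    show "I \<subseteq> {a<..<b}"
      using cInf_lower[OF _ bd(1)] cSup_upper[OF _ bd(2)] aI bI by (force simp: a_def b_def less_le)
    show "{a<..<b} \<subseteq> I"
    proof
      fix x assume x: "x \<in> {a<..<b}"
      obtain u where u: "u \<in> I" "u < x" using x cInf_less_iff[OF ne bd(1), of x] by (auto simp: a_def)
      obtain v where v: "v \<in> I" "x < v" using x less_cSup_iff[OF ne bd(2), of x] by (auto simp: b_def)
      show "x \<in> I" using connectedD_interval[OF con u(1) v(1)] u v by auto
    qed
  qed
  have ab: "a < b" using Iab ne by auto
  have endp: "c \<in> K" if "c \<notin> I" "connected (insert c I)" for c
  proof (rule ccontr)
    assume "c \<notin> K"
    then have "insert c I \<subseteq> I"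
      using components_maximal[OF I(1) that(2)] sub ne by auto
    then show False using that by auto
  qed
  have "insert a I = {a..<b}" "insert b I = {a<..b}" using Iab ab by auto
  then have "a \<in> K" "b \<in> K" using endp[OF aI] endp[OF bI] by (auto simp: is_interval_connected)
  then show "I \<in> {I. \<exists>a b. a < b \<and> a \<in> K \<and> b \<in> K \<and> {a<..<b} \<inter> K = {} \<and> I = {a<..<b}}"
    using ab Iab sub by blast
qed

lemma measure_open_interval: "a < b \<Longrightarrow> measure lborel {a<..<b} = b - a" for a b :: real
  by simp

text \<open>The endpoints of finitely many gaps form a finite subset of \<open>K\<close>. Nothing of
  \<open>K\<close> lies inside a gap, so every chosen gap is one of the jumps of this
  subset.\<close>

lemma gap_sum_half_le:
  assumes K: "closed K" and bd: "\<And>X. finite X \<Longrightarrow> X \<subseteq> K \<Longrightarrow> sqrt_jumps X \<le> B"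
  shows "gap_sum_half K \<le> ennreal B"
  unfolding gap_sum_half_def
proof (rule infsum_le_finite_sums)
  show "(\<lambda>I. ennreal (sqrt (measure lborel I))) summable_on gaps K" by (rule nonneg_summable_on_complete) auto
  fix F assume F: "finite F" "F \<subseteq> gaps K"
  have "\<forall>I\<in>F. \<exists>a b. a < b \<and> a \<in> K \<and> b \<in> K \<and> {a<..<b} \<inter> K = {} \<and> I = {a<..<b}"
    using F(2) unfolding gaps_eq[OF K] by blast
  then obtain a b where ab: "\<And>I. I \<in> F \<Longrightarrow> a I < b I \<and> a I \<in> K \<and> b I \<in> K \<and> {a I<..<b I} \<inter> K = {} \<and> I = {a I<..<b I}"
    by metis
  define X where "X = a ` F \<union> b ` F"
  have X: "finite X" "X \<subseteq> K" using F ab by (auto simp: X_def)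
  have nx: "sqrt_jump X (a I) = sqrt (measure lborel I)" if "I \<in> F" for I
  proof -
    have "sqrt_jump X (a I) = sqrt (b I - a I)"
    proof (rule sqrt_jump_eqI[OF X(1)])
      show "b I \<in> X" using that by (auto simp: X_def)
      show "a I < b I" using ab[OF that] by blast
      show "b I \<le> c" if "c \<in> X" "a I < c" for c
        using ab[OF \<open>I \<in> F\<close>] that X(2) by (meson disjoint_iff greaterThanLessThan_iff not_le subsetD)
    qed
    moreover have "I = {a I<..<b I}" "a I < b I" using ab[OF that] by blast+
    ultimately show ?thesis by (metis measure_open_interval)
  qed
  have inj: "inj_on a F"
  proof (rule inj_onI)
    fix I I' assume I: "I \<in> F" "I' \<in> F" "a I = a I'"
    then have "sqrt (b I - a I) = sqrt (b I' - a I')"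
      using nx ab by (metis measure_open_interval)
    then have "b I = b I'" using I by simp
    then show "I = I'" using I ab by metis
  qed
  have "(\<Sum>I\<in>F. ennreal (sqrt (measure lborel I))) = ennreal (\<Sum>I\<in>F. sqrt_jump X (a I))"
    using nx sqrt_jump_nonneg[OF X(1)] by (subst sum_ennreal[symmetric]) auto
  also have "(\<Sum>I\<in>F. sqrt_jump X (a I)) = (\<Sum>x\<in>a ` F. sqrt_jump X x)" using inj by (simp add: sum.reindex)
  also have "\<dots> \<le> sqrt_jumps X" unfolding sqrt_jumps_def
    using X sqrt_jump_nonneg[OF X(1)] by (intro sum_mono2) (auto simp: X_def)
  also have "\<dots> \<le> B" by (rule bd[OF X])
  finally show "(\<Sum>I\<in>F. ennreal (sqrt (measure lborel I))) \<le> ennreal B" by (simp add: ennreal_leI)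
qed

text \<open>A maximal \<open>d\<close>-separated \<open>X \<subseteq> K\<close> satisfies
  \<open>(card X - 1) * sqrt d \<le> B\<close>, and the intervals of radius \<open>d\<close> around
  it cover \<open>K\<close>. Their total length is at most \<open>2 * d + 2 * B * sqrt d\<close>,
  which tends to 0 with \<open>d\<close>.\<close>

lemma null_of_sqrt_jumps_bound:
  assumes K: "K \<in> sets borel" and bd: "\<And>X. finite X \<Longrightarrow> X \<subseteq> K \<Longrightarrow> sqrt_jumps X \<le> B"
  shows "emeasure lborel K = 0"
proof -
  have B0: "B \<ge> 0" using bd[of "{}"] by (simp add: sqrt_jumps_def)
  have est: "emeasure lborel K \<le> ennreal (2 * d + 2 * B * sqrt d)" if d: "d > 0" for d
  proof -
    define sep where "sep X \<longleftrightarrow> finite X \<and> X \<subseteq> K \<and> (\<forall>x\<in>X. \<forall>y\<in>X. x \<noteq> y \<longrightarrow> d \<le> \<bar>x - y\<bar>)" for X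
    have card: "(real (card X) - 1) * sqrt d \<le> B" if "sep X" for X
    proof (cases "X = {}")
      case False
      have X: "finite X" "X \<subseteq> K" using that by (auto simp: sep_def)
      have "(real (card X) - 1) * sqrt d = (\<Sum>x\<in>X - {Max X}. sqrt d)"
        using X False by (simp add: of_nat_diff card_gt_0_iff Suc_le_eq)
      also have "\<dots> \<le> (\<Sum>x\<in>X - {Max X}. sqrt_jump X x)"
      proof (rule sum_mono)
        fix x assume x: "x \<in> X - {Max X}"
        then have "x < Max X" using X Max_ge[of X x] by (auto simp: less_le)
        then have h: "has_next X x" using Max_in[OF X(1) False] by (auto simp: has_next_def)
        have "\<forall>x\<in>X. \<forall>y\<in>X. x \<noteq> y \<longrightarrow> d \<le> \<bar>x - y\<bar>" using that by (simp add: sep_def)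
        moreover have "next_in X x \<noteq> x" using next_in(2)[OF X(1) h] by simp
        ultimately have "d \<le> \<bar>next_in X x - x\<bar>" using next_in(1)[OF X(1) h] x by blast
        then show "sqrt d \<le> sqrt_jump X x" using h next_in(2)[OF X(1) h] by (simp add: sqrt_jump_def)
      qed
      also have "\<dots> \<le> sqrt_jumps X" unfolding sqrt_jumps_def
        using X sqrt_jump_nonneg[OF X(1)] by (intro sum_mono2) auto
      also have "\<dots> \<le> B" by (rule bd[OF X])
      finally show ?thesis .
    qed (use B0 d in \<open>auto intro: order_trans[of _ 0]\<close>)
    have "card X \<le> nat \<lceil>B / sqrt d + 1\<rceil>" if "sep X" for X
    proof -
      have "real (card X) \<le> B / sqrt d + 1" using card[OF that] d by (simp add: field_simps)
      then show ?thesis by linarith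
    qed
    moreover have "sep {}" by (simp add: sep_def)
    ultimately obtain X where X: "sep X" "\<And>Y. sep Y \<Longrightarrow> card Y \<le> card X"
      using ex_has_greatest_nat[of sep "{}" card "Suc (nat \<lceil>B / sqrt d + 1\<rceil>)"] by (metis le_imp_less_Suc)
    have finX: "finite X" using X(1) by (simp add: sep_def)
    have cover: "K \<subseteq> (\<Union>x\<in>X. {x - d..x + d})"
    proof
      fix k assume k: "k \<in> K"
      show "k \<in> (\<Union>x\<in>X. {x - d..x + d})"
      proof (rule ccontr)
        assume n: "k \<notin> (\<Union>x\<in>X. {x - d..x + d})"
        then have far: "d \<le> \<bar>k - x\<bar>" if "x \<in> X" for x using that by force
        have "k \<notin> X" using n d by force
        moreover have "sep (insert k X)" using X(1) k far by (auto simp: sep_def abs_minus_commute)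
        ultimately show False using X(2)[of "insert k X"] X(1) by (simp add: sep_def)
      qed
    qed
    have "emeasure lborel K \<le> emeasure lborel (\<Union>x\<in>X. {x - d..x + d})"
      by (rule emeasure_mono[OF cover]) (use finX in \<open>auto intro!: sets.finite_UN\<close>)
    also have "\<dots> \<le> (\<Sum>x\<in>X. emeasure lborel {x - d..x + d})"
      by (rule emeasure_subadditive_finite) (use finX in auto)
    also have "\<dots> = ennreal (real (card X) * (2 * d))" using d by (simp add: ennreal_mult ennreal_of_nat_eq_real_of_nat)
    also have "\<dots> \<le> ennreal (2 * d + 2 * B * sqrt d)"
    proof (rule ennreal_leI)
      obtain e where e: "sqrt d = e" "d = e * e" using d by (metis less_imp_le real_sqrt_mult_self abs_of_pos)
      then have "(real (card X) - 1) * (2 * d) = 2 * sqrt d * ((real (card X) - 1) * sqrt d)" by simp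
      also have "\<dots> \<le> 2 * sqrt d * B" using card[OF X(1)] d by (intro mult_left_mono) auto
      finally show "real (card X) * (2 * d) \<le> 2 * d + 2 * B * sqrt d" by (simp add: algebra_simps)
    qed
    finally show ?thesis .
  qed
  have "((\<lambda>d. ennreal (2 * d + 2 * B * sqrt d)) \<longlongrightarrow> ennreal (2 * 0 + 2 * B * sqrt 0)) (at_right 0)"
    by (intro tendsto_intros)
  moreover have "\<forall>\<^sub>F d in at_right 0. emeasure lborel K \<le> ennreal (2 * d + 2 * B * sqrt d)"
    using est by (auto simp: eventually_at_right_field intro: exI[of _ 1])
  ultimately have "emeasure lborel K \<le> ennreal (2 * 0 + 2 * B * sqrt 0)"
    by (rule tendsto_lowerbound) simp
  then show ?thesis by simp
qed

subsection \<open>The gap sum of the critical values\<close>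

definition critical_values :: "'a::euclidean_space set \<Rightarrow> real set" where
  "critical_values A = (\<lambda>x. infdist x A) ` {x. critical_point A x}"

lemma nondiff_radii_subset_critical_values:
  fixes A :: "(real^2) set"
  assumes "compact A" "A \<noteq> {}"
  shows "nondiff_radii A \<subseteq> critical_values A"
proof
  fix s assume s: "s \<in> nondiff_radii A"
  show "s \<in> critical_values A"
  proof (rule ccontr)
    assume "s \<notin> critical_values A"
    then have "{x. critical_point A x \<and> infdist x A = s} = {}" by (auto simp: critical_values_def)
    then have "finite {x. critical_point A x \<and> infdist x A = s}" by (simp only: finite.emptyI)
    then have "volume_function A differentiable (at s)"
      using s by (intro volume_function_differentiable[OF assms]) (auto simp: nondiff_radii_def)
    then show False using s by (simp add: nondiff_radii_def)
  qed
qed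

section \<open>Metric estimates for critical points\<close>

text \<open>Testing criticality with the direction \<open>y - x\<close> provides a nearest point for
  which the linear term of \<open>infdist_sq_le\<close> is not positive.\<close>

lemma critical_point_infdist_sq_le:
  assumes "critical_point A x"
  shows "(infdist y A)\<^sup>2 \<le> (infdist x A)\<^sup>2 + (dist x y)\<^sup>2"
proof -
  obtain p where p: "p \<in> nearest_points A x" "(x - p) \<bullet> (y - x) \<le> 0"
    using assms by (auto simp: critical_point_def)
  show ?thesis using infdist_sq_le[OF p(1), of "y - x"] p(2) by (simp add: dist_norm norm_minus_commute)
qed

lemma critical_points_sq_diff:
  assumes "critical_point A x" "critical_point A y"
  shows "\<bar>(infdist x A)\<^sup>2 - (infdist y A)\<^sup>2\<bar> \<le> (dist x y)\<^sup>2"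
  using critical_point_infdist_sq_le[OF assms(1), of y] critical_point_infdist_sq_le[OF assms(2), of x]
  by (simp add: dist_commute abs_le_iff)

text \<open>Testing with the direction \<open>x\<close> itself gives a nearest point at least as far
  from the origin as \<open>x\<close>.\<close>

lemma critical_point_norm_le:
  assumes A: "\<And>a. a \<in> A \<Longrightarrow> norm a \<le> R" and x: "critical_point A x"
  shows "norm x \<le> R" "infdist x A \<le> 2 * R"
proof -
  obtain p where p: "p \<in> nearest_points A x" "(x - p) \<bullet> x \<le> 0"
    using x by (auto simp: critical_point_def)
  have pA: "norm p \<le> R" using p A by (auto simp: nearest_points_def)
  have "norm x * norm x \<le> norm p * norm x"
    using p(2) norm_cauchy_schwarz[of p x] by (simp add: inner_diff_left flip: power2_norm_eq_inner power2_eq_square)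
  then have "norm x \<le> norm p" by (cases "x = 0") auto
  then show "norm x \<le> R" using pA by simp
  moreover have "infdist x A = norm (x - p)" using p by (auto simp: nearest_points_def dist_norm)
  ultimately show "infdist x A \<le> 2 * R" using pA norm_triangle_ineq4[of x p] by simp
qed

text \<open>Gap sums are taken of closures, so limits must be critical as well. Both the critical
  points and their nearest points have convergent subsequences, and the limit inherits the sign
  condition; positivity of \<open>s\<close> keeps the limit off \<open>A\<close>.\<close>

lemma closure_critical_values:
  fixes A :: "'a::euclidean_space set"
  assumes A: "compact A" "A \<noteq> {}" and s: "s > 0" "s \<in> closure (critical_values A)"
  shows "s \<in> critical_values A"
proof -
  obtain S where S: "\<And>n. S n \<in> critical_values A" "S \<longlonglongrightarrow> s" using s(2) closure_sequential by blast
  have "\<exists>x. critical_point A x \<and> infdist x A = S n" for n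
    using S(1)[of n] by (auto simp: critical_values_def)
  then obtain X where X: "\<And>n. critical_point A (X n)" "\<And>n. infdist (X n) A = S n" by metis
  obtain R where R: "\<And>a. a \<in> A \<Longrightarrow> norm a \<le> R" using compact_imp_bounded[OF A(1)] by (auto simp: bounded_iff)
  have "\<forall>n. X n \<in> cball 0 R" using critical_point_norm_le[OF R X(1)] by simp
  then obtain x r where x: "strict_mono r" "(X \<circ> r) \<longlonglongrightarrow> x"
    using compact_cball[of "0::'a" R] unfolding compact_def by blast
  have "(\<lambda>n. infdist ((X \<circ> r) n) A) \<longlonglongrightarrow> infdist x A" by (intro tendsto_infdist x)
  moreover have "(S \<circ> r) \<longlonglongrightarrow> s" using S(2) x(1) by (rule LIMSEQ_subseq_LIMSEQ)
  ultimately have dx: "infdist x A = s" using X(2) LIMSEQ_unique by (simp add: o_def)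
  have "critical_point A x"
    unfolding critical_point_def
  proof (intro conjI allI)
    show "infdist x A > 0" using dx s by simp
    fix v
    have "\<forall>n. \<exists>p. p \<in> nearest_points A ((X \<circ> r) n) \<and> ((X \<circ> r) n - p) \<bullet> v \<le> 0"
      using X(1) unfolding critical_point_def by auto
    then obtain P where P: "\<And>n. P n \<in> nearest_points A ((X \<circ> r) n)" "\<And>n. ((X \<circ> r) n - P n) \<bullet> v \<le> 0"
      by metis
    obtain p q where p: "p \<in> nearest_points A x" "strict_mono q" "(P \<circ> q) \<longlonglongrightarrow> p"
      by (rule nearest_points_limit[OF A(1) x(2) P(1)])
    have "(\<lambda>n. (((X \<circ> r) \<circ> q) n - (P \<circ> q) n) \<bullet> v) \<longlonglongrightarrow> (x - p) \<bullet> v"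
      by (intro tendsto_intros p LIMSEQ_subseq_LIMSEQ[OF x(2)])
    then have "(x - p) \<bullet> v \<le> 0"
      by (rule LIMSEQ_le_const2) (use P(2) in auto)
    then show "\<exists>p\<in>nearest_points A x. (x - p) \<bullet> v \<le> 0" using p by blast
  qed
  then show ?thesis using dx by (auto simp: critical_values_def)
qed

text \<open>
  Critical points with a nearest point in nearly the same coordinate direction \<open>\<pm>e\<^sub>i\<close> lie on a
  Lipschitz graph over the other axis.
\<close>

definition steep_points :: "(real^2) set \<Rightarrow> 2 \<Rightarrow> real \<Rightarrow> (real^2) set" where
  "steep_points A i \<epsilon> = {x. \<exists>n\<in>nearest_points A x. infdist x A \<le> sqrt 2 * (\<epsilon> * ((x - n) $ i))}"

lemma steep_points_cover:
  fixes A :: "(real^2) set"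
  assumes "compact A" "A \<noteq> {}"
  shows "\<exists>i\<in>{1, 2}. \<exists>\<epsilon>\<in>{-1, 1}. x \<in> steep_points A i \<epsilon>"
proof -
  obtain n where n: "n \<in> nearest_points A x"
    using nearest_points_nonempty compact_imp_closed[OF assms(1)] assms(2) by metis
  define d where "d = infdist x A"
  have d: "d\<^sup>2 = ((x - n) $ 1)\<^sup>2 + ((x - n) $ 2)\<^sup>2"
    using n norm_plane[of "x - n"] by (simp add: d_def nearest_points_def dist_norm)
  have "\<exists>i\<in>{1, 2::2}. d\<^sup>2 \<le> 2 * ((x - n) $ i)\<^sup>2" using d by (auto simp: not_le)
  then obtain i where i: "i \<in> {1, 2::2}" "d\<^sup>2 \<le> 2 * ((x - n) $ i)\<^sup>2" by blast
  then have "d \<le> sqrt (2 * ((x - n) $ i)\<^sup>2)" by (intro real_le_rsqrt)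
  then have le: "d \<le> sqrt 2 * \<bar>(x - n) $ i\<bar>" by (simp add: real_sqrt_mult)
  show ?thesis
  proof (rule bexI[OF _ i(1)])
    show "\<exists>\<epsilon>\<in>{-1, 1}. x \<in> steep_points A i \<epsilon>"
    proof (cases "(x - n) $ i \<ge> 0")
      case True
      then have "x \<in> steep_points A i 1" using n le unfolding steep_points_def d_def by (auto intro!: bexI[of _ n])
      then show ?thesis by blast
    next
      case False
      then have "x \<in> steep_points A i (-1)" using n le unfolding steep_points_def d_def by (auto intro!: bexI[of _ n])
      then show ?thesis by blast
    qed
  qed
qed

text \<open>Write \<open>W\<close>, \<open>V\<close> for the displacements along the steep axis and
  the other one, \<open>D\<close> for the distance. The two critical point bounds give
  \<open>(x - n) \<bullet> (x - y) \<le> D^2\<close>; steepness turns this into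
  \<open>d * (W - V) \<le> sqrt 2 * D^2\<close>, and \<open>4 * D \<le> d\<close> with
  \<open>sqrt 2 \<le> 3/2\<close> into \<open>W - V \<le> 3/8 * D\<close>. Together with
  \<open>D \<le> W + V\<close> this yields \<open>5/8 * D \<le> 2 * V\<close>. Exchanging
  \<open>x\<close> and \<open>y\<close> makes \<open>W\<close> nonnegative.\<close>

lemma steep_points_graph:
  fixes A :: "(real^2) set"
  assumes crit: "critical_point A x" "critical_point A y" and ij: "{i, j} = {1, 2::2}"
    and e: "\<epsilon> \<in> {-1, 1}" and st: "x \<in> steep_points A i \<epsilon>" "y \<in> steep_points A i \<epsilon>"
    and near: "4 * dist x y \<le> infdist x A" "4 * dist x y \<le> infdist y A"
  shows "dist x y \<le> 4 * \<bar>x $ j - y $ j\<bar>"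
proof -
  have plane: "(norm z)\<^sup>2 = (z $ i)\<^sup>2 + (z $ j)\<^sup>2" and inner_plane: "z \<bullet> w = z $ i * w $ i + z $ j * w $ j" for z w :: "real^2"
  proof -
    have "(i = 1 \<and> j = 2) \<or> (i = 2 \<and> j = 1)" using ij by (auto simp: doubleton_eq_iff)
    then show "(norm z)\<^sup>2 = (z $ i)\<^sup>2 + (z $ j)\<^sup>2" "z \<bullet> w = z $ i * w $ i + z $ j * w $ j"
      by (auto simp: norm_plane inner_vec_def sum_2)
  qed
  have main: "dist x y \<le> 4 * \<bar>x $ j - y $ j\<bar>"
    if crit: "critical_point A x" "critical_point A y" and st: "x \<in> steep_points A i \<epsilon>"
      and near: "4 * dist x y \<le> infdist x A" and pos: "0 \<le> \<epsilon> * ((x - y) $ i)" for x y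
  proof -
    define d D W V where "d = infdist x A" and "D = dist x y" and "W = \<epsilon> * ((x - y) $ i)" and "V = \<bar>(x - y) $ j\<bar>"
    have d: "d > 0" using crit(1) by (simp add: d_def critical_point_def)
    obtain n where n: "n \<in> nearest_points A x" "d \<le> sqrt 2 * (\<epsilon> * ((x - n) $ i))"
      using st by (auto simp: steep_points_def d_def)
    define a b where "a = \<epsilon> * ((x - n) $ i)" and "b = (x - n) $ j"
    have ee: "\<epsilon> * \<epsilon> = 1" using e by auto
    have s2: "sqrt 2 * sqrt 2 = (2::real)" "sqrt 2 > 0" by auto
    have a: "d \<le> sqrt 2 * a" using n(2) by (simp add: a_def)
    then have "d\<^sup>2 \<le> 2 * a\<^sup>2" using d power_mono[of d "sqrt 2 * a" 2] by (simp add: power_mult_distrib)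
    moreover have "d\<^sup>2 = a\<^sup>2 + b\<^sup>2"
    proof -
      have "d\<^sup>2 = (norm (x - n))\<^sup>2" using n(1) by (simp add: d_def nearest_points_def dist_norm)
      also have "\<dots> = a\<^sup>2 + b\<^sup>2" using e unfolding plane a_def b_def by (auto simp: power_mult_distrib)
      finally show ?thesis .
    qed
    ultimately have "2 * b\<^sup>2 \<le> d\<^sup>2" by linarith
    then have "sqrt (2 * b\<^sup>2) \<le> sqrt (d\<^sup>2)" by (rule real_sqrt_le_mono)
    then have b: "sqrt 2 * \<bar>b\<bar> \<le> d" using d by (simp add: real_sqrt_mult)
    have "(infdist y A)\<^sup>2 \<le> d\<^sup>2 + 2 * ((x - n) \<bullet> (y - x)) + D\<^sup>2"
      using infdist_sq_le[OF n(1), of "y - x"] by (simp add: d_def D_def dist_norm norm_minus_commute)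
    moreover have "\<bar>d\<^sup>2 - (infdist y A)\<^sup>2\<bar> \<le> D\<^sup>2" unfolding d_def D_def by (rule critical_points_sq_diff[OF crit])
    moreover have "(x - n) \<bullet> (y - x) = - ((x - n) \<bullet> (x - y))" by (simp add: inner_diff_right)
    ultimately have "(x - n) \<bullet> (x - y) \<le> D\<^sup>2" by (simp add: abs_le_iff)
    moreover have "(x - n) \<bullet> (x - y) = a * W + b * (x - y) $ j"
    proof -
      have "a * W = (\<epsilon> * \<epsilon>) * ((x - n) $ i * (x - y) $ i)" unfolding a_def W_def by simp
      then show ?thesis unfolding inner_plane b_def ee by simp
    qed
    moreover have "- (\<bar>b\<bar> * V) \<le> b * (x - y) $ j" unfolding V_def by (simp add: abs_mult[symmetric])
    ultimately have "a * W - \<bar>b\<bar> * V \<le> D\<^sup>2" by linarith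
    then have "sqrt 2 * (a * W - \<bar>b\<bar> * V) \<le> sqrt 2 * D\<^sup>2" by simp
    moreover have "d * W \<le> (sqrt 2 * a) * W" using a pos by (intro mult_right_mono) (auto simp: W_def)
    moreover have "(sqrt 2 * \<bar>b\<bar>) * V \<le> d * V" using b by (intro mult_right_mono) (auto simp: V_def)
    ultimately have "d * (W - V) \<le> sqrt 2 * D\<^sup>2" by (simp add: algebra_simps)
    also have "sqrt 2 * D\<^sup>2 \<le> (3/2) * (D * (d / 4))"
    proof -
      have "sqrt 2 \<le> (3/2::real)" by (rule real_le_lsqrt) (auto simp: power2_eq_square)
      moreover have "D\<^sup>2 \<le> D * (d / 4)" unfolding power2_eq_square using near by (intro mult_left_mono) (auto simp: D_def d_def)
      ultimately show ?thesis by (intro mult_mono) auto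
    qed
    also have "\<dots> = d * (3/8 * D)" by simp
    finally have WV: "W - V \<le> 3/8 * D" using d by simp
    have "D\<^sup>2 = W\<^sup>2 + V\<^sup>2" using e unfolding D_def dist_norm plane W_def V_def by (auto simp: power_mult_distrib)
    also have "\<dots> \<le> (W + V)\<^sup>2" using pos by (simp add: power2_sum V_def W_def)
    finally have "D \<le> W + V" by (rule power2_le_imp_le) (use pos in \<open>auto simp: V_def W_def\<close>)
    moreover have "V \<ge> 0" by (simp add: V_def)
    ultimately have "D \<le> 4 * V" using WV by linarith
    then show ?thesis by (simp add: D_def V_def)
  qed
  show ?thesis
  proof (cases "0 \<le> \<epsilon> * ((x - y) $ i)")
    case True
    then show ?thesis using main[OF crit st(1) near(1)] by simp
  next
    case False
    then have "0 \<le> \<epsilon> * ((y - x) $ i)" using e by auto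
    then show ?thesis using main[OF crit(2,1) st(2)] near(2) by (simp add: dist_commute abs_minus_commute)
  qed
qed

text \<open>Packing: the balls of radius \<open>r / 16\<close> are disjoint and stay where the
  distance is between \<open>r / 2\<close> and \<open>4 * r\<close>. The generous bounds are powers
  of two times \<open>r\<close>, so that dyadic shells will telescope.\<close>

lemma separated_card_le:
  fixes A :: "(real^2) set"
  assumes A: "compact A" "A \<noteq> {}" and r: "r > 0" and P: "finite P"
    and lev: "\<And>p. p \<in> P \<Longrightarrow> r \<le> infdist p A \<and> infdist p A \<le> 2 * r"
    and sep: "\<And>p p'. p \<in> P \<Longrightarrow> p' \<in> P \<Longrightarrow> p \<noteq> p' \<Longrightarrow> r / 8 \<le> dist p p'"
  shows "real (card P) * (pi * (r / 16)\<^sup>2) \<le> sqvol A ((4 * r)\<^sup>2) - sqvol A ((r / 2)\<^sup>2)"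
proof -
  have disj: "disjoint_family_on (\<lambda>p. ball p (r / 16)) P"
    unfolding disjoint_family_on_def
  proof (intro ballI impI)
    fix p p' assume p: "p \<in> P" "p' \<in> P" "p \<noteq> p'"
    show "ball p (r / 16) \<inter> ball p' (r / 16) = {}"
      using sep[OF p] by (intro disjoint_ballI) auto
  qed
  have ball: "measure lborel (ball p (r / 16)) = pi * (r / 16)\<^sup>2" for p :: "real^2"
    using r by (subst content_ball) (auto simp: unit_ball_vol_2)
  have "real (card P) * (pi * (r / 16)\<^sup>2) = (\<Sum>p\<in>P. measure lborel (ball p (r / 16)))"
    by (simp add: ball)
  also have "\<dots> = measure lborel (\<Union>p\<in>P. ball p (r / 16))"
    using P disj emeasure_bounded_finite[OF bounded_ball]
    by (intro measure_finite_Union[symmetric]) (auto simp: less_top[symmetric])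
  also have "\<dots> \<le> measure lborel (sqshell A ((r / 2)\<^sup>2) ((4 * r)\<^sup>2))"
  proof (rule measure_mono_fmeasurable)
    show "(\<Union>p\<in>P. ball p (r / 16)) \<subseteq> sqshell A ((r / 2)\<^sup>2) ((4 * r)\<^sup>2)"
    proof
      fix x assume "x \<in> (\<Union>p\<in>P. ball p (r / 16))"
      then obtain p where p: "p \<in> P" "dist p x < r / 16" by auto
      have "r / 2 \<le> infdist x A" "infdist x A < 4 * r"
        using infdist_triangle[of x A p] infdist_triangle[of p A x] lev[OF p(1)] p(2) r by (auto simp: dist_commute)
      then show "x \<in> sqshell A ((r / 2)\<^sup>2) ((4 * r)\<^sup>2)"
        using r power_mono[of "r / 2" "infdist x A" 2] power_strict_mono[of "infdist x A" "4 * r" 2]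
        unfolding sqshell_def by (simp add: infdist_nonneg del: power_mult_distrib)
    qed
    show "(\<Union>p\<in>P. ball p (r / 16)) \<in> sets lborel" using P by (auto intro!: sets.finite_UN)
  qed (rule sqshell_fmeasurable[OF A])
  also have "\<dots> = sqvol A ((4 * r)\<^sup>2) - sqvol A ((r / 2)\<^sup>2)"
    by (rule sqvol_diff[OF A, symmetric], rule power_mono) (use r in auto)
  finally show ?thesis .
qed

lemma sqrt_diff_critical_le:
  fixes A :: "(real^2) set"
  assumes "critical_point A x" "critical_point A y" and r: "r > 0" "r \<le> infdist x A" "r \<le> infdist y A"
    and d: "dist x y \<le> D"
  shows "sqrt \<bar>infdist x A - infdist y A\<bar> \<le> D / sqrt r"
proof -
  have D: "D \<ge> 0" using d zero_le_dist[of x y] by linarith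
  have "r * \<bar>infdist x A - infdist y A\<bar> \<le> (infdist x A + infdist y A) * \<bar>infdist x A - infdist y A\<bar>"
    using r by (intro mult_right_mono) auto
  also have "\<dots> = \<bar>(infdist x A)\<^sup>2 - (infdist y A)\<^sup>2\<bar>"
    using r by (simp add: power2_eq_square square_diff_square_factored abs_mult)
  also have "\<dots> \<le> (dist x y)\<^sup>2" by (rule critical_points_sq_diff[OF assms(1,2)])
  also have "\<dots> \<le> D\<^sup>2" using d by (intro power_mono) auto
  finally have "\<bar>infdist x A - infdist y A\<bar> \<le> D\<^sup>2 / r" using r by (simp add: pos_le_divide_eq mult.commute)
  then have "sqrt \<bar>infdist x A - infdist y A\<bar> \<le> sqrt (D\<^sup>2 / r)" by (rule real_sqrt_le_mono)
  then show ?thesis using D by (simp add: real_sqrt_divide)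
qed

section \<open>Gap sums of critical values on dyadic levels\<close>

text \<open>Around each point of a maximal \<open>r / 8\<close>-separated set the critical points
  split into four graphs: two axes, two signs. On one graph the values form a chain with constant
  \<open>4 / sqrt r\<close> over a range of length \<open>r / 4\<close>, which costs
  \<open>sqrt r\<close>, and entering the graph costs another \<open>sqrt r\<close>. This makes
  \<open>8 * sqrt r\<close> per separated point.\<close>

lemma sqrt_jumps_Un_level_le:
  fixes A :: "(real^2) set"
  assumes A: "compact A" "A \<noteq> {}" and r: "r > 0" and X: "finite X" "X \<subseteq> {0..M}" and Y: "finite Y" "Y \<subseteq> critical_values A"
    "Y \<subseteq> {r..2 * r}" "Y \<subseteq> {0..M}" and M: "0 \<le> M"
  shows "sqrt_jumps (X \<union> Y) \<le> sqrt_jumps X + sqrt M + 8 * sqrt r * (sqvol A ((4 * r)\<^sup>2) - sqvol A ((r / 2)\<^sup>2)) / (pi * (r / 16)\<^sup>2)"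
proof (cases "Y = {}")
  case True
  have "0 \<le> sqvol A ((4 * r)\<^sup>2) - sqvol A ((r / 2)\<^sup>2)"
    using sqvol_mono[OF A power_mono[of "r / 2" "4 * r" 2]] r by simp
  then show ?thesis using True M r by simp
next
  case False
  define a where "a = sqvol A ((4 * r)\<^sup>2) - sqvol A ((r / 2)\<^sup>2)"
  define d where "d x = infdist x A" for x
  have "\<forall>s\<in>Y. \<exists>x. critical_point A x \<and> d x = s" using Y(2) by (auto simp: critical_values_def d_def)
  then obtain xc where xc: "\<And>s. s \<in> Y \<Longrightarrow> critical_point A (xc s) \<and> d (xc s) = s" by metis
  define E where "E = xc ` Y"
  have E: "finite E" "d ` E = Y" "\<And>x. x \<in> E \<Longrightarrow> critical_point A x" "\<And>x. x \<in> E \<Longrightarrow> d x \<in> Y"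
    using Y(1) xc by (auto simp: E_def image_image)
  have lev: "r \<le> d x" "d x \<le> 2 * r" if "x \<in> E" for x using E(4)[OF that] Y(3) by auto
  define sep where "sep P \<longleftrightarrow> P \<subseteq> E \<and> (\<forall>p\<in>P. \<forall>p'\<in>P. p \<noteq> p' \<longrightarrow> r / 8 \<le> dist p p')" for P
  have "\<exists>P. sep P \<and> (\<forall>Q. sep Q \<longrightarrow> card Q \<le> card P)"
  proof (rule ex_has_greatest_nat[of sep "{}" card "Suc (card E)"])
    show "sep {}" by (simp add: sep_def)
    show "\<forall>Q. sep Q \<longrightarrow> card Q < Suc (card E)" using E(1) by (auto simp: sep_def less_Suc_eq_le intro: card_mono)
  qed
  then obtain P where P: "sep P" "\<And>Q. sep Q \<Longrightarrow> card Q \<le> card P" by blast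
  have PE: "P \<subseteq> E" and finP: "finite P" using P(1) E(1) finite_subset by (auto simp: sep_def)
  have Psep: "r / 8 \<le> dist p p'" if "p \<in> P" "p' \<in> P" "p \<noteq> p'" for p p' using P(1) that by (simp add: sep_def)
  have cov: "\<exists>p\<in>P. dist p x < r / 8" if x: "x \<in> E" for x
  proof (rule ccontr)
    assume n: "\<not> ?thesis"
    then have far: "r / 8 \<le> dist p x" if "p \<in> P" for p using that by (simp add: not_less)
    have "x \<notin> P" using far[of x] r by auto
    have "sep (insert x P)"
      unfolding sep_def using PE x Psep far by (auto simp: dist_commute)
    from P(2)[OF this] show False using \<open>x \<notin> P\<close> finP by simp
  qed
  have "real (card P) * (pi * (r / 16)\<^sup>2) \<le> a"
    unfolding a_def using PE lev Psep by (intro separated_card_le[OF A r finP]) (auto simp: d_def)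
  then have cardP: "real (card P) \<le> a / (pi * (r / 16)\<^sup>2)" using r by (simp add: pos_le_divide_eq)
  define Cl where "Cl = (\<lambda>(p, i, \<epsilon>). {x \<in> E. dist p x < r / 8 \<and> x \<in> steep_points A i \<epsilon>}) ` (P \<times> {1, 2} \<times> {-1, 1})"
  have finCl: "finite Cl" using finP by (simp add: Cl_def)
  have cardCl: "card Cl \<le> card P * 4"
  proof -
    have "card Cl \<le> card (P \<times> {1, 2::2} \<times> {-1, 1::real})" unfolding Cl_def using finP by (intro card_image_le) auto
    also have "\<dots> = card P * 4" by (simp add: card_cartesian_product)
    finally show ?thesis .
  qed
  have "E \<subseteq> \<Union>Cl"
  proof
    fix x assume x: "x \<in> E"
    obtain p where p: "p \<in> P" "dist p x < r / 8" using cov[OF x] by blast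
    obtain i \<epsilon> where i: "i \<in> {1, 2::2}" "\<epsilon> \<in> {-1, 1::real}" "x \<in> steep_points A i \<epsilon>"
      using steep_points_cover[OF A] by blast
    have "(p, i, \<epsilon>) \<in> P \<times> {1, 2} \<times> {-1, 1}" using p i by blast
    moreover have "x \<in> {x \<in> E. dist p x < r / 8 \<and> x \<in> steep_points A i \<epsilon>}" using x p i by blast
    ultimately show "x \<in> \<Union>Cl" unfolding Cl_def by force
  qed
  moreover have "\<Union>Cl \<subseteq> E" by (auto simp: Cl_def)
  ultimately have UCl: "\<Union>Cl = E" by blast
  obtain v0 where v0: "v0 \<in> Y" using False by blast
  \<comment> \<open>All values of \<open>Y\<close> lie within \<open>r\<close> of \<open>v0\<close>,
    so \<open>v0\<close> serves as the entry point of every chain. Linking it to \<open>X\<close> is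
    paid for once, by \<open>sqrt M\<close>.\<close>
  define X1 where "X1 = insert v0 X"
  have X1: "finite X1" "v0 \<in> X1" using X by (auto simp: X1_def)
  have S1: "sqrt_jumps X1 \<le> sqrt_jumps X + sqrt M"
  proof (cases "X = {}")
    case True then show ?thesis using M by (simp add: X1_def sqrt_jumps_def sqrt_jump_def has_next_def)
  next
    case False
    then obtain y where y: "y \<in> X" by blast
    have "\<bar>v0 - y\<bar> \<le> M" using subsetD[OF X(2) y] subsetD[OF Y(4) v0] by auto
    then have "sqrt \<bar>v0 - y\<bar> \<le> sqrt M" by (rule real_sqrt_le_mono)
    then show ?thesis using sqrt_jumps_insert_le[OF X(1) y, of v0] unfolding X1_def by linarith
  qed
  have step: "sqrt_jumps (Z \<union> d ` c) \<le> sqrt_jumps Z + 2 * sqrt r" if c: "c \<in> Cl" and Z: "finite Z" "v0 \<in> Z" for c Z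
  proof -
    obtain p i \<epsilon> where cdef: "c = {x \<in> E. dist p x < r / 8 \<and> x \<in> steep_points A i \<epsilon>}" and pie: "p \<in> P" "i \<in> {1, 2::2}" "\<epsilon> \<in> {-1, 1::real}"
      using c by (auto simp: Cl_def)
    obtain j where ij: "{i, j} = {1, 2::2}" using pie(2) by auto
    have cE: "c \<subseteq> E" by (auto simp: cdef)
    have "sqrt_jumps (Z \<union> d ` c) \<le> sqrt_jumps Z + sqrt r + 4 / sqrt r * (r / 4)"
    proof (rule sqrt_jumps_chain_le[where \<tau> = "\<lambda>x. x $ j" and ?y0.0 = v0 and \<alpha> = "p $ j - r / 8"])
      show "finite c" using cE E(1) finite_subset by blast
      fix x assume x: "x \<in> c"
      then have xE: "x \<in> E" using cE by blast
      have "\<bar>d x - v0\<bar> \<le> r" using lev[OF xE] v0 Y(3) by (force simp: abs_le_iff)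
      then show "sqrt \<bar>d x - v0\<bar> \<le> sqrt r" by (rule real_sqrt_le_mono)
      have "\<bar>(p - x) $ j\<bar> \<le> dist p x" unfolding dist_norm by (rule component_le_norm_cart)
      then show "p $ j - r / 8 \<le> x $ j \<and> x $ j \<le> p $ j - r / 8 + r / 4" using x by (auto simp: cdef abs_le_iff)
      fix y assume y: "y \<in> c"
      then have yE: "y \<in> E" using cE by blast
      have "dist x y < r / 4" using x y dist_triangle3[of x y p] by (auto simp: cdef)
      then have n: "4 * dist x y \<le> infdist x A" "4 * dist x y \<le> infdist y A" using lev[OF xE] lev[OF yE] by (auto simp: d_def)
      have "dist x y \<le> 4 * \<bar>x $ j - y $ j\<bar>"
        by (rule steep_points_graph[OF E(3)[OF xE] E(3)[OF yE] ij pie(3) _ _ n]) (use x y in \<open>auto simp: cdef\<close>)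
      then have "sqrt \<bar>infdist x A - infdist y A\<bar> \<le> (4 * \<bar>x $ j - y $ j\<bar>) / sqrt r"
        using lev[OF xE] lev[OF yE] by (intro sqrt_diff_critical_le[OF E(3)[OF xE] E(3)[OF yE] r]) (auto simp: d_def)
      then show "sqrt \<bar>d x - d y\<bar> \<le> 4 / sqrt r * \<bar>x $ j - y $ j\<bar>" by (simp add: d_def)
    qed (use Z r in auto)
    also have "4 / sqrt r * (r / 4) = sqrt r" using r by (simp add: real_div_sqrt)
    finally show ?thesis by simp
  qed
  have "sqrt_jumps (X1 \<union> (\<Union>c\<in>C. d ` c)) \<le> sqrt_jumps X1 + real (card C) * (2 * sqrt r)" if "finite C" "C \<subseteq> Cl" for C
    using that
  proof (induction C rule: finite_induct)
    case empty then show ?case by simp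
  next
    case (insert c C)
    have fc: "finite c'" if "c' \<in> Cl" for c' using that E(1) by (auto simp: Cl_def)
    have "sqrt_jumps ((X1 \<union> (\<Union>c\<in>C. d ` c)) \<union> d ` c) \<le> sqrt_jumps (X1 \<union> (\<Union>c\<in>C. d ` c)) + 2 * sqrt r"
      by (rule step) (use insert X1 fc in auto)
    moreover have "(X1 \<union> (\<Union>c\<in>C. d ` c)) \<union> d ` c = X1 \<union> (\<Union>c\<in>insert c C. d ` c)" by blast
    ultimately show ?case using insert by (simp add: algebra_simps)
  qed
  from this[OF finCl order_refl] have "sqrt_jumps (X1 \<union> (\<Union>c\<in>Cl. d ` c)) \<le> sqrt_jumps X1 + real (card Cl) * (2 * sqrt r)" .
  moreover have "X1 \<union> (\<Union>c\<in>Cl. d ` c) = X \<union> Y"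
  proof -
    have "(\<Union>c\<in>Cl. d ` c) = d ` (\<Union>Cl)" by blast
    then show ?thesis using UCl E(2) v0 by (auto simp: X1_def)
  qed
  moreover have "real (card Cl) * (2 * sqrt r) \<le> 8 * sqrt r * a / (pi * (r / 16)\<^sup>2)"
  proof -
    define c where "c = pi * (r / 16)\<^sup>2"
    have "real (card Cl) \<le> real (card P * 4)" using cardCl by (simp only: of_nat_le_iff)
    then have "real (card Cl) \<le> 4 * (a / c)" using cardP by (simp add: c_def)
    then have "real (card Cl) * (2 * sqrt r) \<le> (4 * (a / c)) * (2 * sqrt r)"
      using r by (intro mult_right_mono) auto
    then show ?thesis unfolding c_def[symmetric] by (simp add: mult_ac)
  qed
  ultimately have "sqrt_jumps (X \<union> Y) \<le> sqrt_jumps X1 + 8 * sqrt r * a / (pi * (r / 16)\<^sup>2)" by simp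
  then show ?thesis using S1 unfolding a_def by linarith
qed

theorem critical_values_gap_sum:
  fixes A :: "(real^2) set"
  assumes A: "compact A" "A \<noteq> {}" and N: "N \<subseteq> critical_values A"
  shows "emeasure lborel (closure N) = 0"
    "(\<integral>\<^sup>+r\<in>{0<..}. (gap_sum_half (closure N \<inter> {r..}) * ennreal (sqrt r)) \<partial>lborel) < \<infinity>"
proof -
  define K where "K = closure N"
  obtain R where R: "\<And>a. a \<in> A \<Longrightarrow> norm a \<le> R" using compact_imp_bounded[OF A(1)] by (auto simp: bounded_iff)
  obtain a0 where "a0 \<in> A" using A(2) by blast
  then have R0: "R \<ge> 0" using R[of a0] norm_ge_zero[of a0] by linarith
  \<comment> \<open>The summand 1 keeps critical values strictly below \<open>M = t 0\<close>, so
    the induction over dyadic levels starts with the empty set.\<close>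
  define M where "M = 2 * R + 1"
  have M: "M > 0" using R0 by (simp add: M_def)
  have cv: "0 < s \<and> s < M" if "s \<in> critical_values A" for s
    using that critical_point_norm_le(2)[OF R] by (fastforce simp: critical_values_def critical_point_def M_def)
  define t where "t j = M / 2 ^ j" for j
  have t: "t j > 0" "t j \<le> M" "t (Suc j) = t j / 2" for j
    using M by (auto simp: t_def field_simps)
  define r where "r j = t (Suc j)" for j
  have r: "r j > 0" "t j = 2 * r j" for j using t(1)[of "Suc j"] t(3)[of j] by (simp_all add: r_def)
  define v where "v j = sqvol A ((4 * r j)\<^sup>2)" for j
  have v0: "v j \<ge> 0" for j by (simp add: v_def sqvol_def)
  \<comment> \<open>Area of the enlarged shell at level \<open>j\<close>. It reaches over three
    dyadic steps, so the areas telescope to at most \<open>v 0 + v 1 + v 2\<close>.\<close>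
  define a where "a j = v j - v (j + 3)" for j
  have r3: "4 * r (j + 3) = r j / 2" for j by (simp add: r_def t_def power_add)
  have a_eq: "a j = sqvol A ((4 * r j)\<^sup>2) - sqvol A ((r j / 2)\<^sup>2)" for j
    unfolding a_def v_def r3 ..
  have a0: "a j \<ge> 0" for j
    unfolding a_eq using sqvol_mono[OF A power_mono[of "r j / 2" "4 * r j" 2]] r(1)[of j] by simp
  have "summable a"
  proof (rule summableI_nonneg_bounded[OF a0])
    fix n
    have "(\<Sum>i<n. a i) = v 0 + v 1 + v 2 - v n - v (n + 1) - v (n + 2)"
      by (induction n) (auto simp: a_def numeral_3_eq_3 numeral_2_eq_2)
    then show "(\<Sum>i<n. a i) \<le> v 0 + v 1 + v 2" using v0[of n] v0[of "n + 1"] v0[of "n + 2"] by linarith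
  qed
  define B where "B j = sqrt M + 8 * sqrt (r j) * a j / (pi * (r j / 16)\<^sup>2)" for j
  have B0: "B j \<ge> 0" for j using M a0[of j] r(1)[of j] by (auto simp: B_def intro!: add_nonneg_nonneg divide_nonneg_nonneg mult_nonneg_nonneg)
  have jumps: "sqrt_jumps X \<le> (\<Sum>j<k. B j)" if "finite X" "X \<subseteq> critical_values A" "X \<subseteq> {t k..}" for X k
    using that
  proof (induction k arbitrary: X)
    case 0
    then have "X = {}" using cv by (force simp: t_def)
    then show ?case by (simp add: sqrt_jumps_def)
  next
    case (Suc k)
    define X1 Y where "X1 = {x \<in> X. t k \<le> x}" and "Y = {x \<in> X. x < t k}"
    have XY: "X = X1 \<union> Y" by (auto simp: X1_def Y_def)
    have "sqrt_jumps X1 \<le> (\<Sum>j<k. B j)" using Suc.prems by (intro Suc.IH) (auto simp: X1_def)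
    moreover have "sqrt_jumps (X1 \<union> Y) \<le> sqrt_jumps X1 + sqrt M + 8 * sqrt (r k) * (sqvol A ((4 * r k)\<^sup>2) - sqvol A ((r k / 2)\<^sup>2)) / (pi * (r k / 16)\<^sup>2)"
    proof (rule sqrt_jumps_Un_level_le[OF A r(1)])
      show "X1 \<subseteq> {0..M}" "Y \<subseteq> {0..M}" using Suc.prems(2) cv by (force simp: X1_def Y_def)+
      show "Y \<subseteq> {r k..2 * r k}" using Suc.prems(3) r(2)[of k] by (auto simp: Y_def r_def)
    qed (use Suc.prems M in \<open>auto simp: X1_def Y_def\<close>)
    ultimately show ?case unfolding XY by (simp add: B_def a_eq)
  qed
  have Kcv: "K \<inter> {u..} \<subseteq> critical_values A" if "u > 0" for u
    using closure_critical_values[OF A] closure_mono[OF N] that by (auto simp: K_def)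
  have cK: "closed (K \<inter> {u..})" for u by (simp add: K_def closed_Int)
  have jumpsK: "\<exists>k. (\<forall>X. finite X \<longrightarrow> X \<subseteq> K \<inter> {u..} \<longrightarrow> sqrt_jumps X \<le> (\<Sum>j<k. B j)) \<and> (\<forall>j<k. u < t j)" if u: "u > 0" for u
  proof -
    have "\<exists>k. t k \<le> u"
    proof -
      obtain k where "(1/2::real) ^ k < u / M" using real_arch_pow_inv[of "u / M" "1/2"] u M by auto
      then show ?thesis using M by (intro exI[of _ k]) (simp add: t_def field_simps power_one_over)
    qed
    then obtain k where k: "t k \<le> u" "\<And>j. j < k \<Longrightarrow> \<not> t j \<le> u"
      using exists_least_iff[of "\<lambda>k. t k \<le> u"] by blast
    have "sqrt_jumps X \<le> (\<Sum>j<k. B j)" if "finite X" "X \<subseteq> K \<inter> {u..}" for X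
      using that Kcv[OF u] k(1) by (intro jumps) auto
    then show ?thesis using k(2) by (intro exI[of _ k]) (auto simp: not_le)
  qed
  have null: "emeasure lborel (K \<inter> {u..}) = 0" if "u > 0" for u
    using jumpsK[OF that] null_of_sqrt_jumps_bound[of "K \<inter> {u..}"] cK[of u] by (meson borel_closed)
  have "K \<subseteq> {0..}"
    unfolding K_def by (rule closure_minimal) (use N cv in force)+
  \<comment> \<open>The bounds on jumps hold only away from 0, so \<open>K\<close> is exhausted by
    its parts above \<open>1 / (n + 1)\<close>, and the point 0 is added.\<close>
  define Z where "Z = {0} \<union> (\<Union>n. K \<inter> {inverse (real (Suc n))..})"
  have "K \<subseteq> Z"
  proof
    fix x assume x: "x \<in> K"
    show "x \<in> Z"
    proof (cases "x = 0")
      case False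
      then have "x > 0" using x \<open>K \<subseteq> {0..}\<close> by auto
      then obtain n where "inverse (real (Suc n)) < x" using reals_Archimedean by blast
      then show ?thesis using x by (auto simp: Z_def intro!: exI[of _ n])
    qed (simp add: Z_def)
  qed
  have Z: "Z \<in> null_sets lborel"
  proof -
    have "K \<inter> {inverse (real (Suc n))..} \<in> null_sets lborel" for n
      using null[of "inverse (real (Suc n))"] cK[of "inverse (real (Suc n))"] by (auto intro!: null_setsI simp del: of_nat_Suc)
    then have "(\<Union>n. K \<inter> {inverse (real (Suc n))..}) \<in> null_sets lborel" by (intro null_sets_UN) auto
    moreover have "{0::real} \<in> null_sets lborel" by auto
    ultimately show ?thesis unfolding Z_def by (rule null_sets.Un[rotated])
  qed
  have "emeasure lborel K \<le> emeasure lborel Z" using \<open>K \<subseteq> Z\<close> Z by (intro emeasure_mono) auto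
  then show "emeasure lborel (closure N) = 0" unfolding K_def[symmetric] using Z by auto
  \<comment> \<open>Upper bound for the share of \<open>B j\<close> in the weighted integral, since
    level \<open>j\<close> counts only for \<open>r \<le> t j\<close>.\<close>
  define f where "f j = B j * sqrt (t j) * t j" for j
  have f0: "f j \<ge> 0" for j using B0[of j] t(1)[of j] by (simp add: f_def)
  have "summable f"
  proof (rule summable_comparison_test')
    show "summable (\<lambda>j. M * M * (1/2) ^ j + (4096 * sqrt 2 / pi) * a j)"
      by (intro summable_add summable_mult \<open>summable a\<close> summable_geometric) auto
    fix j
    have 1: "sqrt M * sqrt (t j) * t j \<le> M * M * (1/2) ^ j"
    proof -
      have "sqrt M * sqrt (t j) * t j \<le> sqrt M * sqrt M * t j"
        using t M by (intro mult_right_mono mult_left_mono) (auto simp: less_imp_le)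
      also have "\<dots> = M * M * (1/2) ^ j" using M by (simp add: t_def power_one_over field_simps)
      finally show ?thesis .
    qed
    obtain e where e: "e > 0" "sqrt (r j) = e" "r j = e\<^sup>2" using r(1)[of j] by (metis real_sqrt_gt_0_iff real_sqrt_pow2 less_imp_le)
    have st: "sqrt (t j) = sqrt 2 * e" by (simp add: r(2) real_sqrt_mult e(2))
    \<comment> \<open>The powers of \<open>r j\<close> cancel: 1/2 from a chain, -2 from the cell
      area, 1/2 from the weight, 1 from the length of integration. The constant is 8 times 256 times
      2 times \<open>sqrt 2\<close>, divided by \<open>pi\<close>.\<close>
    have 2: "8 * sqrt (r j) * a j / (pi * (r j / 16)\<^sup>2) * sqrt (t j) * t j = (4096 * sqrt 2 / pi) * a j"
      unfolding st e(2) using e(1) by (simp add: r(2) e(3) power2_eq_square field_simps)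
    have "f j \<le> M * M * (1/2) ^ j + (4096 * sqrt 2 / pi) * a j"
      unfolding f_def B_def distrib_right 2 using 1 by simp
    then show "norm (f j) \<le> M * M * (1/2) ^ j + (4096 * sqrt 2 / pi) * a j" using f0[of j] by simp
  qed
  have G: "gap_sum_half (K \<inter> {u..}) \<le> (\<Sum>j. ennreal (B j) * indicator {0..t j} u)" if u: "u > 0" for u
  proof -
    obtain k where k: "\<forall>X. finite X \<longrightarrow> X \<subseteq> K \<inter> {u..} \<longrightarrow> sqrt_jumps X \<le> (\<Sum>j<k. B j)" "\<forall>j<k. u < t j"
      using jumpsK[OF u] by blast
    have "gap_sum_half (K \<inter> {u..}) \<le> ennreal (\<Sum>j<k. B j)" using k(1) by (intro gap_sum_half_le cK) auto
    also have "\<dots> = (\<Sum>j<k. ennreal (B j) * indicator {0..t j} u)"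
      unfolding sum_ennreal[OF B0, symmetric]
    proof (rule sum.cong[OF refl])
      fix j assume "j \<in> {..<k}"
      then have "u \<in> {0..t j}" using k(2) u by force
      then show "ennreal (B j) = ennreal (B j) * indicator {0..t j} u" by simp
    qed
    also have "\<dots> \<le> (\<Sum>j. ennreal (B j) * indicator {0..t j} u)" by (rule sum_le_suminf) auto
    finally show ?thesis .
  qed
  have "(\<integral>\<^sup>+u\<in>{0<..}. (gap_sum_half (K \<inter> {u..}) * ennreal (sqrt u)) \<partial>lborel)
      \<le> (\<integral>\<^sup>+u. (\<Sum>j. ennreal (B j * sqrt (t j)) * indicator {0..t j} u) \<partial>lborel)"
  proof (rule nn_integral_mono)
    fix u :: real
    show "gap_sum_half (K \<inter> {u..}) * ennreal (sqrt u) * indicator {0<..} u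
      \<le> (\<Sum>j. ennreal (B j * sqrt (t j)) * indicator {0..t j} u)"
    proof (cases "u > 0")
      case True
      have "gap_sum_half (K \<inter> {u..}) * ennreal (sqrt u) \<le> (\<Sum>j. ennreal (B j) * indicator {0..t j} u) * ennreal (sqrt u)"
        by (intro mult_right_mono G True) auto
      also have "\<dots> = (\<Sum>j. ennreal (B j) * indicator {0..t j} u * ennreal (sqrt u))" by simp
      also have "\<dots> \<le> (\<Sum>j. ennreal (B j * sqrt (t j)) * indicator {0..t j} u)"
      proof (rule suminf_le)
        fix j
        show "ennreal (B j) * indicator {0..t j} u * ennreal (sqrt u) \<le> ennreal (B j * sqrt (t j)) * indicator {0..t j} u"
          using B0[of j] True by (auto simp: indicator_def ennreal_mult'[symmetric] intro!: ennreal_leI mult_left_mono)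
      qed auto
      finally show ?thesis using True by simp
    qed simp
  qed
  also have "\<dots> = (\<Sum>j. \<integral>\<^sup>+u. ennreal (B j * sqrt (t j)) * indicator {0..t j} u \<partial>lborel)"
    by (rule nn_integral_suminf) measurable
  also have "\<dots> = (\<Sum>j. ennreal (f j))"
    using t(1) B0 by (intro suminf_cong) (simp add: nn_integral_cmult f_def ennreal_mult'' less_imp_le)
  also have "\<dots> < \<infinity>" using ennreal_suminf_neq_top[OF \<open>summable f\<close> f0] by (simp add: less_top)
  finally show "(\<integral>\<^sup>+r\<in>{0<..}. (gap_sum_half (closure N \<inter> {r..}) * ennreal (sqrt r)) \<partial>lborel) < \<infinity>"
    by (simp add: K_def)
qed

subsection \<open>Holes\<close>

definition hole :: "real \<Rightarrow> real set \<Rightarrow> (real \<Rightarrow> real) \<Rightarrow> (real^2) set" where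
  "hole \<eta> K \<psi> = (\<Union>b\<in>K. \<Union>\<tau>\<in>{-\<psi> b..\<psi> b}. ball (vector [\<tau>, \<eta>]) b)"

lemma dist_plane_less_iff: "dist x y < b \<longleftrightarrow> (x $ 1 - y $ 1)\<^sup>2 + (x $ 2 - y $ 2)\<^sup>2 < b\<^sup>2" if "b > 0" for x y :: "real^2"
proof -
  have "dist x y < b \<longleftrightarrow> (dist x y)\<^sup>2 < b\<^sup>2"
    using that by (meson power_strict_mono power_less_imp_less_base less_imp_le pos2 zero_le_dist)
  then show ?thesis by (simp add: dist_plane)
qed

text \<open>A ball is connected: if it met both \<open>U\<close> and the complement, it would meet
  the frontier, hence \<open>A\<close>, closer than the distance allows.\<close>

lemma ball_subset_of_frontier_subset:
  fixes A :: "'a::euclidean_space set"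
  assumes "A \<inter> U = {}" "frontier U \<subseteq> A" "x \<in> U"
  shows "ball x (infdist x A) \<subseteq> U"
proof
  fix y assume y: "y \<in> ball x (infdist x A)"
  show "y \<in> U"
  proof (rule ccontr)
    assume "y \<notin> U"
    have "0 < infdist x A" using y by (simp add: le_less_trans[OF zero_le_dist])
    then have "x \<in> ball x (infdist x A)" by simp
    then have "ball x (infdist x A) \<inter> U \<noteq> {}" "ball x (infdist x A) - U \<noteq> {}" using y \<open>y \<notin> U\<close> assms(3) by blast+
    then have "ball x (infdist x A) \<inter> frontier U \<noteq> {}" by (intro connected_Int_frontier) auto
    then obtain z where z: "z \<in> ball x (infdist x A)" "z \<in> frontier U" by blast
    then have "z \<in> A" using assms(2) by blast
    then show False using infdist_le[of z A x] z(1) by simp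
  qed
qed

section \<open>Geometry of a single hole\<close>

text \<open>At height \<open>n\<close> above the axis the stadium of radius \<open>b > n\<close>
  reaches the abscissa \<open>\<psi> b + sqrt (b^2 - n^2)\<close>. So \<open>flat\<close> leaves a
  stretch of length \<open>l\<close> up to \<open>\<psi> n\<close> where the hole has height exactly
  \<open>n\<close>, while \<open>no_flat\<close> rules out such stretches at the other radii of
  \<open>K\<close>. By \<open>left_cont\<close>, limits of stadiums with increasing radii are
  governed by the stadium of the limit radius.\<close>

locale hole_profile =
  fixes \<eta> :: real and K N :: "real set" and \<psi> :: "real \<Rightarrow> real" and C :: real
  assumes closed_K: "closed K" and K_pos: "\<And>b. b \<in> K \<Longrightarrow> 0 < b" and N_K: "N \<subseteq> K"
    and profile_nonneg: "\<And>b. b \<in> K \<Longrightarrow> 0 \<le> \<psi> b" and profile_le: "\<And>b. b \<in> K \<Longrightarrow> \<psi> b \<le> C"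
    and flat: "\<And>n. n \<in> N \<Longrightarrow> \<exists>l>0. l \<le> \<psi> n \<and> (\<forall>b\<in>K. n < b \<longrightarrow> \<psi> b + sqrt (b\<^sup>2 - n\<^sup>2) \<le> \<psi> n - l)"
    and no_flat: "\<And>s e. s \<in> K \<Longrightarrow> s \<notin> N \<Longrightarrow> e > 0 \<Longrightarrow> \<psi> s > 0 \<Longrightarrow> \<exists>b\<in>K. s < b \<and> \<psi> s \<le> \<psi> b + sqrt (b\<^sup>2 - s\<^sup>2) + e"
    and left_cont: "\<And>s e. s \<in> K \<Longrightarrow> e > 0 \<Longrightarrow> \<exists>d>0. \<forall>b\<in>K. s - d < b \<longrightarrow> b \<le> s \<longrightarrow> \<psi> b \<le> \<psi> s + e"
begin

lemma mem_hole: "x \<in> hole \<eta> K \<psi> \<longleftrightarrow> (\<exists>b\<in>K. \<exists>\<tau>. \<bar>\<tau>\<bar> \<le> \<psi> b \<and> (x $ 1 - \<tau>)\<^sup>2 + (x $ 2 - \<eta>)\<^sup>2 < b\<^sup>2)"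
proof -
  have ball: "dist (vector [\<tau>, \<eta>]) x < b \<longleftrightarrow> (x $ 1 - \<tau>)\<^sup>2 + (x $ 2 - \<eta>)\<^sup>2 < b\<^sup>2" if "b \<in> K" for b \<tau>
    using dist_plane_less_iff[OF K_pos[OF that], of x "vector [\<tau>, \<eta>]"] by (simp add: dist_commute)
  show ?thesis
  proof
    assume "x \<in> hole \<eta> K \<psi>"
    then obtain b \<tau> where b: "b \<in> K" "\<tau> \<in> {-\<psi> b..\<psi> b}" "dist (vector [\<tau>, \<eta>]) x < b"
      unfolding hole_def UN_iff mem_ball by blast
    moreover have "\<bar>\<tau>\<bar> \<le> \<psi> b" using b(2) by auto
    ultimately show "\<exists>b\<in>K. \<exists>\<tau>. \<bar>\<tau>\<bar> \<le> \<psi> b \<and> (x $ 1 - \<tau>)\<^sup>2 + (x $ 2 - \<eta>)\<^sup>2 < b\<^sup>2"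
      using ball[OF b(1)] by blast
  next
    assume "\<exists>b\<in>K. \<exists>\<tau>. \<bar>\<tau>\<bar> \<le> \<psi> b \<and> (x $ 1 - \<tau>)\<^sup>2 + (x $ 2 - \<eta>)\<^sup>2 < b\<^sup>2"
    then obtain b \<tau> where b: "b \<in> K" "\<bar>\<tau>\<bar> \<le> \<psi> b" "(x $ 1 - \<tau>)\<^sup>2 + (x $ 2 - \<eta>)\<^sup>2 < b\<^sup>2" by blast
    then have "x \<in> ball (vector [\<tau>, \<eta>]) b" using ball[OF b(1)] by simp
    moreover have "\<tau> \<in> {-\<psi> b..\<psi> b}" using b(2) by auto
    ultimately show "x \<in> hole \<eta> K \<psi>" unfolding hole_def using b(1) by blast
  qed
qed

lemma open_hole: "open (hole \<eta> K \<psi>)" unfolding hole_def by (intro open_UN) auto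

lemma hole_bounds:
  assumes "x \<in> hole \<eta> K \<psi>" "K \<subseteq> {..T}"
  shows "\<bar>x $ 2 - \<eta>\<bar> < T" "\<bar>x $ 1\<bar> < C + T"
proof -
  obtain b \<tau> where b: "b \<in> K" "\<bar>\<tau>\<bar> \<le> \<psi> b" "(x $ 1 - \<tau>)\<^sup>2 + (x $ 2 - \<eta>)\<^sup>2 < b\<^sup>2" using assms(1) mem_hole by blast
  have "(x $ 1 - \<tau>)\<^sup>2 < b\<^sup>2" "(x $ 2 - \<eta>)\<^sup>2 < b\<^sup>2"
    using b(3) zero_le_power2[of "x $ 1 - \<tau>"] zero_le_power2[of "x $ 2 - \<eta>"] by linarith+
  then have "\<bar>x $ 1 - \<tau>\<bar> < b" "\<bar>x $ 2 - \<eta>\<bar> < b" using K_pos[OF b(1)] power2_less_imp_less[of "\<bar>x $ 1 - \<tau>\<bar>" b] power2_less_imp_less[of "\<bar>x $ 2 - \<eta>\<bar>" b] by simp_all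
  then show "\<bar>x $ 2 - \<eta>\<bar> < T" "\<bar>x $ 1\<bar> < C + T" using b profile_le[OF b(1)] assms(2) by force+
qed

text \<open>Each stadium is symmetric in both of its axes and shrinks away from them. In the sequel
  this serves to move or mirror points outside the hole without entering it.\<close>

lemma hole_mono:
  assumes x: "x \<in> hole \<eta> K \<psi>" and le: "\<bar>y $ 1\<bar> \<le> \<bar>x $ 1\<bar>" "\<bar>y $ 2 - \<eta>\<bar> \<le> \<bar>x $ 2 - \<eta>\<bar>"
  shows "y \<in> hole \<eta> K \<psi>"
proof -
  obtain b \<tau> where b: "b \<in> K" "\<bar>\<tau>\<bar> \<le> \<psi> b" "(x $ 1 - \<tau>)\<^sup>2 + (x $ 2 - \<eta>)\<^sup>2 < b\<^sup>2" using x mem_hole by blast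
  have "\<exists>\<tau>'. \<bar>\<tau>'\<bar> \<le> \<psi> b \<and> \<bar>y $ 1 - \<tau>'\<bar> \<le> \<bar>x $ 1 - \<tau>\<bar>"
  proof (cases "\<bar>y $ 1\<bar> \<le> \<psi> b")
    case True then show ?thesis by (intro exI[of _ "y $ 1"]) auto
  next
    case False
    then show ?thesis using b(2) le(1) by (intro exI[of _ "if y $ 1 \<ge> 0 then \<psi> b else - \<psi> b"]) auto
  qed
  then obtain \<tau>' where \<tau>': "\<bar>\<tau>'\<bar> \<le> \<psi> b" "\<bar>y $ 1 - \<tau>'\<bar> \<le> \<bar>x $ 1 - \<tau>\<bar>" by blast
  have "(y $ 1 - \<tau>')\<^sup>2 + (y $ 2 - \<eta>)\<^sup>2 \<le> (x $ 1 - \<tau>)\<^sup>2 + (x $ 2 - \<eta>)\<^sup>2"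
    using \<tau>'(2) le(2) by (intro add_mono) (simp_all add: abs_le_square_iff)
  then show ?thesis using b \<tau>'(1) mem_hole by fastforce
qed

lemma mem_hole_axis:
  assumes "0 \<le> t" "0 \<le> y"
  shows "vector [t, \<eta> + y] \<in> hole \<eta> K \<psi> \<longleftrightarrow> (\<exists>b\<in>K. (max 0 (t - \<psi> b))\<^sup>2 + y\<^sup>2 < b\<^sup>2)"
proof
  assume "vector [t, \<eta> + y] \<in> hole \<eta> K \<psi>"
  then obtain b \<tau> where b: "b \<in> K" "\<bar>\<tau>\<bar> \<le> \<psi> b" "(t - \<tau>)\<^sup>2 + y\<^sup>2 < b\<^sup>2" unfolding mem_hole by auto
  have "\<bar>max 0 (t - \<psi> b)\<bar> \<le> \<bar>t - \<tau>\<bar>" using b(2) by auto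
  then have "(max 0 (t - \<psi> b))\<^sup>2 \<le> (t - \<tau>)\<^sup>2" by (simp only: abs_le_square_iff)
  then show "\<exists>b\<in>K. (max 0 (t - \<psi> b))\<^sup>2 + y\<^sup>2 < b\<^sup>2" using b by force
next
  assume "\<exists>b\<in>K. (max 0 (t - \<psi> b))\<^sup>2 + y\<^sup>2 < b\<^sup>2"
  then obtain b where b: "b \<in> K" "(max 0 (t - \<psi> b))\<^sup>2 + y\<^sup>2 < b\<^sup>2" by blast
  have "(t - min t (\<psi> b))\<^sup>2 = (max 0 (t - \<psi> b))\<^sup>2" by (auto simp: min_def max_def)
  then show "vector [t, \<eta> + y] \<in> hole \<eta> K \<psi>"
    unfolding mem_hole using b profile_nonneg[OF b(1)] assms by (intro bexI[OF _ b(1)] exI[of _ "min t (\<psi> b)"]) auto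
qed

text \<open>Stadiums that almost reach height \<open>s\<close> at \<open>t2\<close> but leave out
  the point at height \<open>s\<close> over \<open>t1\<close> must have
  \<open>\<psi> b > t1\<close>, hence radius at most \<open>s\<close>. In the limit
  \<open>s \<in> K\<close> and \<open>\<psi> s \<ge> t2\<close>. Then \<open>no_flat\<close>
  supplies a larger stadium reaching, at height \<open>s\<close>, farther than \<open>t1\<close>: a
  contradiction.\<close>

lemma axis_point_unique:
  assumes s: "s > 0" "s \<notin> N"
    and t: "0 \<le> t1" "t1 < t2" and out1: "vector [t1, \<eta> + s] \<notin> hole \<eta> K \<psi>"
    and in2: "\<And>y. 0 \<le> y \<Longrightarrow> y < s \<Longrightarrow> vector [t2, \<eta> + y] \<in> hole \<eta> K \<psi>"
  shows False
proof -
  have out: "b\<^sup>2 \<le> (max 0 (t1 - \<psi> b))\<^sup>2 + s\<^sup>2" if "b \<in> K" for b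
    using out1 mem_hole_axis[of t1 s] t(1) s(1) that by (auto simp: not_less)
  have approx: "\<exists>b\<in>K. s - e < b \<and> b \<le> s \<and> t2 - e \<le> \<psi> b" if e: "e > 0" for e
  proof -
    define m where "m = min e (t2 - t1)"
    have m: "m > 0" "m \<le> e" "m \<le> t2 - t1" using e t by (auto simp: m_def)
    \<comment> \<open>A height so close below \<open>s\<close> that \<open>s^2 - y^2 < m^2\<close>:
      a stadium covering this point over \<open>t2\<close> has radius above \<open>s - e\<close> and
      \<open>\<psi> b \<ge> t2 - m\<close>.\<close>
    define y where "y = max 0 (max (s - e / 2) (sqrt (max 0 (s\<^sup>2 - m\<^sup>2 / 2))))"
    have "sqrt (max 0 (s\<^sup>2 - m\<^sup>2 / 2)) < sqrt (s\<^sup>2)" using m s by (intro real_sqrt_less_mono) auto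
    then have y: "0 \<le> y" "y < s" "s - e < y" using s e by (auto simp: y_def)
    have "sqrt (max 0 (s\<^sup>2 - m\<^sup>2 / 2)) \<le> y" by (simp add: y_def)
    then have "(sqrt (max 0 (s\<^sup>2 - m\<^sup>2 / 2)))\<^sup>2 \<le> y\<^sup>2" by (intro power_mono) auto
    then have "s\<^sup>2 - m\<^sup>2 / 2 \<le> y\<^sup>2" by simp
    moreover have "m\<^sup>2 > 0" using m by simp
    ultimately have ym: "s\<^sup>2 - y\<^sup>2 < m\<^sup>2" by linarith
    obtain b where b: "b \<in> K" "(max 0 (t2 - \<psi> b))\<^sup>2 + y\<^sup>2 < b\<^sup>2"
      using in2[OF y(1,2)] mem_hole_axis[of t2 y] t y(1) by auto
    have lt: "(max 0 (t2 - \<psi> b))\<^sup>2 < (max 0 (t1 - \<psi> b))\<^sup>2 + m\<^sup>2"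
      using b(2) out[OF b(1)] ym by linarith
    have big: "\<psi> b > t1"
    proof (rule ccontr)
      assume "\<not> \<psi> b > t1"
      then have p: "0 \<le> t1 - \<psi> b" "t1 - \<psi> b + m \<le> t2 - \<psi> b" using m by auto
      then have "(t1 - \<psi> b + m)\<^sup>2 \<le> (t2 - \<psi> b)\<^sup>2" using m by (intro power_mono) auto
      moreover have "(t1 - \<psi> b)\<^sup>2 + m\<^sup>2 \<le> (t1 - \<psi> b + m)\<^sup>2" using p m by (simp add: power2_sum)
      moreover have "max 0 (t1 - \<psi> b) = t1 - \<psi> b" "max 0 (t2 - \<psi> b) = t2 - \<psi> b" using p m by auto
      ultimately show False using lt by linarith
    qed
    then have "b\<^sup>2 \<le> s\<^sup>2" using out[OF b(1)] by simp
    then have bs: "b \<le> s" using s by (auto intro: power2_le_imp_le)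
    have "y\<^sup>2 < b\<^sup>2" using b(2) zero_le_power2[of "max 0 (t2 - \<psi> b)"] by linarith
    then have "y < b" using K_pos[OF b(1)] by (auto intro: power2_less_imp_less)
    moreover have "t2 - m \<le> \<psi> b"
    proof (rule ccontr)
      assume n: "\<not> t2 - m \<le> \<psi> b"
      then have "m\<^sup>2 \<le> (t2 - \<psi> b)\<^sup>2" using m by (intro power_mono) auto
      moreover have "max 0 (t1 - \<psi> b) = 0" "max 0 (t2 - \<psi> b) = t2 - \<psi> b" using big n m by auto
      moreover have "(0::real)\<^sup>2 = 0" by simp
      ultimately show False using lt by simp
    qed
    ultimately show ?thesis using b(1) bs y m by (intro bexI[of _ b]) auto
  qed
  have sK: "s \<in> K"
  proof -
    have "s \<in> closure K"
      unfolding closure_approachable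
    proof (intro allI impI)
      fix e :: real assume "e > 0"
      then obtain b where "b \<in> K" "s - e < b" "b \<le> s" using approx by blast
      then show "\<exists>y\<in>K. dist y s < e" by (intro bexI[of _ b]) (auto simp: dist_real_def)
    qed
    then show ?thesis using closed_K by simp
  qed
  have \<psi>s: "\<psi> s \<ge> t2"
  proof (rule field_le_epsilon)
    fix e :: real assume e: "e > 0"
    then obtain d where d: "d > 0" "\<And>b. b \<in> K \<Longrightarrow> s - d < b \<Longrightarrow> b \<le> s \<Longrightarrow> \<psi> b \<le> \<psi> s + e / 2"
      using left_cont[OF sK, of "e / 2"] by auto
    obtain b where "b \<in> K" "s - min d (e / 2) < b" "b \<le> s" "t2 - min d (e / 2) \<le> \<psi> b"
      using approx[of "min d (e / 2)"] d(1) e by auto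
    then show "t2 \<le> \<psi> s + e" using d(2)[of b] by (auto simp: min_def split: if_splits)
  qed
  obtain b where b: "b \<in> K" "s < b" "\<psi> s \<le> \<psi> b + sqrt (b\<^sup>2 - s\<^sup>2) + (t2 - t1) / 2"
    using no_flat[OF sK s(2), of "(t2 - t1) / 2"] \<psi>s t by auto
  have "b\<^sup>2 - s\<^sup>2 > 0" using b(2) s by (simp add: power_strict_mono)
  then have "sqrt (b\<^sup>2 - s\<^sup>2) > 0" by simp
  moreover have "sqrt (b\<^sup>2 - s\<^sup>2) \<le> sqrt ((max 0 (t1 - \<psi> b))\<^sup>2)" using out[OF b(1)] by (intro real_sqrt_le_mono) auto
  ultimately have "sqrt (b\<^sup>2 - s\<^sup>2) \<le> t1 - \<psi> b" by (auto simp: max_def split: if_splits)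
  then have "\<psi> s \<le> t1 + (t2 - t1) / 2" using b(3) by linarith
  also have "\<dots> < t2" using t by (simp add: field_simps)
  finally show False using \<psi>s by simp
qed

context
  fixes A :: "(real^2) set"
  assumes A: "compact A" "A \<noteq> {}" and disj: "A \<inter> hole \<eta> K \<psi> = {}" and fr: "frontier (hole \<eta> K \<psi>) \<subseteq> A"
begin

lemma infdist_le_outside:
  assumes "x \<in> hole \<eta> K \<psi>" "z \<notin> hole \<eta> K \<psi>" shows "infdist x A \<le> dist x z"
  using ball_subset_of_frontier_subset[OF disj fr assms(1)] assms(2) by (auto simp: subset_iff not_less)

text \<open>
  A nearest point \<open>p\<close> at the same height as \<open>x\<close> is impossible: the points
  \<open>p + (\<plusminus>e, \<surd>(\<rho>e))\<close> lie in the ball around \<open>x\<close>, hence in a ball around a point of the axis,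
  which for small \<open>e\<close> contains \<open>p\<close> as well.
\<close>

lemma off_axis_not_critical:
  assumes x: "x \<in> hole \<eta> K \<psi>" and off: "x $ 2 \<noteq> \<eta>"
  shows "\<not> critical_point A x"
proof
  assume crit: "critical_point A x"
  define \<rho> where "\<rho> = infdist x A"
  have \<rho>: "\<rho> > 0" using crit by (simp add: critical_point_def \<rho>_def)
  define \<epsilon> :: real where "\<epsilon> = (if x $ 2 > \<eta> then 1 else -1)"
  have \<epsilon>: "\<epsilon> * \<epsilon> = 1" "\<bar>\<epsilon>\<bar> = 1" by (auto simp: \<epsilon>_def)
  define Y where "Y z = \<epsilon> * (z $ 2 - \<eta>)" for z :: "real^2"
  have Yx: "Y x > 0" using off by (auto simp: Y_def \<epsilon>_def)
  have absY: "\<bar>z $ 2 - \<eta>\<bar> = \<bar>Y z\<bar>" for z using \<epsilon> by (simp add: Y_def abs_mult)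
  have sqY: "(z $ 2 - w $ 2)\<^sup>2 = (Y z - Y w)\<^sup>2" for z w
    by (auto simp: Y_def \<epsilon>_def power2_commute)
  have distY: "(dist z w)\<^sup>2 = (z $ 1 - w $ 1)\<^sup>2 + (Y z - Y w)\<^sup>2" for z w by (simp add: dist_plane sqY)
  obtain p where p: "p \<in> nearest_points A x" "(x - p) \<bullet> vector [0, -\<epsilon>] \<le> 0"
    using crit by (auto simp: critical_point_def)
  have Yp: "Y p \<le> Y x"
    using p(2) by (simp add: inner_vec_def sum_2 Y_def algebra_simps)
  have pO: "p \<notin> hole \<eta> K \<psi>" using p(1) disj by (auto simp: nearest_points_def)
  have \<rho>p: "\<rho>\<^sup>2 = (x $ 1 - p $ 1)\<^sup>2 + (Y x - Y p)\<^sup>2"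
    using p(1) distY[of x p] by (simp add: nearest_points_def \<rho>_def)
  have far: "\<rho>\<^sup>2 \<le> (x $ 1 - z $ 1)\<^sup>2 + (Y x - Y z)\<^sup>2" if "z \<notin> hole \<eta> K \<psi>" for z
  proof -
    have "\<rho>\<^sup>2 \<le> (dist x z)\<^sup>2" unfolding \<rho>_def by (intro power_mono infdist_le_outside x that infdist_nonneg)
    then show ?thesis by (simp add: distY)
  qed
  have Ypt: "Y (vector [a, \<eta> + \<epsilon> * h]) = h" for a h using \<epsilon> by (simp add: Y_def mult.assoc[symmetric])
  \<comment> \<open>Otherwise the mirror image of \<open>p\<close> in the axis would be outside the
    hole and closer to \<open>x\<close>.\<close>
  have "\<not> Y p < - Y x"
  proof
    assume n: "Y p < - Y x"
    define q :: "real^2" where "q = vector [p $ 1, \<eta> + \<epsilon> * (- Y p)]"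
    have q: "q $ 1 = p $ 1" "Y q = - Y p" unfolding q_def by (simp only: vector_2, rule Ypt)
    have "q \<notin> hole \<eta> K \<psi>" using hole_mono[of q p] pO q by (auto simp: absY)
    from far[OF this] have "(Y x - Y p)\<^sup>2 \<le> (Y x + Y p)\<^sup>2" using \<rho>p q by simp
    then have "0 \<le> Y x * Y p" by (simp add: power2_sum power2_diff mult.commute)
    then show False using Yx n by (simp add: zero_le_mult_iff)
  qed
  then have "\<bar>Y p\<bar> \<le> \<bar>Y x\<bar>" using Yp Yx by simp
  define q :: "real^2" where "q = vector [p $ 1, \<eta> + \<epsilon> * Y x]"
  have q: "q $ 1 = p $ 1" "Y q = Y x" unfolding q_def by (simp only: vector_2, rule Ypt)
  have "q \<notin> hole \<eta> K \<psi>" using hole_mono[of q p] pO q \<open>\<bar>Y p\<bar> \<le> \<bar>Y x\<bar>\<close> by (auto simp: absY)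
  from far[OF this] have "\<rho>\<^sup>2 \<le> (x $ 1 - p $ 1)\<^sup>2" using q by simp
  then have "(Y x - Y p)\<^sup>2 \<le> 0" using \<rho>p by linarith
  then have Yeq: "Y p = Y x" by simp
  then have x1: "(x $ 1 - p $ 1)\<^sup>2 = \<rho>\<^sup>2" using \<rho>p by simp
  define \<sigma> :: real where "\<sigma> = (if x $ 1 > p $ 1 then 1 else -1)"
  have \<sigma>: "\<sigma> * \<sigma> = 1" "\<bar>\<sigma>\<bar> = 1" by (auto simp: \<sigma>_def)
  have x1p: "x $ 1 = p $ 1 + \<sigma> * \<rho>" using x1 \<rho> by (auto simp: \<sigma>_def power2_eq_iff)
  define m where "m = \<bar>p $ 1\<bar> + \<bar>C\<bar> + 1"
  have m: "m > 0" by (simp add: m_def)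
  \<comment> \<open>The bound \<open>e \<le> \<rho> * (Y x / m)^2\<close> makes the vertical gain
    \<open>Y x * sqrt (\<rho> * e)\<close> at least the horizontal loss \<open>e * m\<close>, where
    \<open>m\<close> exceeds the horizontal distance of \<open>p\<close> from every possible
    centre.\<close>
  define e where "e = min (\<rho> / 2) (\<rho> * (Y x / m)\<^sup>2)"
  have e: "0 < e" "e < \<rho>" "e \<le> \<rho> * (Y x / m)\<^sup>2" using \<rho> Yx m by (auto simp: e_def)
  have em: "e * m \<le> Y x * sqrt (\<rho> * e)"
  proof -
    have "(e * m)\<^sup>2 = e * m\<^sup>2 * e" by (simp add: power2_eq_square)
    also have "\<dots> \<le> \<rho> * (Y x / m)\<^sup>2 * m\<^sup>2 * e" using e m by (intro mult_right_mono) auto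
    also have "\<dots> = (Y x * sqrt (\<rho> * e))\<^sup>2" using m \<rho> e by (simp add: power_mult_distrib power_divide)
    finally show ?thesis by (rule power2_le_imp_le) (use Yx \<rho> e(1) in simp)
  qed
  define z :: "real^2" where "z = vector [p $ 1 + \<sigma> * e, \<eta> + \<epsilon> * (Y x + sqrt (\<rho> * e))]"
  have z: "z $ 1 = p $ 1 + \<sigma> * e" "Y z = Y x + sqrt (\<rho> * e)" unfolding z_def by (simp only: vector_2, rule Ypt)
  have "x $ 1 - z $ 1 = \<sigma> * (\<rho> - e)" "Y x - Y z = - sqrt (\<rho> * e)" unfolding z x1p by (simp_all add: algebra_simps)
  then have "(dist x z)\<^sup>2 = (\<sigma> * (\<rho> - e))\<^sup>2 + (sqrt (\<rho> * e))\<^sup>2"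
    unfolding distY by simp
  also have "\<dots> = (\<rho> - e)\<^sup>2 + \<rho> * e" using \<sigma> \<rho> e by (simp add: power_mult_distrib power2_eq_square[of \<sigma>])
  also have "\<dots> < \<rho>\<^sup>2" 
  proof -
    have "e * e < e * \<rho>" using e by simp
    then show ?thesis by (simp add: power2_eq_square algebra_simps)
  qed
  finally have "dist x z < \<rho>" using \<rho> by (auto intro: power2_less_imp_less)
  then have "z \<in> hole \<eta> K \<psi>" using ball_subset_of_frontier_subset[OF disj fr x] by (auto simp: \<rho>_def)
  then obtain b \<tau> where b: "b \<in> K" "\<bar>\<tau>\<bar> \<le> \<psi> b" "(z $ 1 - \<tau>)\<^sup>2 + (z $ 2 - \<eta>)\<^sup>2 < b\<^sup>2" using mem_hole by blast
  have "b\<^sup>2 \<le> (p $ 1 - \<tau>)\<^sup>2 + (p $ 2 - \<eta>)\<^sup>2" using pO b(1,2) mem_hole by (meson not_less)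
  moreover have h2: "(w $ 2 - \<eta>)\<^sup>2 = (Y w)\<^sup>2" for w by (auto simp: Y_def \<epsilon>_def power2_commute)
  ultimately have "(z $ 1 - \<tau>)\<^sup>2 + (Y x + sqrt (\<rho> * e))\<^sup>2 < (p $ 1 - \<tau>)\<^sup>2 + (Y x)\<^sup>2"
    using b(3) unfolding h2 Yeq z(2) by linarith
  moreover have "(z $ 1 - \<tau>)\<^sup>2 = (p $ 1 - \<tau>)\<^sup>2 + 2 * (\<sigma> * e * (p $ 1 - \<tau>)) + (\<sigma> * e)\<^sup>2"
    unfolding z(1) by (simp add: power2_eq_square algebra_simps)
  moreover have "(Y x + sqrt (\<rho> * e))\<^sup>2 = (Y x)\<^sup>2 + 2 * (Y x * sqrt (\<rho> * e)) + (sqrt (\<rho> * e))\<^sup>2" by (simp add: power2_sum)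
  moreover have "0 \<le> (\<sigma> * e)\<^sup>2" "0 \<le> (sqrt (\<rho> * e))\<^sup>2" by auto
  ultimately have "Y x * sqrt (\<rho> * e) < - (\<sigma> * e * (p $ 1 - \<tau>))" by linarith
  also have "\<dots> \<le> \<bar>\<sigma> * e * (p $ 1 - \<tau>)\<bar>" by linarith
  also have "\<dots> = e * \<bar>p $ 1 - \<tau>\<bar>" using \<sigma> e by (simp add: abs_mult)
  also have "\<dots> \<le> e * m"
    using e b(2) profile_le[OF b(1)] by (intro mult_left_mono) (auto simp: m_def)
  finally show False using em by simp
qed

text \<open>Testing with the horizontal direction towards the centre gives a nearest point
  \<open>p\<close> that is not farther out than \<open>x\<close> on the side of \<open>x\<close>.
  Moving it to the abscissa of \<open>x\<close>, or mirroring it if it lies far on the opposite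
  side, stays outside the hole and comes closer to \<open>x\<close>, unless \<open>p\<close> is
  straight above or below \<open>x\<close>.\<close>

lemma axis_critical:
  assumes x: "x \<in> hole \<eta> K \<psi>" and ax: "x $ 2 = \<eta>" and crit: "critical_point A x" and x0: "x $ 1 \<noteq> 0"
  shows "vector [\<bar>x $ 1\<bar>, \<eta> + infdist x A] \<notin> hole \<eta> K \<psi>"
    "\<And>y. 0 \<le> y \<Longrightarrow> y < infdist x A \<Longrightarrow> vector [\<bar>x $ 1\<bar>, \<eta> + y] \<in> hole \<eta> K \<psi>"
proof -
  define \<rho> where "\<rho> = infdist x A"
  have \<rho>: "\<rho> > 0" using crit by (simp add: critical_point_def \<rho>_def)
  define \<sigma> :: real where "\<sigma> = (if x $ 1 > 0 then 1 else -1)"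
  obtain p where p: "p \<in> nearest_points A x" "(x - p) \<bullet> vector [- \<sigma>, 0] \<le> 0"
    using crit by (auto simp: critical_point_def)
  have le: "\<sigma> * p $ 1 \<le> \<bar>x $ 1\<bar>"
    using p(2) by (auto simp: inner_vec_def sum_2 \<sigma>_def algebra_simps split: if_splits)
  have pO: "p \<notin> hole \<eta> K \<psi>" using p(1) disj by (auto simp: nearest_points_def)
  have \<rho>p: "\<rho>\<^sup>2 = (x $ 1 - p $ 1)\<^sup>2 + (p $ 2 - \<eta>)\<^sup>2"
    using p(1) dist_plane[of x p] ax by (simp add: nearest_points_def \<rho>_def power2_commute)
  have far: "\<rho>\<^sup>2 \<le> (x $ 1 - z $ 1)\<^sup>2 + (z $ 2 - \<eta>)\<^sup>2" if "z \<notin> hole \<eta> K \<psi>" for z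
  proof -
    have "\<rho>\<^sup>2 \<le> (dist x z)\<^sup>2" unfolding \<rho>_def by (intro power_mono infdist_le_outside x that infdist_nonneg)
    then show ?thesis by (simp add: dist_plane ax power2_commute)
  qed
  have "p $ 1 = x $ 1"
  proof (cases "\<bar>p $ 1\<bar> \<le> \<bar>x $ 1\<bar>")
    case True
    define q :: "real^2" where "q = vector [x $ 1, p $ 2]"
    have "q \<notin> hole \<eta> K \<psi>" using hole_mono[of q p] pO True by (auto simp: q_def)
    from far[OF this] \<rho>p have "(x $ 1 - p $ 1)\<^sup>2 \<le> 0" by (simp add: q_def)
    then show ?thesis by simp
  next
    case False
    define q :: "real^2" where "q = vector [- p $ 1, p $ 2]"
    have "q \<notin> hole \<eta> K \<psi>" using hole_mono[of q p] pO by (auto simp: q_def)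
    from far[OF this] \<rho>p have "(x $ 1 - p $ 1)\<^sup>2 \<le> (x $ 1 + p $ 1)\<^sup>2" by (simp add: q_def)
    then have "0 \<le> x $ 1 * p $ 1" by (simp add: power2_sum power2_diff mult.commute)
    then have False using False le x0 by (auto simp: \<sigma>_def zero_le_mult_iff split: if_splits)
    then show ?thesis ..
  qed
  then have "(p $ 2 - \<eta>)\<^sup>2 = \<rho>\<^sup>2" using \<rho>p by simp
  then have "\<bar>p $ 2 - \<eta>\<bar> = \<rho>" using \<rho> by (metis abs_of_pos power2_eq_iff_nonneg abs_ge_zero power2_abs)
  then show "vector [\<bar>x $ 1\<bar>, \<eta> + infdist x A] \<notin> hole \<eta> K \<psi>"
    using hole_mono[of "vector [\<bar>x $ 1\<bar>, \<eta> + \<rho>]" p] pO \<open>p $ 1 = x $ 1\<close> \<rho> by (auto simp: \<rho>_def)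
  fix y assume y: "0 \<le> y" "y < infdist x A"
  define z :: "real^2" where "z = vector [x $ 1, \<eta> + y]"
  have "(dist x z)\<^sup>2 = y\<^sup>2" by (simp add: dist_plane z_def ax)
  then have "dist x z = y" using y(1) by (metis power2_eq_iff_nonneg zero_le_dist)
  then have "z \<in> hole \<eta> K \<psi>" using ball_subset_of_frontier_subset[OF disj fr x] y(2) by auto
  then show "vector [\<bar>x $ 1\<bar>, \<eta> + y] \<in> hole \<eta> K \<psi>" by (rule hole_mono) (auto simp: z_def)
qed

text \<open>Critical points lie on the axis, and two different positive values of
  \<open>\<bar>x $ 1\<bar>\<close> would contradict \<open>axis_point_unique\<close>. The centre
  \<open>x $ 1 = 0\<close> may be critical at any level and is counted separately, so there are at
  most three such points.\<close>

lemma finite_critical_hole: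
  assumes s: "s > 0" "s \<notin> N"
  shows "finite {x \<in> hole \<eta> K \<psi>. critical_point A x \<and> infdist x A = s}" (is "finite ?S")
proof -
  define T where "T = (\<lambda>x. \<bar>x $ 1\<bar>) ` ?S"
  have "t = t'" if "t \<in> T - {0}" "t' \<in> T - {0}" for t t'
  proof -
    have *: False if tt: "t \<in> T - {0}" "t' \<in> T - {0}" "t < t'" for t t'
    proof -
      obtain x x' where x: "x \<in> ?S" "t = \<bar>x $ 1\<bar>" "x' \<in> ?S" "t' = \<bar>x' $ 1\<bar>"
        using tt(1,2) unfolding T_def by blast
      have ax: "x $ 2 = \<eta>" "x' $ 2 = \<eta>" using x off_axis_not_critical by blast+
      show False
      proof (rule axis_point_unique[OF s, of t t'])
        show "vector [t, \<eta> + s] \<notin> hole \<eta> K \<psi>" using axis_critical(1)[of x] x ax tt by auto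
        show "vector [t', \<eta> + y] \<in> hole \<eta> K \<psi>" if "0 \<le> y" "y < s" for y
          using axis_critical(2)[of x' y] x ax that tt by auto
      qed (use x tt in auto)
    qed
    show ?thesis using *[of t t'] *[of t' t] that by (cases t t' rule: linorder_cases) auto
  qed
  then have "finite (T - {0})" by (metis finite.emptyI finite_insert finite_subset insertI1 subsetI)
  then have finT: "finite T" by simp
  have "?S \<subseteq> (\<lambda>t. vector [t, \<eta>]) ` (T \<union> uminus ` T)"
  proof
    fix x assume x: "x \<in> ?S"
    have "x $ 2 = \<eta>" using x off_axis_not_critical by blast
    then have "x = vector [x $ 1, \<eta>]" by (auto simp: vec_eq_iff forall_2)
    moreover have "\<bar>x $ 1\<bar> \<in> T" using x by (auto simp: T_def)
    then have "x $ 1 \<in> T \<union> uminus ` T" by (cases "x $ 1 \<ge> 0") (auto simp: image_iff intro!: bexI[of _ "\<bar>x $ 1\<bar>"])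
    ultimately show "x \<in> (\<lambda>t. vector [t, \<eta>]) ` (T \<union> uminus ` T)" by blast
  qed
  then show ?thesis using finT by (meson finite_UnI finite_imageI finite_subset)
qed

text \<open>On the stretch given by \<open>flat\<close> the points at height \<open>n\<close> are
  outside the hole, while the ball of radius \<open>n\<close> around the axis point is inside. The
  distance there is the roof \<open>n - \<bar>x $ 2 - \<eta>\<bar>\<close>.\<close>

lemma not_differentiable_hole:
  assumes n: "n \<in> N"
  shows "\<not> volume_function A differentiable (at n)"
proof -
  have nK: "n \<in> K" and npos: "n > 0" using n N_K K_pos by auto
  obtain l where l: "l > 0" "l \<le> \<psi> n" "\<And>b. b \<in> K \<Longrightarrow> n < b \<Longrightarrow> \<psi> b + sqrt (b\<^sup>2 - n\<^sup>2) \<le> \<psi> n - l"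
    using flat[OF n] by blast
  show ?thesis
  proof (rule volume_function_not_differentiable[OF A npos, of "\<psi> n - l" "\<psi> n" \<eta>])
    fix x :: "real^2" assume x: "\<psi> n - l < x $ 1" "x $ 1 < \<psi> n" "\<bar>x $ 2 - \<eta>\<bar> < n"
    define h where "h = \<bar>x $ 2 - \<eta>\<bar>"
    have x10: "x $ 1 \<ge> 0" using x l by simp
    have "\<bar>x $ 2 - \<eta>\<bar>\<^sup>2 < n\<^sup>2" using x(3) by (intro power_strict_mono) auto
    then have xO: "x \<in> hole \<eta> K \<psi>"
      unfolding mem_hole using x x10 by (intro bexI[OF _ nK] exI[of _ "x $ 1"]) simp
    have top: "vector [x $ 1, \<eta> + n] \<notin> hole \<eta> K \<psi>"
    proof -
      have "b\<^sup>2 \<le> (max 0 (x $ 1 - \<psi> b))\<^sup>2 + n\<^sup>2" if b: "b \<in> K" for b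
      proof (cases "n < b")
        case True
        have "sqrt (b\<^sup>2 - n\<^sup>2) \<le> x $ 1 - \<psi> b" using l(3)[OF b True] x by simp
        moreover have "0 \<le> b\<^sup>2 - n\<^sup>2" using True npos by (simp add: power_mono)
        ultimately have "b\<^sup>2 - n\<^sup>2 \<le> (x $ 1 - \<psi> b)\<^sup>2" "0 \<le> x $ 1 - \<psi> b"
          using sqrt_le_D real_sqrt_ge_zero order_trans by blast+
        then show ?thesis by simp
      next
        case False
        then have "b\<^sup>2 \<le> n\<^sup>2" using K_pos[OF b] by (intro power_mono) auto
        then show ?thesis by (simp add: add_increasing)
      qed
      then show ?thesis using mem_hole_axis[OF x10, of n] npos by (auto simp: not_less)
    qed
    have "infdist x A \<le> n - h"
    proof -
      define q :: "real^2" where "q = vector [x $ 1, if x $ 2 \<ge> \<eta> then \<eta> + n else \<eta> - n]"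
      have "q \<notin> hole \<eta> K \<psi>" using hole_mono[of q "vector [x $ 1, \<eta> + n]"] top npos by (auto simp: q_def)
      moreover have "(dist x q)\<^sup>2 = (n - h)\<^sup>2" by (auto simp: dist_plane q_def h_def power2_commute algebra_simps)
      then have "dist x q = n - h" using x(3) by (metis diff_ge_0_iff_ge h_def less_imp_le power2_eq_iff_nonneg zero_le_dist)
      ultimately show ?thesis using infdist_le_outside[OF xO] by metis
    qed
    moreover have "n - h \<le> infdist x A"
    proof -
      define c :: "real^2" where "c = vector [x $ 1, \<eta>]"
      have "(dist x c)\<^sup>2 = h\<^sup>2" by (simp add: dist_plane c_def h_def)
      then have xc: "dist x c = h" by (metis h_def abs_ge_zero power2_eq_iff_nonneg zero_le_dist)
      have "n - h \<le> dist x a" if a: "a \<in> A" for a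
      proof -
        have "x $ 1 \<in> {-\<psi> n..\<psi> n}" using x x10 by auto
        then have "ball c n \<subseteq> hole \<eta> K \<psi>" unfolding hole_def c_def using nK by blast
        then have "n \<le> dist c a" using a disj by (auto simp: not_less[symmetric])
        then show ?thesis using xc dist_triangle[of c a x] by (simp add: dist_commute)
      qed
      then show ?thesis unfolding infdist_notempty[OF A(2)] by (intro cINF_greatest A(2))
    qed
    ultimately show "infdist x A = n - \<bar>x $ 2 - \<eta>\<bar>" by (simp add: h_def)
  qed (use l in simp)
qed

end

end

section \<open>Stacking the holes\<close>

text \<open>Holes in disjoint horizontal strips of heights \<open>2 * T i\<close> do not see each
  other: the frontier of each belongs to \<open>A\<close>, so the analysis of one hole applies.
  Summable heights and a common width keep the box bounded.\<close>

lemma nondiff_radii_of_holes: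
  fixes T :: "nat \<Rightarrow> real" and K N :: "nat \<Rightarrow> real set" and \<psi> :: "nat \<Rightarrow> real \<Rightarrow> real"
  assumes T: "\<And>i. T i > 0" "summable T" and C: "C \<ge> 0"
    and prof: "\<And>i. hole_profile (K i) (N i) (\<psi> i) C" and KT: "\<And>i. K i \<subseteq> {..T i}"
  shows "\<exists>A :: (real^2) set. A \<noteq> {} \<and> compact A \<and> (\<Union>i. N i) = nondiff_radii A"
proof -
  define S where "S i = (\<Sum>j<i. 2 * T j)" for i
  define \<eta> where "\<eta> i = S i + T i" for i
  define H where "H = (\<Sum>i. 2 * T i)"
  define O' where "O' i = hole (\<eta> i) (K i) (\<psi> i)" for i
  have sT: "summable (\<lambda>i. 2 * T i)" using T(2) by (intro summable_mult)
  have S_Suc: "S (Suc i) = \<eta> i + T i" for i by (simp add: S_def \<eta>_def)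
  have S_mono: "S i \<le> S j" if "i \<le> j" for i j
    unfolding S_def using that T(1) by (intro sum_mono2) (auto intro: less_imp_le)
  have S0: "0 \<le> S i" for i using S_mono[of 0 i] by (simp add: S_def)
  have SH: "S i \<le> H" for i unfolding S_def H_def using T(1) by (intro sum_le_suminf sT) (auto intro: less_imp_le)
  have TH: "T i \<le> H" for i using SH[of "Suc i"] S0[of i] T(1)[of i] by (simp add: S_Suc \<eta>_def)
  have H0: "H \<ge> 0" using SH[of 0] S0[of 0] by simp
  define W where "W = C + H + 1"
  define B :: "(real^2) set" where "B = cbox (vector [- W, -1]) (vector [W, H + 1])"
  have memB: "x \<in> B \<longleftrightarrow> \<bar>x $ 1\<bar> \<le> W \<and> -1 \<le> x $ 2 \<and> x $ 2 \<le> H + 1" for x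
    by (auto simp: B_def mem_box_cart forall_2)
  have strip: "\<bar>x $ 2 - \<eta> i\<bar> < T i \<and> \<bar>x $ 1\<bar> < C + T i" if "x \<in> O' i" for x i
    using hole_profile.hole_bounds[OF prof _ KT] that by (simp add: O'_def)
  have openO: "open (O' i)" for i unfolding O'_def by (rule hole_profile.open_hole[OF prof])
  have strip': "\<bar>x $ 2 - \<eta> i\<bar> \<le> T i \<and> \<bar>x $ 1\<bar> \<le> C + T i" if "x \<in> closure (O' i)" for x i
  proof -
    have "closed {x::real^2. \<bar>x $ 2 - \<eta> i\<bar> \<le> T i \<and> \<bar>x $ 1\<bar> \<le> C + T i}"
      by (intro closed_Collect_conj closed_Collect_le continuous_intros)
    then have "closure (O' i) \<subseteq> {x. \<bar>x $ 2 - \<eta> i\<bar> \<le> T i \<and> \<bar>x $ 1\<bar> \<le> C + T i}"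
      using strip by (intro closure_minimal) (auto intro: less_imp_le)
    then show ?thesis using that by blast
  qed
  define A where "A = B - (\<Union>i. O' i)"
  have compA: "compact A"
  proof -
    have "closed (- (\<Union>i. O' i))" using openO by (intro closed_Compl open_UN) auto
    then show ?thesis unfolding A_def Diff_eq B_def by (intro compact_Int_closed compact_cbox)
  qed
  have neA: "A \<noteq> {}"
  proof -
    have "vector [0, -1] \<in> B" using C H0 by (simp add: memB W_def)
    moreover have "vector [0, -1] \<notin> O' i" for i
      using strip[of "vector [0, -1]" i] S0[of i] by (auto simp: \<eta>_def)
    ultimately show ?thesis by (auto simp: A_def)
  qed
  have disj: "A \<inter> hole (\<eta> i) (K i) (\<psi> i) = {}" for i by (auto simp: A_def O'_def)
  have fr: "frontier (hole (\<eta> i) (K i) (\<psi> i)) \<subseteq> A" for i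
  proof
    fix z assume "z \<in> frontier (hole (\<eta> i) (K i) (\<psi> i))"
    then have z: "z \<in> closure (O' i)" "z \<notin> O' i"
      using openO[of i] by (auto simp: frontier_def interior_open O'_def)
    have sz: "\<bar>z $ 2 - \<eta> i\<bar> \<le> T i" "\<bar>z $ 1\<bar> \<le> C + T i" using strip'[OF z(1)] by auto
    have "z \<in> B"
    proof -
      have "S i \<le> z $ 2" "z $ 2 \<le> S (Suc i)" using sz(1) by (auto simp: \<eta>_def S_Suc abs_le_iff)
      then show ?thesis using sz(2) S0[of i] SH[of "Suc i"] TH[of i] by (simp add: memB W_def)
    qed
    moreover have "z \<notin> O' j" for j
    proof
      assume "z \<in> O' j"
      then have zj: "\<bar>z $ 2 - \<eta> j\<bar> < T j" using strip by blast
      have "i \<noteq> j" using z(2) \<open>z \<in> O' j\<close> by auto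
      then consider "Suc i \<le> j" | "Suc j \<le> i" by linarith
      then show False
      proof cases
        case 1
        then show False using S_mono[OF 1] sz(1) zj unfolding S_Suc by (simp add: \<eta>_def abs_le_iff abs_less_iff)
      next
        case 2
        then show False using S_mono[OF 2] sz(1) zj unfolding S_Suc by (simp add: \<eta>_def abs_le_iff abs_less_iff)
      qed
    qed
    ultimately show "z \<in> A" by (auto simp: A_def)
  qed
  note fin_hole = hole_profile.finite_critical_hole[OF prof compA neA disj fr]
  note nd_hole = hole_profile.not_differentiable_hole[OF prof compA neA disj fr]
  note le_out = hole_profile.infdist_le_outside[OF prof compA neA disj fr]
  \<comment> \<open>The box is convex and contains all nearest points, so the direction away from
    the closest point of the box has positive inner product with every \<open>x - p\<close>.\<close>
  have outside: "x \<in> B" if crit: "critical_point A x" for x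
  proof (rule ccontr)
    assume xB: "x \<notin> B"
    have Bne: "closed B" "B \<noteq> {}" "convex B" using neA by (auto simp: A_def B_def convex_box)
    define c where "c = closest_point B x"
    have cB: "c \<in> B" and cmin: "\<And>y. y \<in> B \<Longrightarrow> dist x c \<le> dist x y"
      unfolding c_def using closest_point_exists[OF Bne(1,2)] by auto
    obtain p where p: "p \<in> nearest_points A x" "(x - p) \<bullet> (x - c) \<le> 0" using crit by (auto simp: critical_point_def)
    then have "p \<in> B" by (auto simp: nearest_points_def A_def)
    then have "(x - c) \<bullet> (p - c) \<le> 0" using any_closest_point_dot[OF Bne(3,1) cB] cmin by blast
    moreover have "(x - p) \<bullet> (x - c) = (norm (x - c))\<^sup>2 - (x - c) \<bullet> (p - c)"
      by (simp add: power2_norm_eq_inner inner_diff inner_commute)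
    ultimately have "(norm (x - c))\<^sup>2 \<le> 0" using p(2) by linarith
    then have "x = c" by simp
    then show False using xB cB by simp
  qed
  have finite_crit: "finite {x. critical_point A x \<and> infdist x A = s}" if s: "s > 0" "s \<notin> (\<Union>i. N i)" for s
  proof -
    have "T \<longlonglongrightarrow> 0" using T(2) by (rule summable_LIMSEQ_zero)
    then obtain n where n: "\<And>i. i \<ge> n \<Longrightarrow> T i < s / 2"
      using s(1) order_tendstoD(2)[of T 0 sequentially "s / 2"] by (auto simp: eventually_sequentially)
    \<comment> \<open>A point in hole \<open>i\<close> is within \<open>2 * T i\<close> of the upper
      edge of its strip, so only finitely many holes are deep enough for distance
      \<open>s\<close>.\<close>
    have "{x. critical_point A x \<and> infdist x A = s} \<subseteq> (\<Union>i<n. {x \<in> O' i. critical_point A x \<and> infdist x A = s})"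
    proof
      fix x assume "x \<in> {x. critical_point A x \<and> infdist x A = s}"
      then have x: "critical_point A x" "infdist x A = s" by auto
      then have "x \<notin> A" using s(1) by auto
      then obtain i where i: "x \<in> O' i" using outside[OF x(1)] by (auto simp: A_def)
      define q :: "real^2" where "q = vector [x $ 1, \<eta> i + T i]"
      have "q \<notin> O' i" using strip[of q i] T(1)[of i] by (auto simp: q_def)
      then have "s \<le> dist x q" using le_out[of x i q] i x(2) by (simp add: O'_def)
      also have "dist x q = \<eta> i + T i - x $ 2"
      proof -
        have "(dist x q)\<^sup>2 = (\<eta> i + T i - x $ 2)\<^sup>2" by (simp add: dist_plane q_def power2_commute)
        moreover have "0 \<le> \<eta> i + T i - x $ 2" using strip[OF i] by (simp add: abs_less_iff)
        ultimately show ?thesis by (simp only: power2_eq_iff_nonneg zero_le_dist)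
      qed
      also have "\<dots> \<le> 2 * T i" using strip[OF i] by (simp add: abs_less_iff)
      finally have "i < n" using n[of i] by (force simp: not_le[symmetric])
      then show "x \<in> (\<Union>i<n. {x \<in> O' i. critical_point A x \<and> infdist x A = s})" using i x by blast
    qed
    moreover have "finite {x \<in> O' i. critical_point A x \<and> infdist x A = s}" for i
      using fin_hole[of s i] s by (simp add: O'_def)
    ultimately show ?thesis using finite_subset by blast
  qed
  have "nondiff_radii A = (\<Union>i. N i)"
  proof (intro set_eqI iffI)
    fix s assume s: "s \<in> nondiff_radii A"
    show "s \<in> (\<Union>i. N i)"
    proof (rule ccontr)
      assume n: "s \<notin> (\<Union>i. N i)"
      have "s > 0" using s by (simp add: nondiff_radii_def)
      then have "volume_function A differentiable (at s)"
        by (rule volume_function_differentiable[OF compA neA _ finite_crit[OF \<open>s > 0\<close> n]])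
      then show False using s by (simp add: nondiff_radii_def)
    qed
  next
    fix s assume "s \<in> (\<Union>i. N i)"
    then obtain i where i: "s \<in> N i" by blast
    then have "s \<in> K i" using hole_profile.N_K[OF prof] by blast
    then have "s > 0" by (rule hole_profile.K_pos[OF prof])
    then show "s \<in> nondiff_radii A" using nd_hole[OF i] by (simp add: nondiff_radii_def)
  qed
  then show ?thesis using neA compA by blast
qed

subsection \<open>Profiles from the gap sum condition\<close>

lemma has_integral_half_inverse_sqrt:
  fixes a b :: real assumes "a \<le> b"
  shows "((\<lambda>x. 1 / (2 * sqrt (b - x))) has_integral sqrt (b - a)) {a..b}"
proof -
  have "((\<lambda>x. 1 / (2 * sqrt (b - x))) has_integral (- sqrt (b - b)) - (- sqrt (b - a))) {a..b}"
  proof (rule fundamental_theorem_of_calculus_interior[OF assms])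
    show "continuous_on {a..b} (\<lambda>x. - sqrt (b - x))" by (intro continuous_intros)
    fix x assume "x \<in> {a<..<b}"
    then show "((\<lambda>x. - sqrt (b - x)) has_vector_derivative 1 / (2 * sqrt (b - x))) (at x)"
      unfolding has_real_derivative_iff_has_vector_derivative[symmetric]
      by (auto intro!: derivative_eq_intros simp: field_simps)
  qed
  then show ?thesis by simp
qed

lemma has_integral_sqrt_diff_squares:
  fixes a b :: real assumes "0 \<le> a" "a \<le> b"
  shows "((\<lambda>x. x / sqrt (b\<^sup>2 - x\<^sup>2)) has_integral sqrt (b\<^sup>2 - a\<^sup>2)) {a..b}"
proof -
  have "((\<lambda>x. x / sqrt (b\<^sup>2 - x\<^sup>2)) has_integral (- sqrt (b\<^sup>2 - b\<^sup>2)) - (- sqrt (b\<^sup>2 - a\<^sup>2))) {a..b}"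
  proof (rule fundamental_theorem_of_calculus_interior[OF assms(2)])
    show "continuous_on {a..b} (\<lambda>x. - sqrt (b\<^sup>2 - x\<^sup>2))" by (intro continuous_intros)
    fix x assume x: "x \<in> {a<..<b}"
    then have "0 < b\<^sup>2 - x\<^sup>2" using assms by (simp add: power_strict_mono)
    then show "((\<lambda>x. - sqrt (b\<^sup>2 - x\<^sup>2)) has_vector_derivative x / sqrt (b\<^sup>2 - x\<^sup>2)) (at x)"
      unfolding has_real_derivative_iff_has_vector_derivative[symmetric]
      by (auto intro!: derivative_eq_intros simp: field_simps)
  qed
  then show ?thesis by simp
qed

text \<open>The function \<open>1 / (2 * sqrt (b - x))\<close> has integral
  \<open>sqrt (b - a)\<close> over a gap \<open>(a, b)\<close>, so integrating \<open>w\<close> over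
  all gaps reproduces the gap sum.\<close>

lemma nn_integral_gaps_le:
  fixes w :: "real \<Rightarrow> real"
  assumes K: "closed K" and w[measurable]: "w \<in> borel_measurable borel"
    and weq: "\<And>a b x. a < x \<Longrightarrow> x < b \<Longrightarrow> a \<in> K \<Longrightarrow> b \<in> K \<Longrightarrow> {a<..<b} \<inter> K = {} \<Longrightarrow> w x = 1 / (2 * sqrt (b - x))"
    and X: "X \<subseteq> \<Union>(gaps K)"
  shows "(\<integral>\<^sup>+x. ennreal (w x) * indicator X x \<partial>lborel) \<le> gap_sum_half K"
proof -
  define G where "G = gaps K"
  have "countable (components (- K))"
    using K by (intro countable_disjoint_open_subsets) (auto intro: open_components simp: disjoint_def components_nonoverlap)
  then have cG: "countable G" unfolding G_def gaps_def by (rule countable_subset[rotated]) auto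
  have opG: "I \<in> sets borel" if "I \<in> G" for I
    using that unfolding G_def gaps_eq[OF K] by auto
  define D where "D n = (if n \<in> to_nat_on G ` G then from_nat_into G n else {})" for n
  have D[measurable]: "D n \<in> sets borel" for n using cG opG by (auto simp: D_def)
  have one: "(\<integral>\<^sup>+x. ennreal (w x) * indicator I x \<partial>lborel) = ennreal (sqrt (measure lborel I))" if I: "I \<in> G" for I
  proof -
    obtain a b where ab: "a < b" "a \<in> K" "b \<in> K" "{a<..<b} \<inter> K = {}" "I = {a<..<b}"
      using I unfolding G_def gaps_eq[OF K] by blast
    have "((\<lambda>x. 1 / (2 * sqrt (b - x))) has_integral sqrt (b - a)) {a<..<b}"
      using has_integral_half_inverse_sqrt[of a b] ab(1) by (simp add: has_integral_Icc_iff_Ioo)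
    then have "(\<integral>\<^sup>+x. ennreal (indicator {a<..<b} x * (1 / (2 * sqrt (b - x)))) \<partial>lborel) = ennreal (sqrt (b - a))"
      by (intro nn_integral_has_integral_lebesgue) auto
    moreover have "ennreal (w x) * indicator I x = ennreal (indicator {a<..<b} x * (1 / (2 * sqrt (b - x))))" for x
      using weq[of a x b] ab by (auto simp: indicator_def)
    ultimately show ?thesis using ab by simp
  qed
  have "(\<integral>\<^sup>+x. ennreal (w x) * indicator X x \<partial>lborel) \<le> (\<integral>\<^sup>+x. (\<Sum>n. ennreal (w x) * indicator (D n) x) \<partial>lborel)"
  proof (rule nn_integral_mono)
    fix x
    show "ennreal (w x) * indicator X x \<le> (\<Sum>n. ennreal (w x) * indicator (D n) x)"
    proof (cases "x \<in> X")
      case True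
      then obtain I where I: "I \<in> G" "x \<in> I" using X by (auto simp: G_def)
      then have "x \<in> D (to_nat_on G I)" using cG by (simp add: D_def)
      then have "ennreal (w x) * indicator X x = (\<Sum>n\<in>{to_nat_on G I}. ennreal (w x) * indicator (D n) x)" using True by simp
      also have "\<dots> \<le> (\<Sum>n. ennreal (w x) * indicator (D n) x)" by (rule sum_le_suminf) auto
      finally show ?thesis .
    qed simp
  qed
  also have "\<dots> = (\<Sum>n. \<integral>\<^sup>+x. ennreal (w x) * indicator (D n) x \<partial>lborel)"
    by (rule nn_integral_suminf) measurable
  also have "\<dots> \<le> gap_sum_half K"
  proof (rule suminf_le_const)
    fix m
    let ?J = "{..<m} \<inter> to_nat_on G ` G"
    have "(\<Sum>n<m. \<integral>\<^sup>+x. ennreal (w x) * indicator (D n) x \<partial>lborel) = (\<Sum>n\<in>?J. \<integral>\<^sup>+x. ennreal (w x) * indicator (D n) x \<partial>lborel)"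
      by (rule sum.mono_neutral_right) (auto simp: D_def)
    also have "\<dots> = (\<Sum>n\<in>?J. ennreal (sqrt (measure lborel (from_nat_into G n))))"
      using one cG by (intro sum.cong) (auto simp: D_def)
    also have "\<dots> = (\<Sum>I\<in>from_nat_into G ` ?J. ennreal (sqrt (measure lborel I)))"
      using cG by (subst sum.reindex) (auto intro!: inj_onI)
    also have "\<dots> \<le> (\<Sum>\<^sub>\<infinity>I\<in>G. ennreal (sqrt (measure lborel I)))"
      by (subst nonneg_infsum_complete) (use cG in \<open>auto intro!: SUP_upper from_nat_into\<close>)
    finally show "(\<Sum>n<m. \<integral>\<^sup>+x. ennreal (w x) * indicator (D n) x \<partial>lborel) \<le> gap_sum_half K"
      by (simp add: gap_sum_half_def G_def)
  qed auto
  finally show ?thesis .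
qed

section \<open>The density attached to a compact null set\<close>

locale null_compact =
  fixes K :: "real set" and M :: real
  assumes closed_K: "closed K" and K_sub: "K \<subseteq> {0..M}" and M_in: "M \<in> K" and M_pos: "M > 0"
    and null_K: "emeasure lborel K = 0"
begin

text \<open>At a point of a gap, \<open>up\<close> and \<open>down\<close> are its right and left
  ends. Inserting \<open>M\<close> and 0 as default values keeps the infimum and the supremum away
  from empty sets.\<close>

definition up :: "real \<Rightarrow> real" where "up x = Inf (insert M {y \<in> K. x \<le> y})"

definition down :: "real \<Rightarrow> real" where "down x = Sup (insert 0 {y \<in> K. y \<le> x})"

text \<open>
  On a gap \<open>(a, b)\<close> this is the derivative of \<open>-\<surd>(b\<^sup>2 - x\<^sup>2)\<close>; it is cut off on the gaps with
  \<open>b > 2a\<close>, which are too long to be crossed by one hole.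
\<close>

definition dens :: "real \<Rightarrow> real" where
  "dens x = (if 0 < x \<and> x < M \<and> x \<notin> K \<and> x / 2 \<le> down x then x / sqrt ((up x)\<^sup>2 - x\<^sup>2) else 0)"

lemma up:
  assumes "x \<le> M" shows "up x \<in> K" "x \<le> up x" "\<And>y. y \<in> K \<Longrightarrow> x \<le> y \<Longrightarrow> up x \<le> y"
proof -
  let ?S = "insert M {y \<in> K. x \<le> y}"
  have S: "?S = K \<inter> {x..}" using assms M_in by auto
  have cl: "closed ?S" unfolding S by (intro closed_Int closed_K) auto
  have bd: "bdd_below ?S" unfolding S by auto
  have "up x \<in> ?S" unfolding up_def by (rule closed_contains_Inf[OF _ bd cl]) auto
  then show "up x \<in> K" "x \<le> up x" unfolding S by auto
  show "up x \<le> y" if "y \<in> K" "x \<le> y" for y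
    unfolding up_def by (rule cInf_lower[OF _ bd]) (use that in auto)
qed

lemma down:
  assumes "0 \<le> x" shows "down x \<in> insert 0 K" "down x \<le> x" "\<And>y. y \<in> K \<Longrightarrow> y \<le> x \<Longrightarrow> y \<le> down x"
proof -
  let ?S = "insert 0 {y \<in> K. y \<le> x}"
  have S: "?S = insert 0 (K \<inter> {..x})" by auto
  have cl: "closed ?S" unfolding S by (intro closed_insert closed_Int closed_K) auto
  have bd: "bdd_above ?S" unfolding S using assms by auto
  have "down x \<in> ?S" unfolding down_def by (rule closed_contains_Sup[OF _ bd cl]) auto
  then show "down x \<in> insert 0 K" "down x \<le> x" using assms by auto
  show "y \<le> down x" if "y \<in> K" "y \<le> x" for y
    unfolding down_def by (rule cSup_upper[OF _ bd]) (use that in auto)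
qed

lemma up_measurable [measurable]: "up \<in> borel_measurable borel"
proof (rule borel_measurable_mono, rule monoI)
  fix x y :: real assume "x \<le> y"
  have "bdd_below (insert M {z \<in> K. x \<le> z})" by (auto intro!: bdd_belowI[of _ x])
  then show "up x \<le> up y" unfolding up_def using \<open>x \<le> y\<close> by (intro cInf_superset_mono) auto
qed

lemma down_measurable [measurable]: "down \<in> borel_measurable borel"
proof (rule borel_measurable_mono, rule monoI)
  fix x y :: real assume "x \<le> y"
  have "bdd_above (insert 0 {z \<in> K. z \<le> y})" by (auto intro!: bdd_aboveI[of _ y])
  then show "down x \<le> down y" unfolding down_def using \<open>x \<le> y\<close> by (intro cSup_subset_mono) auto
qed

lemma K_borel [measurable]: "K \<in> sets borel" using closed_K by simp

lemma dens_measurable [measurable]: "dens \<in> borel_measurable borel"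
  unfolding dens_def by measurable

lemma dens_nonneg: "0 \<le> dens x"
  using up(2)[of x] by (auto simp: dens_def power_mono)

text \<open>Up to a factor 16, \<open>x * dens x\<close> is bounded by \<open>w x\<close> times the
  integral of \<open>sqrt r\<close> over \<open>r \<le> x / 2\<close>. After exchanging the
  integrals, for fixed \<open>r\<close> there remains the integral of \<open>w\<close> over points
  \<open>x \<ge> 2 * r\<close> of gaps, at most the gap sum of
  \<open>K \<inter> {r..}\<close>.\<close>

lemma dens_integral_finite:
  assumes fin: "(\<integral>\<^sup>+r\<in>{0<..}. (gap_sum_half (K \<inter> {r..}) * ennreal (sqrt r)) \<partial>lborel) < \<infinity>"
  shows "(\<integral>\<^sup>+x. ennreal (x * dens x) \<partial>lborel) < \<infinity>"
proof -
  define w where "w x = 1 / (2 * sqrt (up x - x))" for x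
  have [measurable]: "w \<in> borel_measurable borel" unfolding w_def by measurable
  define X where "X = {x. 0 < x \<and> x < M \<and> x \<notin> K \<and> x / 2 \<le> down x}"
  have [measurable]: "X \<in> sets borel" unfolding X_def by measurable
  define g where "g x r = ennreal (sqrt r) * indicator {0<..} r * (ennreal (w x) * indicator (X \<inter> {2 * r..}) x)" for x r
  have g_alt: "g x r = ennreal (w x) * indicator X x * (ennreal (sqrt r) * indicator {0<..x / 2} r)" for x r
    by (auto simp: g_def indicator_def mult_ac)
  have pw: "ennreal (x * dens x / 16) \<le> (\<integral>\<^sup>+r. g x r \<partial>lborel)" for x
  proof (cases "x \<in> X")
    case True
    then have x: "0 < x" "x < M" "x \<notin> K" by (auto simp: X_def)
    have u: "x < up x" using up(1,2)[of x] x by (cases "up x = x") auto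
    have "ennreal (w x * (sqrt (x / 4) * (x / 4))) = ennreal (w x) * (ennreal (sqrt (x / 4)) * emeasure lborel {x / 4<..x / 2})"
      using x u by (simp add: w_def ennreal_mult'[symmetric] mult_ac)
    also have "\<dots> = ennreal (w x) * (\<integral>\<^sup>+r. ennreal (sqrt (x / 4)) * indicator {x / 4<..x / 2} r \<partial>lborel)"
      by (subst nn_integral_cmult_indicator) auto
    also have "\<dots> \<le> ennreal (w x) * (\<integral>\<^sup>+r. ennreal (sqrt r) * indicator {0<..x / 2} r \<partial>lborel)"
      using x by (intro mult_left_mono nn_integral_mono) (auto simp: indicator_def intro!: ennreal_leI)
    also have "\<dots> = (\<integral>\<^sup>+r. g x r \<partial>lborel)" unfolding g_alt using True by (simp add: nn_integral_cmult)
    finally have 1: "ennreal (w x * (sqrt (x / 4) * (x / 4))) \<le> (\<integral>\<^sup>+r. g x r \<partial>lborel)" .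
    \<comment> \<open>Only \<open>r\<close> between \<open>x / 4\<close> and \<open>x / 2\<close>
      has been used. The factors are 1/2 from \<open>w\<close>, 1/2 from \<open>sqrt (x / 4)\<close>
      and 1/4 from the length of the interval.\<close>
    have "x * dens x / 16 \<le> w x * (sqrt (x / 4) * (x / 4))"
    proof -
      have e: "sqrt ((up x)\<^sup>2 - x\<^sup>2) = sqrt (up x - x) * sqrt (up x + x)"
        by (simp add: real_sqrt_mult[symmetric] power2_eq_square algebra_simps)
      have "x * dens x = x * x / (sqrt (up x - x) * sqrt (up x + x))" using True x by (simp add: dens_def X_def e)
      also have "\<dots> \<le> x * x / (sqrt (up x - x) * sqrt x)"
        using x u by (intro divide_left_mono mult_left_mono mult_pos_pos) auto
      also have "\<dots> = (x / sqrt x) * (x / sqrt (up x - x))" by simp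
      also have "x / sqrt x = sqrt x" using x by (simp add: real_div_sqrt)
      finally show ?thesis by (simp add: w_def real_sqrt_divide)
    qed
    from order_trans[OF ennreal_leI[OF this] 1] show ?thesis .
  next
    case False
    then have "dens x = 0" by (auto simp: dens_def X_def)
    then show ?thesis by simp
  qed
  have inner: "(\<integral>\<^sup>+x. ennreal (w x) * indicator (X \<inter> {2 * r..}) x \<partial>lborel) \<le> gap_sum_half (K \<inter> {r..})" if r: "r > 0" for r
  proof (rule nn_integral_gaps_le)
    show cl: "closed (K \<inter> {r..})" using closed_K by (intro closed_Int) auto
    show "w \<in> borel_measurable borel" by measurable
    show "w x = 1 / (2 * sqrt (b - x))"
      if ab: "a < x" "x < b" "a \<in> K \<inter> {r..}" "b \<in> K \<inter> {r..}" "{a<..<b} \<inter> (K \<inter> {r..}) = {}" for a b x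
    proof -
      have "x \<le> M" using ab(2,4) K_sub by auto
      note u = up[OF this]
      have "up x \<le> b" using u(3)[of b] ab by auto
      moreover have "up x \<in> {r..}" using u(2) ab by auto
      ultimately have "up x \<in> {a<..<b} \<inter> (K \<inter> {r..})" if "up x \<noteq> b" using u(1,2) ab(1) that by auto
      then have "up x = b" using ab(5) by blast
      then show ?thesis by (simp add: w_def)
    qed
    \<comment> \<open>Here the cut-off in \<open>dens\<close> matters:
      \<open>x / 2 \<le> down x\<close> and \<open>2 * r \<le> x\<close> put the left end of the gap
      above \<open>r\<close>, so the gap survives the truncation of \<open>K\<close>.\<close>
    show "X \<inter> {2 * r..} \<subseteq> \<Union>(gaps (K \<inter> {r..}))"
    proof
      fix x assume "x \<in> X \<inter> {2 * r..}"
      then have x: "0 < x" "x < M" "x \<notin> K" "x / 2 \<le> down x" "2 * r \<le> x" by (auto simp: X_def)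
      have d: "down x \<in> K" "down x \<le> x" "r \<le> down x" "\<And>y. y \<in> K \<Longrightarrow> y \<le> x \<Longrightarrow> y \<le> down x" using down[of x] x r by auto
      have u: "up x \<in> K" "x \<le> up x" "\<And>y. y \<in> K \<Longrightarrow> x \<le> y \<Longrightarrow> up x \<le> y" using up[of x] x by auto
      have lt: "down x < x" "x < up x" using d(1,2) u(1,2) x(3) by (auto simp: less_le)
      have "{down x<..<up x} \<inter> (K \<inter> {r..}) = {}"
      proof -
        have False if "y \<in> K" "down x < y" "y < up x" for y using d(4)[of y] u(3)[of y] that by linarith
        then show ?thesis by auto
      qed
      moreover have "r \<le> up x" using d(3) lt by linarith
      ultimately have "{down x<..<up x} \<in> gaps (K \<inter> {r..})"
        unfolding gaps_eq[OF cl] mem_Collect_eq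
        by (intro exI[of _ "down x"] exI[of _ "up x"] conjI refl) (use d(1,3) u(1) lt in auto)
      then show "x \<in> \<Union>(gaps (K \<inter> {r..}))" using lt by (intro UnionI) auto
    qed
  qed
  have "(\<integral>\<^sup>+x. ennreal (x * dens x / 16) \<partial>lborel) \<le> (\<integral>\<^sup>+x. \<integral>\<^sup>+r. g x r \<partial>lborel \<partial>lborel)"
    by (rule nn_integral_mono) (rule pw)
  also have "\<dots> = (\<integral>\<^sup>+r. \<integral>\<^sup>+x. g x r \<partial>lborel \<partial>lborel)"
  proof (rule lborel_pair.Fubini')
    have [measurable]: "Measurable.pred (borel \<Otimes>\<^sub>M borel) (\<lambda>z::real \<times> real. fst z \<in> {0<..snd z / 2})"
      unfolding greaterThanAtMost_iff by measurable
    show "(\<lambda>(r, x). g x r) \<in> borel_measurable (lborel \<Otimes>\<^sub>M lborel)" unfolding g_alt by measurable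
  qed
  also have "\<dots> \<le> (\<integral>\<^sup>+r\<in>{0<..}. (gap_sum_half (K \<inter> {r..}) * ennreal (sqrt r)) \<partial>lborel)"
  proof (rule nn_integral_mono)
    fix r :: real
    show "(\<integral>\<^sup>+x. g x r \<partial>lborel) \<le> gap_sum_half (K \<inter> {r..}) * ennreal (sqrt r) * indicator {0<..} r"
    proof (cases "r > 0")
      case True
      have "(\<integral>\<^sup>+x. g x r \<partial>lborel) = ennreal (sqrt r) * (\<integral>\<^sup>+x. ennreal (w x) * indicator (X \<inter> {2 * r..}) x \<partial>lborel)"
        unfolding g_def using True by (simp add: nn_integral_cmult)
      also have "\<dots> \<le> ennreal (sqrt r) * gap_sum_half (K \<inter> {r..})" by (intro mult_left_mono inner True) auto
      finally show ?thesis using True by (simp add: mult.commute)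
    qed (simp add: g_def)
  qed
  also note fin
  finally have "16 * (\<integral>\<^sup>+x. ennreal (x * dens x / 16) \<partial>lborel) < \<infinity>" by (simp add: ennreal_mult_less_top)
  moreover have "(\<integral>\<^sup>+x. ennreal (x * dens x) \<partial>lborel) = 16 * (\<integral>\<^sup>+x. ennreal (x * dens x / 16) \<partial>lborel)"
  proof -
    have "ennreal (x * dens x) = 16 * ennreal (x * dens x / 16)" for x
      using ennreal_mult'[of 16 "x * dens x / 16"] by simp
    then show ?thesis by (simp add: nn_integral_cmult)
  qed
  ultimately show ?thesis by simp
qed

end

section \<open>Profiles of bounded width\<close>

locale gap_profile = null_compact +
  fixes N :: "real set"
  assumes dens_fin: "(\<integral>\<^sup>+x. ennreal (x * dens x) \<partial>lborel) < \<infinity>"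
    and N: "countable N" "N \<subseteq> K" "N \<subseteq> {0<..}" "N \<noteq> {}"
begin

definition mass :: "real \<Rightarrow> real \<Rightarrow> real" where "mass a b = integral {a..b} dens"

lemma xdens_nonneg: "0 \<le> x * dens x"
  using dens_nonneg[of x] by (auto simp: dens_def zero_le_mult_iff)

lemma xdens_integrable: "(\<lambda>x. x * dens x) integrable_on {a..b}"
proof -
  have "(\<lambda>x. x * dens x) integrable_on UNIV"
    by (rule nn_integral_integrable_on) (use dens_fin xdens_nonneg in auto)
  then show ?thesis by (rule integrable_on_subinterval) auto
qed

lemma dens_integrable:
  assumes "0 < a" shows "dens integrable_on {a..b}"
proof -
  define h where "h x = dens x * indicator {a..} x" for x
  have "(\<integral>\<^sup>+x. ennreal (h x) \<partial>lborel) \<le> (\<integral>\<^sup>+x. ennreal (1 / a) * ennreal (x * dens x) \<partial>lborel)"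
  proof (rule nn_integral_mono)
    fix x
    have "h x \<le> (1 / a) * (x * dens x)"
    proof (cases "a \<le> x")
      case True
      then have "1 * dens x \<le> (x / a) * dens x" using assms dens_nonneg by (intro mult_right_mono) auto
      then show ?thesis using True by (simp add: h_def)
    next
      case False then show ?thesis using xdens_nonneg[of x] assms by (simp add: h_def)
    qed
    then show "ennreal (h x) \<le> ennreal (1 / a) * ennreal (x * dens x)"
      using assms xdens_nonneg[of x] by (simp add: ennreal_mult[symmetric] ennreal_leI del: times_divide_eq_left)
  qed
  also have "\<dots> = ennreal (1 / a) * (\<integral>\<^sup>+x. ennreal (x * dens x) \<partial>lborel)" by (rule nn_integral_cmult) measurable
  also have "\<dots> < \<infinity>" using dens_fin by (simp add: ennreal_mult_less_top)
  finally have fin: "(\<integral>\<^sup>+x. ennreal (h x) \<partial>lborel) < \<infinity>" .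
  have "h \<in> borel_measurable borel" unfolding h_def by measurable
  then have "h integrable_on UNIV"
    by (rule nn_integral_integrable_on[OF _ _ fin]) (simp add: h_def dens_nonneg)
  then have "h integrable_on {a..b}" by (rule integrable_on_subinterval) auto
  then show ?thesis by (rule integrable_eq) (auto simp: h_def)
qed

lemma mass_add: "0 < a \<Longrightarrow> a \<le> b \<Longrightarrow> b \<le> c \<Longrightarrow> mass a b + mass b c = mass a c"
  unfolding mass_def by (rule Henstock_Kurzweil_Integration.integral_combine) (auto intro: dens_integrable)

lemma mass_nonneg: "0 < a \<Longrightarrow> 0 \<le> mass a b"
  unfolding mass_def by (rule integral_nonneg) (auto intro: dens_integrable dens_nonneg)

lemma mass_refl: "mass a a = 0" by (simp add: mass_def)

lemma negligible_K: "negligible K"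
  using null_K by (simp add: negligible_iff_null_sets null_sets_completion_iff null_setsI)

lemma dens_between:
  assumes ab: "a \<in> K" "b \<in> K" "b \<le> 2 * a" and x: "a < x" "x < b" "x \<notin> K"
  shows "dens x = x / sqrt ((up x)\<^sup>2 - x\<^sup>2)" "x < up x" "up x \<le> b"
proof -
  have bM: "b \<le> M" "0 \<le> a" using ab K_sub by auto
  have "a \<le> down x" using down(3)[of x a] ab x bM by auto
  then show "dens x = x / sqrt ((up x)\<^sup>2 - x\<^sup>2)" using ab x bM by (simp add: dens_def)
  show "x < up x" using up(1,2)[of x] x bM by (cases "up x = x") auto
  show "up x \<le> b" using up(3)[of x b] ab x bM by auto
qed

text \<open>Off the null set \<open>K\<close> one has \<open>up x \<le> b\<close>, so
  \<open>dens\<close> is at least the density \<open>x / sqrt (b^2 - x^2)\<close> of a single gap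
  from \<open>a\<close> to \<open>b\<close>.\<close>

lemma mass_ge:
  assumes ab: "a \<in> K" "b \<in> K" "0 < a" "a \<le> b" "b \<le> 2 * a"
  shows "sqrt (b\<^sup>2 - a\<^sup>2) \<le> mass a b"
proof -
  define h where "h x = (if x \<in> K then 0 else x / sqrt (b\<^sup>2 - x\<^sup>2))" for x
  have "(h has_integral sqrt (b\<^sup>2 - a\<^sup>2)) {a..b}"
    by (rule has_integral_spike[OF negligible_K _ has_integral_sqrt_diff_squares]) (use ab in \<open>auto simp: h_def\<close>)
  then have h: "h integrable_on {a..b}" "integral {a..b} h = sqrt (b\<^sup>2 - a\<^sup>2)" by (auto simp: has_integral_iff)
  have "integral {a..b} h \<le> integral {a..b} dens"
  proof (rule integral_le[OF h(1) dens_integrable[OF ab(3)]])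
    fix x assume x: "x \<in> {a..b}"
    show "h x \<le> dens x"
    proof (cases "x \<in> K")
      case True then show ?thesis using dens_nonneg by (simp add: h_def)
    next
      case False
      then have x': "a < x" "x < b" using x ab by (auto simp: less_le)
      note d = dens_between[OF ab(1,2,5) x' False]
      have "x\<^sup>2 < (up x)\<^sup>2" "(up x)\<^sup>2 \<le> b\<^sup>2" using d(2,3) x' ab(3) by (auto intro!: power_strict_mono power_mono)
      then have "x / sqrt (b\<^sup>2 - x\<^sup>2) \<le> x / sqrt ((up x)\<^sup>2 - x\<^sup>2)"
        using x' ab(3) by (intro divide_left_mono mult_pos_pos) auto
      then show ?thesis using d(1) False by (simp add: h_def)
    qed
  qed
  then show ?thesis using h by (simp add: mass_def)
qed

lemma mass_gap:
  assumes ab: "a \<in> K" "b \<in> K" "0 < a" "a \<le> b" "b \<le> 2 * a" and gap: "{a<..<b} \<inter> K = {}"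
  shows "mass a b = sqrt (b\<^sup>2 - a\<^sup>2)"
proof -
  have noK: "y \<notin> K" if "a < y" "y < b" for y using gap that by (auto simp: disjoint_iff)
  have "(dens has_integral sqrt (b\<^sup>2 - a\<^sup>2)) {a..b}"
  proof (rule has_integral_spike[of "{a, b}", OF _ _ has_integral_sqrt_diff_squares])
    fix x assume x: "x \<in> {a..b} - {a, b}"
    then have x': "a < x" "x < b" "x \<notin> K" using noK by auto
    note d = dens_between[OF ab(1,2,5) x']
    have "up x \<in> K" using up(1)[of x] x' ab K_sub by auto
    then have "up x = b" using d(2,3) x' noK[of "up x"] by force
    then show "dens x = x / sqrt (b\<^sup>2 - x\<^sup>2)" using d by simp
  qed (use ab in auto)
  then show ?thesis by (simp add: mass_def has_integral_iff)
qed

lemma mass_continuous: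
  assumes a: "0 < a" and s: "a \<le> s" "s \<le> b" and e: "e > 0"
  shows "\<exists>d>0. \<forall>t\<in>{a..b}. \<bar>t - s\<bar> < d \<longrightarrow> \<bar>mass a t - mass a s\<bar> < e"
proof -
  have "continuous_on {a..b} (\<lambda>t. integral {a..t} dens)"
    by (rule indefinite_integral_continuous_1) (rule dens_integrable[OF a])
  then show ?thesis using s e unfolding continuous_on_iff mass_def by (auto simp: dist_real_def)
qed

definition enum :: "nat \<Rightarrow> real" where "enum = from_nat_into N"

text \<open>A finite measure with an atom at each point of \<open>N\<close>. If \<open>N\<close> is
  finite, \<open>enum\<close> repeats values; what counts is that each point has positive weight and
  the total is at most 2.\<close>

definition weight :: "(real \<Rightarrow> bool) \<Rightarrow> real" where
  "weight P = (\<Sum>j. if P (enum j) then (1/2) ^ j else 0)"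

lemma weight_summable: "summable (\<lambda>j. if P (enum j) then (1/2) ^ j else (0::real))"
  by (rule summable_comparison_test'[OF summable_geometric[of "1/2 :: real"]]) auto

lemma weight_nonneg: "0 \<le> weight P"
  unfolding weight_def by (intro suminf_nonneg weight_summable) auto

lemma weight_le_2: "weight P \<le> 2"
proof -
  have "weight P \<le> (\<Sum>j. (1/2::real) ^ j)"
    unfolding weight_def by (intro suminf_le weight_summable summable_geometric) auto
  also have "\<dots> = 2" by (subst suminf_geometric) auto
  finally show ?thesis .
qed

lemma weight_mono: "(\<And>x. P x \<Longrightarrow> Q x) \<Longrightarrow> weight P \<le> weight Q"
  unfolding weight_def by (intro suminf_le weight_summable) auto

lemma weight_diff: "(\<And>x. P x \<Longrightarrow> Q x) \<Longrightarrow> weight Q - weight P = weight (\<lambda>x. Q x \<and> \<not> P x)"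
  unfolding weight_def by (subst suminf_diff[OF weight_summable weight_summable]) (auto intro!: suminf_cong)

lemma weight_ge: "P (enum k) \<Longrightarrow> (1/2) ^ k \<le> weight P"
  using sum_le_suminf[OF weight_summable[of P], of "{k}"] by (simp add: weight_def)

text \<open>A punctured neighbourhood of \<open>s\<close> can avoid the first \<open>m\<close>
  values of \<open>enum\<close>, and the remaining terms sum to \<open>2 * (1/2)^m\<close>.\<close>

lemma weight_tail:
  assumes "e > 0" shows "\<exists>d>0. weight (\<lambda>x. 0 < \<bar>x - s\<bar> \<and> \<bar>x - s\<bar> < d) \<le> e"
proof -
  obtain m where m: "(1/2::real) ^ m < e / 2" using real_arch_pow_inv[of "e / 2" "1/2"] assms by auto
  define D where "D = insert 1 ((\<lambda>j. \<bar>enum j - s\<bar>) ` {j. j < m \<and> enum j \<noteq> s})"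
  have D: "finite D" "D \<noteq> {}" "\<And>x. x \<in> D \<Longrightarrow> x > 0" by (auto simp: D_def)
  define d where "d = Min D"
  have d: "d > 0" using D by (simp add: d_def)
  have "weight (\<lambda>x. 0 < \<bar>x - s\<bar> \<and> \<bar>x - s\<bar> < d) \<le> (\<Sum>j. if j < m then 0 else (1/2::real) ^ j)"
    unfolding weight_def
  proof (rule suminf_le[OF _ weight_summable])
    show "summable (\<lambda>j. if j < m then 0 else (1/2::real) ^ j)"
      by (rule summable_comparison_test'[OF summable_geometric[of "1/2 :: real"]]) auto
    fix j
    have "d \<le> \<bar>enum j - s\<bar>" if "j < m" "enum j \<noteq> s"
      unfolding d_def by (rule Min_le[OF D(1)]) (use that in \<open>auto simp: D_def\<close>)
    then show "(if 0 < \<bar>enum j - s\<bar> \<and> \<bar>enum j - s\<bar> < d then (1/2) ^ j else 0) \<le> (if j < m then 0 else (1/2::real) ^ j)"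
      by auto
  qed
  also have "\<dots> = (\<Sum>j. (1/2::real) ^ (j + m))"
    by (subst suminf_split_initial_segment[of _ m])
      (auto intro!: summable_comparison_test'[OF summable_geometric[of "1/2 :: real"]])
  also have "\<dots> = 2 * (1/2) ^ m" by (subst power_add, subst suminf_mult2[symmetric], simp, subst suminf_geometric) auto
  also have "\<dots> \<le> e" using m by simp
  finally show ?thesis using d by blast
qed

text \<open>The mass provides the drop \<open>sqrt (b^2 - a^2)\<close> demanded between any two
  radii, with equality on gaps, so flat stretches arise only from the weights placed at points of
  \<open>N\<close>. The width is at most 3: mass at most 1, weights at most 2.\<close>

lemma piece_profile:
  assumes uv: "0 < u" "u \<le> v" "v \<le> M" and small: "mass u v + 2 * ln (v / u) \<le> 1"
  shows "\<exists>\<psi>. hole_profile (K \<inter> {u..v}) (N \<inter> {u..v}) \<psi> 3"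
proof -
  define L where "L = K \<inter> {u..v}"
  define P where "P = N \<inter> {u..v}"
  define top where "top = Sup L"
  \<comment> \<open>The weight of a point \<open>n\<close> still counts at \<open>b = n\<close> and
    is lost for \<open>b > n\<close>, so the profile jumps just to the right of \<open>n\<close> and
    is continuous from the left.\<close>
  define \<psi> where "\<psi> b = mass b top + weight (\<lambda>x. x \<in> P \<and> b \<le> x)" for b
  have cL: "closed L" unfolding L_def by (intro closed_Int closed_K) auto
  have bL: "bdd_above L" unfolding L_def by auto
  have top: "top \<in> L" "b \<le> top" if "b \<in> L" for b
    using closed_contains_Sup[OF _ bL cL] cSup_upper[OF that bL] that by (auto simp: top_def)
  have L: "b \<in> K" "u \<le> b" "b \<le> v" "0 < b" if "b \<in> L" for b using that uv by (auto simp: L_def)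
  have PL: "P \<subseteq> L" using N(2) by (auto simp: P_def L_def)
  have mass_le: "mass a b \<le> 1" if "u \<le> a" "a \<le> b" "b \<le> v" for a b
  proof -
    have "mass u v = mass u a + mass a b + mass b v" using that uv by (simp add: mass_add)
    moreover have "0 \<le> mass u a" "0 \<le> mass b v" using that uv by (auto intro!: mass_nonneg)
    moreover have "0 \<le> ln (v / u)" using uv by simp
    ultimately show ?thesis using small by linarith
  qed
  \<comment> \<open>The logarithmic term gives \<open>ln (v / u) \<le> 1/2 < ln 2\<close>. No gap
    within the piece is then cut off in \<open>dens\<close>.\<close>
  have double: "b \<le> 2 * a" if "u \<le> a" "a \<le> b" "b \<le> v" for a b
  proof -
    have "0 \<le> mass u v" using uv by (intro mass_nonneg)
    then have "ln (v / u) \<le> 1 / 2" using small by simp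
    also have "1 / 2 \<le> ln (2::real)" using ln2_ge_two_thirds by simp
    finally have "v / u \<le> 2" using uv by simp
    then show ?thesis using that uv by (simp add: divide_le_eq)
  qed
  have \<psi>_diff: "\<psi> a - \<psi> b = mass a b + weight (\<lambda>x. x \<in> P \<and> a \<le> x \<and> x < b)" if "a \<in> L" "b \<in> L" "a \<le> b" for a b
  proof -
    have "mass a b + mass b top = mass a top" using that L(4)[OF that(1)] top(2)[OF that(2)] by (intro mass_add) auto
    moreover have "weight (\<lambda>x. x \<in> P \<and> a \<le> x) - weight (\<lambda>x. x \<in> P \<and> b \<le> x) = weight (\<lambda>x. (x \<in> P \<and> a \<le> x) \<and> \<not> (x \<in> P \<and> b \<le> x))"
      using that by (intro weight_diff) auto
    moreover have "(\<lambda>x. (x \<in> P \<and> a \<le> x) \<and> \<not> (x \<in> P \<and> b \<le> x)) = (\<lambda>x. x \<in> P \<and> a \<le> x \<and> x < b)" by auto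
    ultimately show ?thesis by (simp add: \<psi>_def)
  qed
  have "hole_profile L P \<psi> 3"
  proof
    show "closed L" "P \<subseteq> L" by (fact cL PL)+
    show "0 < b" if "b \<in> L" for b using L(4)[OF that] .
    show "0 \<le> \<psi> b" if "b \<in> L" for b
      unfolding \<psi>_def using L(4)[OF that] by (intro add_nonneg_nonneg mass_nonneg weight_nonneg)
    show "\<psi> b \<le> 3" if "b \<in> L" for b
      using mass_le[of b top] top[OF that] L[OF that] L(3)[of top] weight_le_2[of "\<lambda>x. x \<in> P \<and> b \<le> x"] by (simp add: \<psi>_def)
    show "\<exists>l>0. l \<le> \<psi> n \<and> (\<forall>b\<in>L. n < b \<longrightarrow> \<psi> b + sqrt (b\<^sup>2 - n\<^sup>2) \<le> \<psi> n - l)" if n: "n \<in> P" for n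
    proof -
      define k where "k = to_nat_on N n"
      have k: "enum k = n" unfolding enum_def k_def using n N(1) by (intro from_nat_into_to_nat_on) (auto simp: P_def)
      have nL: "n \<in> L" using n PL by blast
      have "(1/2) ^ k \<le> weight (\<lambda>x. x \<in> P \<and> n \<le> x)" by (rule weight_ge) (use n k in auto)
      then have "(1/2) ^ k \<le> \<psi> n" using mass_nonneg[OF L(4)[OF nL]] by (simp add: \<psi>_def add_increasing)
      moreover have "\<psi> b + sqrt (b\<^sup>2 - n\<^sup>2) \<le> \<psi> n - (1/2) ^ k" if b: "b \<in> L" "n < b" for b
      proof -
        have "(1/2) ^ k \<le> weight (\<lambda>x. x \<in> P \<and> n \<le> x \<and> x < b)" by (rule weight_ge) (use n k b in auto)
        moreover have "sqrt (b\<^sup>2 - n\<^sup>2) \<le> mass n b"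
          using L[OF nL] L[OF b(1)] b(2) double[of n b] by (intro mass_ge) auto
        ultimately show ?thesis using \<psi>_diff[OF nL b(1)] b(2) by simp
      qed
      ultimately show ?thesis by (intro exI[of _ "(1/2) ^ k"]) auto
    qed
    show "\<exists>b\<in>L. s < b \<and> \<psi> s \<le> \<psi> b + sqrt (b\<^sup>2 - s\<^sup>2) + e" if s: "s \<in> L" "s \<notin> P" and e: "e > 0" and pos: "\<psi> s > 0" for s e
    proof -
      have "s \<noteq> top"
      proof
        assume "s = top"
        have "weight (\<lambda>x. x \<in> P \<and> s \<le> x) = weight (\<lambda>x. False)"
        proof -
          have "\<not> (x \<in> P \<and> s \<le> x)" for x using top(2)[of x] PL s(2) \<open>s = top\<close> by (cases "x = s") (auto simp: subset_iff)
          then show ?thesis by (intro arg_cong[of _ _ weight]) auto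
        qed
        then have "\<psi> s = 0" using \<open>s = top\<close> by (simp add: \<psi>_def mass_refl weight_def)
        then show False using pos by simp
      qed
      then have st: "s < top" using top(2)[OF s(1)] by simp
      define S where "S = {b \<in> L. s < b}"
      have S: "S \<noteq> {}" "bdd_below S" using st top(1)[OF s(1)] by (auto simp: S_def intro!: bdd_belowI[of _ s])
      define b where "b = Inf S"
      have sb: "s \<le> b" unfolding b_def by (rule cInf_greatest[OF S(1)]) (auto simp: S_def)
      have bmin: "b \<le> x" if "x \<in> L" "s < x" for x unfolding b_def by (rule cInf_lower[OF _ S(2)]) (use that in \<open>auto simp: S_def\<close>)
      have bL: "b \<in> L"
      proof -
        have "b \<in> closure S" unfolding b_def by (rule closure_contains_Inf[OF S])
        also have "closure S \<subseteq> L" by (rule closure_minimal[OF _ cL]) (auto simp: S_def)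
        finally show ?thesis .
      qed
      \<comment> \<open>Either \<open>s\<close> is the left end of a gap, whose mass is exact and
        which carries no weight because \<open>s\<close> is not in \<open>P\<close>; or points of
        \<open>L\<close> accumulate at \<open>s\<close> from the right, and then mass and weight up
        to a close one are small.\<close>
      show ?thesis
      proof (cases "s < b")
        case True
        have "{s<..<b} \<inter> K = {}"
        proof -
          have False if "x \<in> K" "s < x" "x < b" for x
          proof -
            have "x \<in> L" using that L[OF s(1)] L[OF bL] by (auto simp: L_def)
            then show False using bmin[of x] that by simp
          qed
          then show ?thesis by auto
        qed
        then have "mass s b = sqrt (b\<^sup>2 - s\<^sup>2)"
          using L[OF s(1)] L[OF bL] True double[of s b] by (intro mass_gap) auto
        moreover have "weight (\<lambda>x. x \<in> P \<and> s \<le> x \<and> x < b) = weight (\<lambda>x. False)"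
        proof -
          have "\<not> (x \<in> P \<and> s \<le> x \<and> x < b)" for x using bmin[of x] PL s(2) by (cases "x = s") (auto simp: subset_iff)
          then show ?thesis by (intro arg_cong[of _ _ weight]) auto
        qed
        ultimately show ?thesis using \<psi>_diff[OF s(1) bL] True e by (intro bexI[OF _ bL]) (auto simp: weight_def)
      next
        case False
        then have bs: "b = s" using sb by simp
        obtain d1 where d1: "d1 > 0" "\<And>t. t \<in> {s..v} \<Longrightarrow> \<bar>t - s\<bar> < d1 \<Longrightarrow> \<bar>mass s t - mass s s\<bar> < e / 2"
          using mass_continuous[of s s v "e / 2"] L[OF s(1)] e by auto
        obtain d2 where d2: "d2 > 0" "weight (\<lambda>x. 0 < \<bar>x - s\<bar> \<and> \<bar>x - s\<bar> < d2) \<le> e / 2"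
          using weight_tail[of "e / 2" s] e by auto
        have "Inf S < s + min d1 d2" using bs d1(1) d2(1) by (simp add: b_def)
        then obtain x where x: "x \<in> S" "x < s + min d1 d2" using cInf_less_iff[OF S] by blast
        then have xL: "x \<in> L" "s < x" by (auto simp: S_def)
        have xd: "x < s + d1" "x < s + d2" using x(2) by auto
        have "\<bar>mass s x - mass s s\<bar> < e / 2" using xd xL L[OF xL(1)] by (intro d1(2)) auto
        then have "mass s x < e / 2" by (simp add: mass_refl)
        moreover have "weight (\<lambda>y. y \<in> P \<and> s \<le> y \<and> y < x) \<le> weight (\<lambda>x. 0 < \<bar>x - s\<bar> \<and> \<bar>x - s\<bar> < d2)"
          using s(2) xd by (intro weight_mono) (auto simp: less_le)
        moreover have "0 \<le> sqrt (x\<^sup>2 - s\<^sup>2)" using xL L(4)[OF s(1)] by (simp add: power_mono)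
        ultimately have "\<psi> s \<le> \<psi> x + sqrt (x\<^sup>2 - s\<^sup>2) + e" using \<psi>_diff[OF s(1) xL(1)] xL(2) d2(2) by linarith
        then show ?thesis using xL by blast
      qed
    qed
    show "\<exists>d>0. \<forall>b\<in>L. s - d < b \<longrightarrow> b \<le> s \<longrightarrow> \<psi> b \<le> \<psi> s + e" if s: "s \<in> L" and e: "e > 0" for s e
    proof -
      obtain d1 where d1: "d1 > 0" "\<And>t. t \<in> {u..v} \<Longrightarrow> \<bar>t - s\<bar> < d1 \<Longrightarrow> \<bar>mass u t - mass u s\<bar> < e / 2"
        using mass_continuous[of u s v "e / 2"] L[OF s] uv e by auto
      obtain d2 where d2: "d2 > 0" "weight (\<lambda>x. 0 < \<bar>x - s\<bar> \<and> \<bar>x - s\<bar> < d2) \<le> e / 2"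
        using weight_tail[of "e / 2" s] e by auto
      have "\<psi> b \<le> \<psi> s + e" if b: "b \<in> L" "s - min d1 d2 < b" "b \<le> s" for b
      proof -
        have "mass u b + mass b s = mass u s" using uv L[OF b(1)] b(3) by (intro mass_add) auto
        moreover have "\<bar>mass u b - mass u s\<bar> < e / 2" using L[OF b(1)] b by (intro d1(2)) auto
        moreover have "weight (\<lambda>y. y \<in> P \<and> b \<le> y \<and> y < s) \<le> weight (\<lambda>x. 0 < \<bar>x - s\<bar> \<and> \<bar>x - s\<bar> < d2)"
          using b by (intro weight_mono) auto
        ultimately show ?thesis using \<psi>_diff[OF b(1) s b(3)] d2(2) by linarith
      qed
      then show ?thesis using d1(1) d2(1) by (intro exI[of _ "min d1 d2"]) auto
    qed
  qed
  then show ?thesis unfolding L_def P_def by blast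
qed

text \<open>The levels of this function cut \<open>(0, M]\<close> into pieces. The logarithm makes
  it strictly decreasing and unbounded near 0 whatever \<open>dens\<close> is, and a unit increment
  meets the smallness condition of \<open>piece_profile\<close>.\<close>

definition height :: "real \<Rightarrow> real" where "height s = mass s M + 2 * ln (M / s)"

lemma height_diff:
  assumes "0 < a" "a \<le> b" "b \<le> M"
  shows "height a - height b = mass a b + 2 * ln (b / a)"
  using assms mass_add[of a b M] by (simp add: height_def ln_div)

lemma height_less: "0 < a \<Longrightarrow> a < b \<Longrightarrow> b \<le> M \<Longrightarrow> height b < height a"
  using height_diff[of a b] mass_nonneg[of a b] by (simp add: ln_div) (smt (verit) ln_less_cancel_iff)

lemma height_attained:
  assumes "0 \<le> y" shows "\<exists>c. 0 < c \<and> c \<le> M \<and> height c = y"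
proof -
  define s where "s = M * exp (- y)"
  have s: "0 < s" "s \<le> M" using assms M_pos by (auto simp: s_def mult_left_le)
  have "M / s = exp y" using M_pos by (simp add: s_def exp_minus field_simps)
  then have "y \<le> height s" using mass_nonneg[OF s(1), of M] assms by (simp add: height_def)
  moreover have "height M \<le> y" using assms M_pos by (simp add: height_def mass_refl)
  moreover have "continuous_on {s..M} height"
  proof -
    have "continuous_on {s..M} (\<lambda>t. integral {s..t} dens)"
      by (rule indefinite_integral_continuous_1) (rule dens_integrable[OF s(1)])
    then have "continuous_on {s..M} (\<lambda>t. mass s M - integral {s..t} dens + 2 * ln (M / t))"
      using s M_pos by (intro continuous_intros) auto
    then show ?thesis
    proof (rule continuous_on_eq)
      fix t assume "t \<in> {s..M}"
      then show "mass s M - integral {s..t} dens + 2 * ln (M / t) = height t"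
        using mass_add[of s t M] s by (simp add: height_def mass_def)
    qed
  qed
  ultimately obtain c where "s \<le> c" "c \<le> M" "height c = y" using IVT2'[of height M y s] s(2) by blast
  then show ?thesis using s by (intro exI[of _ c]) auto
qed

theorem nondiff_radii_exists: "\<exists>A :: (real^2) set. A \<noteq> {} \<and> compact A \<and> N = nondiff_radii A"
proof -
  have "\<forall>i::nat. \<exists>c. 0 < c \<and> c \<le> M \<and> height c = real i" using height_attained by simp
  then obtain c where c: "\<And>i. 0 < c i" "\<And>i. c i \<le> M" "\<And>i. height (c i) = real i" by metis
  have le_iff: "a \<le> b" if "height b \<le> height a" "0 < a" "0 < b" "a \<le> M" "b \<le> M" for a b
  proof (rule ccontr)
    assume "\<not> a \<le> b"
    then have "height a < height b" using that by (intro height_less) auto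
    then show False using that(1) by simp
  qed
  have dec: "c (Suc i) \<le> c i" for i by (rule le_iff) (simp_all add: c)
  define g where "g x = x * dens x" for x
  define E where "E n = integral {c n..c 0} g" for n
  have gint: "g integrable_on {a..b}" for a b unfolding g_def by (rule xdens_integrable)
  have cn0: "c n \<le> c 0" for n
  proof (induction n)
    case (Suc n)
    then show ?case using dec[of n] by simp
  qed simp
  \<comment> \<open>Multiply the unit increment of \<open>height\<close> by
    \<open>c (Suc i)\<close>: the mass term is at most the integral of \<open>x * dens x\<close>
    over the piece, and \<open>ln y \<le> y - 1\<close> makes the logarithmic term telescope.
    Summing bounds the heights of the strips.\<close>
  have step: "c (Suc i) \<le> integral {c (Suc i)..c i} g + 2 * (c i - c (Suc i))" for i
  proof -
    have one: "mass (c (Suc i)) (c i) + 2 * ln (c i / c (Suc i)) = 1"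
      using height_diff[OF c(1) dec c(2), of i] c(3) by simp
    have "c (Suc i) * mass (c (Suc i)) (c i) = integral {c (Suc i)..c i} (\<lambda>x. c (Suc i) * dens x)" by (simp add: mass_def)
    also have "\<dots> \<le> integral {c (Suc i)..c i} g"
      unfolding g_def using dens_nonneg c(1)
      by (intro integral_le integrable_on_mult_right dens_integrable xdens_integrable mult_right_mono) auto
    finally have 1: "c (Suc i) * mass (c (Suc i)) (c i) \<le> integral {c (Suc i)..c i} g" .
    have "ln (c i / c (Suc i)) \<le> c i / c (Suc i) - 1" using c(1) by (intro ln_le_minus_one) auto
    then have "c (Suc i) * ln (c i / c (Suc i)) \<le> c (Suc i) * (c i / c (Suc i) - 1)" using c(1)[of "Suc i"] by (intro mult_left_mono) auto
    also have "\<dots> = c i - c (Suc i)" using c(1)[of "Suc i"] by (simp add: field_simps)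
    finally have 2: "c (Suc i) * ln (c i / c (Suc i)) \<le> c i - c (Suc i)" .
    have "c (Suc i) = c (Suc i) * (mass (c (Suc i)) (c i) + 2 * ln (c i / c (Suc i)))" unfolding one by simp
    also have "\<dots> = c (Suc i) * mass (c (Suc i)) (c i) + 2 * (c (Suc i) * ln (c i / c (Suc i)))" by (simp add: algebra_simps)
    also have "\<dots> \<le> integral {c (Suc i)..c i} g + 2 * (c i - c (Suc i))"
      using 1 2 by (intro add_mono mult_left_mono) auto
    finally show ?thesis .
  qed
  have part: "(\<Sum>i<n. c (Suc i)) \<le> E n + 2 * (c 0 - c n)" for n
  proof (induction n)
    case 0 then show ?case by (simp add: E_def)
  next
    case (Suc n)
    have "integral {c (Suc n)..c n} g + E n = E (Suc n)"
      unfolding E_def by (rule Henstock_Kurzweil_Integration.integral_combine[OF dec cn0 gint])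
    then show ?case using Suc step[of n] by simp
  qed
  have "summable (\<lambda>i. c (Suc i))"
  proof (rule summableI_nonneg_bounded)
    fix n
    have le: "E n \<le> integral {0..M} g"
      unfolding E_def using c(1)[of n] c(2)[of 0] xdens_nonneg by (intro integral_subset_le gint) (auto simp: g_def)
    have "c 0 - c n \<le> M" using c(1)[of n] c(2)[of 0] by simp
    then have "E n + 2 * (c 0 - c n) \<le> integral {0..M} g + 2 * M" using le by (intro add_mono mult_left_mono) auto
    with part[of n] show "(\<Sum>i<n. c (Suc i)) \<le> integral {0..M} g + 2 * M" by (rule order_trans)
  qed (use c(1) in \<open>auto intro: less_imp_le\<close>)
  then have sc: "summable c" by (simp add: summable_Suc_iff)
  have "\<exists>\<psi>. hole_profile (K \<inter> {c (Suc i)..c i}) (N \<inter> {c (Suc i)..c i}) \<psi> 3" for i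
    using height_diff[OF c(1) dec c(2), of i] c(3) by (intro piece_profile c dec) simp
  then obtain \<psi> where \<psi>: "\<And>i. hole_profile (K \<inter> {c (Suc i)..c i}) (N \<inter> {c (Suc i)..c i}) (\<psi> i) 3" by metis
  have "\<exists>A :: (real^2) set. A \<noteq> {} \<and> compact A \<and> (\<Union>i. N \<inter> {c (Suc i)..c i}) = nondiff_radii A"
    by (rule nondiff_radii_of_holes[OF c(1) sc _ \<psi>]) auto
  moreover have "(\<Union>i. N \<inter> {c (Suc i)..c i}) = N"
  proof -
    have "\<exists>i. s \<in> {c (Suc i)..c i}" if "s \<in> N" for s
    proof -
      have s: "0 < s" "s \<le> M" using that N(2,3) K_sub by auto
      define i where "i = nat \<lfloor>height s\<rfloor>"
      have "0 \<le> height s" using mass_nonneg[OF s(1), of M] s by (simp add: height_def)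
      then have "real i \<le> height s" "height s \<le> real (Suc i)" unfolding i_def by linarith+
      note i = this
      have "s \<le> c i" by (rule le_iff) (simp_all only: s c i)
      moreover have "c (Suc i) \<le> s" by (rule le_iff) (simp_all only: s c i)
      ultimately show ?thesis by auto
    qed
    then show ?thesis by blast
  qed
  ultimately show ?thesis by simp
qed

end

subsection \<open>The characterization\<close>

lemma gap_sum_half_empty: "gap_sum_half {} = 0"
proof -
  have "gaps {} = {}" by (subst gaps_eq) auto
  then show ?thesis by (simp add: gap_sum_half_def)
qed

text \<open>Truncation from below only removes gaps: both ends of a remaining gap are at least
  \<open>r\<close>, so nothing of \<open>K\<close> was cut away between them.\<close>

lemma gap_sum_half_Int_le:
  assumes K: "closed K" shows "gap_sum_half (K \<inter> {r..}) \<le> gap_sum_half K"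
proof -
  have "closed (K \<inter> {r..})" using K by (intro closed_Int) auto
  then have "gaps (K \<inter> {r..}) \<subseteq> gaps K"
    unfolding gaps_eq[OF K] by (subst gaps_eq) fastforce+
  then show ?thesis
    unfolding gap_sum_half_def by (simp add: nonneg_infsum_complete) (intro SUP_subset_mono, auto)
qed

lemma nondiff_radii_characterization:
  fixes N :: "real set"
  assumes N: "N \<subseteq> {0<..}" "bounded N" "countable N"
  shows "(\<exists>A :: (real^2) set. A \<noteq> {} \<and> compact A \<and> N = nondiff_radii A) \<longleftrightarrow>
    emeasure lborel (closure N) = 0 \<and>
    (\<integral>\<^sup>+r\<in>{0<..}. (gap_sum_half (closure N \<inter> {r..}) * ennreal (sqrt r)) \<partial>lborel) < \<infinity>"
proof
  assume "\<exists>A :: (real^2) set. A \<noteq> {} \<and> compact A \<and> N = nondiff_radii A"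
  then obtain A :: "(real^2) set" where A: "A \<noteq> {}" "compact A" "N = nondiff_radii A" by blast
  then have "N \<subseteq> critical_values A" using nondiff_radii_subset_critical_values by blast
  from critical_values_gap_sum[OF A(2,1) this]
  show "emeasure lborel (closure N) = 0 \<and>
    (\<integral>\<^sup>+r\<in>{0<..}. (gap_sum_half (closure N \<inter> {r..}) * ennreal (sqrt r)) \<partial>lborel) < \<infinity>" by blast
next
  assume asm: "emeasure lborel (closure N) = 0 \<and>
    (\<integral>\<^sup>+r\<in>{0<..}. (gap_sum_half (closure N \<inter> {r..}) * ennreal (sqrt r)) \<partial>lborel) < \<infinity>"
  show "\<exists>A :: (real^2) set. A \<noteq> {} \<and> compact A \<and> N = nondiff_radii A"
  proof (cases "N = {}")
    case True
    \<comment> \<open>With all holes empty, \<open>A\<close> is a full rectangle.\<close>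
    have "\<exists>A :: (real^2) set. A \<noteq> {} \<and> compact A \<and> (\<Union>i::nat. {}) = nondiff_radii A"
    proof (rule nondiff_radii_of_holes[where T = "\<lambda>i. (1/2) ^ i" and C = 0 and K = "\<lambda>_. {}" and N = "\<lambda>_. {}"])
      show "hole_profile {} {} (\<lambda>_. 0) 0" by unfold_locales auto
    qed (auto intro: summable_geometric)
    then show ?thesis using True by simp
  next
    case False
    define K where "K = closure N"
    define M where "M = Sup K"
    have K: "closed K" "bdd_above K" "K \<noteq> {}"
      using N(2) False by (auto simp: K_def intro: bounded_imp_bdd_above bounded_closure)
    have MK: "M \<in> K" unfolding M_def by (rule closed_contains_Sup[OF K(3,2,1)])
    have "K \<subseteq> {0..}" unfolding K_def by (rule closure_minimal) (use N(1) in auto)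
    then have K0M: "K \<subseteq> {0..M}" using cSup_upper[OF _ K(2)] by (auto simp: M_def)
    obtain n where "n \<in> N" using False by blast
    then have "0 < n" "n \<in> K" using N(1) closure_subset by (auto simp: K_def)
    then have M0: "M > 0" using K0M by force
    have nc: "null_compact K M" by unfold_locales (use K MK K0M M0 asm in \<open>auto simp: K_def\<close>)
    have fin: "(\<integral>\<^sup>+x. ennreal (x * null_compact.dens K M x) \<partial>lborel) < \<infinity>"
      by (rule null_compact.dens_integral_finite[OF nc]) (use asm in \<open>simp add: K_def\<close>)
    have "gap_profile K M N"
      unfolding gap_profile_def gap_profile_axioms_def
      using nc fin N(1,3) False closure_subset by (auto simp: K_def)
    then show ?thesis by (rule gap_profile.nondiff_radii_exists)
  qed
qed

text \<open>For \<open>r \<le> \<epsilon>\<close> the truncation leaves \<open>K\<close> unchanged,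
  so the integral dominates a positive multiple of the full gap sum. In the other direction the
  integrand vanishes beyond a bound of \<open>K\<close> and truncation does not increase the gap
  sum.\<close>

lemma gap_sum_integral_finite_iff:
  assumes e: "\<epsilon> > 0" and K: "closed K" "bounded K" "K \<subseteq> {\<epsilon>..}"
  shows "(\<integral>\<^sup>+r\<in>{0<..}. (gap_sum_half (K \<inter> {r..}) * ennreal (sqrt r)) \<partial>lborel) < \<infinity> \<longleftrightarrow> gap_sum_half K < \<infinity>"
proof
  let ?I = "\<integral>\<^sup>+r\<in>{0<..}. (gap_sum_half (K \<inter> {r..}) * ennreal (sqrt r)) \<partial>lborel"
  assume fin: "?I < \<infinity>"
  have "gap_sum_half K * ennreal (sqrt (\<epsilon> / 2)) * emeasure lborel {\<epsilon> / 2..\<epsilon>}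
      = (\<integral>\<^sup>+r. gap_sum_half K * ennreal (sqrt (\<epsilon> / 2)) * indicator {\<epsilon> / 2..\<epsilon>} r \<partial>lborel)"
    by (rule nn_integral_cmult_indicator[symmetric]) auto
  also have "\<dots> \<le> ?I"
  proof (rule nn_integral_mono)
    fix r
    show "gap_sum_half K * ennreal (sqrt (\<epsilon> / 2)) * indicator {\<epsilon> / 2..\<epsilon>} r
        \<le> gap_sum_half (K \<inter> {r..}) * ennreal (sqrt r) * indicator {0<..} r"
    proof (cases "r \<in> {\<epsilon> / 2..\<epsilon>}")
      case True
      then have "K \<inter> {r..} = K" using K(3) by auto
      then show ?thesis using True e by (auto intro!: mult_left_mono ennreal_leI)
    qed simp
  qed
  finally have "gap_sum_half K * ennreal (sqrt (\<epsilon> / 2)) * emeasure lborel {\<epsilon> / 2..\<epsilon>} < \<infinity>" using fin by (rule le_less_trans)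
  then show "gap_sum_half K < \<infinity>" using e by (auto simp: ennreal_mult_less_top mult.assoc ennreal_mult_eq_top_iff less_top)
next
  assume fin: "gap_sum_half K < \<infinity>"
  obtain M where M: "M > 0" "\<And>x. x \<in> K \<Longrightarrow> \<bar>x\<bar> \<le> M" using K(2) by (auto simp: bounded_pos)
  have "(\<integral>\<^sup>+r\<in>{0<..}. (gap_sum_half (K \<inter> {r..}) * ennreal (sqrt r)) \<partial>lborel)
      \<le> (\<integral>\<^sup>+r. gap_sum_half K * ennreal (sqrt M) * indicator {0..M} r \<partial>lborel)"
  proof (rule nn_integral_mono)
    fix r
    show "gap_sum_half (K \<inter> {r..}) * ennreal (sqrt r) * indicator {0<..} r \<le> gap_sum_half K * ennreal (sqrt M) * indicator {0..M} r"
    proof (cases "r \<in> {0<..M}")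
      case True
      then show ?thesis using gap_sum_half_Int_le[OF K(1), of r] by (auto intro!: mult_mono ennreal_leI)
    next
      case False
      have "K \<inter> {r..} = {}" if "r > M" using M(2) that by force
      then show ?thesis using False by (cases "r > M") (auto simp: gap_sum_half_empty)
    qed
  qed
  also have "\<dots> = gap_sum_half K * ennreal (sqrt M) * ennreal M" using M by (subst nn_integral_cmult_indicator) auto
  also have "\<dots> < \<infinity>" using fin by (simp add: ennreal_mult_less_top)
  finally show "(\<integral>\<^sup>+r\<in>{0<..}. (gap_sum_half (K \<inter> {r..}) * ennreal (sqrt r)) \<partial>lborel) < \<infinity>" .
qed

theorem theorem1p3:
  shows "(\<forall>\<epsilon>::real. \<forall>N::real set.
            \<epsilon> > 0 \<longrightarrow> N \<subseteq> {\<epsilon>..} \<longrightarrow> bounded N \<longrightarrow> countable N \<longrightarrow>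
            ((\<exists>A :: (real ^ 2) set. A \<noteq> {} \<and> compact A \<and> N = nondiff_radii A) \<longleftrightarrow>
             emeasure lborel (closure N) = 0 \<and> gap_sum_half (closure N) < \<infinity>))
       \<and> (\<forall>N::real set.
            N \<subseteq> {0<..} \<longrightarrow> bounded N \<longrightarrow> countable N \<longrightarrow>
            ((\<exists>A :: (real ^ 2) set. A \<noteq> {} \<and> compact A \<and> N = nondiff_radii A) \<longleftrightarrow>
             emeasure lborel (closure N) = 0 \<and>
             (\<integral>\<^sup>+r\<in>{0<..}. (gap_sum_half (closure N \<inter> {r..}) * ennreal (sqrt r)) \<partial>lborel) < \<infinity>))"
proof (intro conjI allI impI)
  fix \<epsilon> :: real and N :: "real set"
  assume e: "\<epsilon> > 0" and N: "N \<subseteq> {\<epsilon>..}" "bounded N" "countable N"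
  have "N \<subseteq> {0<..}" using e N(1) by auto
  moreover have "closure N \<subseteq> {\<epsilon>..}" using N(1) by (intro closure_minimal) auto
  ultimately show "(\<exists>A :: (real ^ 2) set. A \<noteq> {} \<and> compact A \<and> N = nondiff_radii A) \<longleftrightarrow>
      emeasure lborel (closure N) = 0 \<and> gap_sum_half (closure N) < \<infinity>"
    using nondiff_radii_characterization[of N] N gap_sum_integral_finite_iff[OF e, of "closure N"]
    by (simp add: bounded_closure)
qed (rule nondiff_radii_characterization)

end
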